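(* Let $A$ be a finite dimensional Hopf algebra over a field $k$ and let $S$ be a left coideal subalgebra of $A$. Then the following are equivalent: (i) $S$ is left normal, i.e. closed under the left adjoint action of $A$; (ii) $S$ is a right depth two subalgebra of $A$; (iii) the extension $S\subset A$ is normal in the sense of Rieffel.
   Context: Sweedler notation $\Delta(a)=a_1\otimes a_2$ with summation omitted; $\sigma$ denotes the antipode of $A$. A left coideal subalgebra $S$ of $A$ is a subalgebra with $\Delta(S)\subset A\otimes S$. It is left normal if $a_1x\sigma(a_2)\in S$ for all $a\in A$, $x\in S$. An extension of algebras $B\subset A$ is right depth two if $A\otimes_BA$ is isomorphic to a direct summand of $A^n$ for some $n\ge1$ in the category of $(A,B)$-bimodules (left $A$, right $B$). For an extension $B\subset A$ of finite dimensional $k$-algebras, an ideal $J$ of $B$ is called $A$-invariant if $AJ=JA$; the extension is normal in the sense of Rieffel if for every maximal two-sided ideal $I$ of $A$ the ideal $B\cap I$ of $B$ is $A$-invariant. *)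

theory Defs
  imports
    "HOL-Library.Set_Algebras"
    "HOL-Library.Function_Algebras"
    "HOL-Library.Poly_Mapping"
    "HOL-Computational_Algebra.Group_Closure"
    "HOL-Algebra.Algebraic_Closure_Type"
begin

section \<open>Tensor products\<close>

text \<open>
  \<open>M \<otimes>\<^sub>R N\<close> is the free abelian group on \<open>M \<times> N\<close> modulo the subgroup of relations below.
  Its elements are represented as cosets, and a sum of two of them is the Minkowski sum of
  \<^theory>\<open>HOL-Library.Set_Algebras\<close>. Here \<open>R\<close> acts on \<open>M\<close> from the right by \<open>ract\<close> and on
  \<open>N\<close> from the left by \<open>lact\<close>.
\<close>

type_synonym 'x frag = "'x \<Rightarrow>\<^sub>0 int"

definition tensor_rel ::
    "('m::ab_group_add \<Rightarrow> 'r \<Rightarrow> 'm) \<Rightarrow> ('r \<Rightarrow> 'n::ab_group_add \<Rightarrow> 'n) \<Rightarrow> 'r set \<Rightarrow> ('m \<times> 'n) frag set"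
  where
  "tensor_rel ract lact R = group_closure
     ({frag_of (x + x', y) - frag_of (x, y) - frag_of (x', y) | x x' y. True} \<union>
      {frag_of (x, y + y') - frag_of (x, y) - frag_of (x, y') | x y y'. True} \<union>
      {frag_of (ract x r, y) - frag_of (x, lact r y) | x y r. r \<in> R})"

definition coset :: "'x frag set \<Rightarrow> 'x frag \<Rightarrow> 'x frag set" where
  "coset N u = u +o N"

definition quotient_space :: "'x frag set \<Rightarrow> 'x frag set set" where
  "quotient_space N = range (coset N)"

text \<open>
  Maps out of a tensor product are evaluated on a representative. They are only used for maps that
  respect the defining relations, so that the choice is irrelevant.
\<close>

definition tensor_rep :: "'x frag set \<Rightarrow> 'x frag" where
  "tensor_rep t = (SOME u. u \<in> t)"

definition tensor_map :: "'y frag set \<Rightarrow> ('x \<Rightarrow> 'y frag) \<Rightarrow> 'x frag set \<Rightarrow> 'y frag set" where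
  "tensor_map N f t = coset N (frag_extend f (tensor_rep t))"

definition tensor_eval :: "('m \<Rightarrow> 'n \<Rightarrow> 'c::ring_1) \<Rightarrow> ('m \<times> 'n) frag set \<Rightarrow> 'c" where
  "tensor_eval f t =
     (\<Sum>(x, y)\<in>Poly_Mapping.keys (tensor_rep t). of_int (Poly_Mapping.lookup (tensor_rep t) (x, y)) * f x y)"


section \<open>Algebras and Hopf algebras over a field\<close>

locale k_algebra = vector_space scale
  for scale :: "'k::field \<Rightarrow> 'a::ring_1 \<Rightarrow> 'a" +
  assumes scale_mult_left: "scale c (x * y) = scale c x * y"
    and scale_mult_right: "scale c (x * y) = x * scale c y"

text \<open>\<open>A \<otimes> A\<close> and \<open>A \<otimes> A \<otimes> A\<close> over \<open>k\<close>; the latter is built on triples, which avoids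
  the associator.\<close>

definition krel2 :: "('k::field \<Rightarrow> 'a::ring_1 \<Rightarrow> 'a) \<Rightarrow> ('a \<times> 'a) frag set" where
  "krel2 scale = tensor_rel (\<lambda>x c. scale c x) scale UNIV"

definition krel3 :: "('k::field \<Rightarrow> 'a::ring_1 \<Rightarrow> 'a) \<Rightarrow> ('a \<times> 'a \<times> 'a) frag set" where
  "krel3 scale = group_closure
     ({frag_of (x + x', y, z) - frag_of (x, y, z) - frag_of (x', y, z) | x x' y z. True} \<union>
      {frag_of (x, y + y', z) - frag_of (x, y, z) - frag_of (x, y', z) | x y y' z. True} \<union>
      {frag_of (x, y, z + z') - frag_of (x, y, z) - frag_of (x, y, z') | x y z z'. True} \<union>
      {frag_of (scale c x, y, z) - frag_of (x, scale c y, z) | x y z c. True} \<union>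
      {frag_of (x, scale c y, z) - frag_of (x, y, scale c z) | x y z c. True})"

definition tensor_scale ::
    "('k::field \<Rightarrow> 'a::ring_1 \<Rightarrow> 'a) \<Rightarrow> 'k \<Rightarrow> ('a \<times> 'a) frag set \<Rightarrow> ('a \<times> 'a) frag set" where
  "tensor_scale scale c = tensor_map (krel2 scale) (\<lambda>(x, y). frag_of (scale c x, y))"

definition tensor_mult ::
    "('k::field \<Rightarrow> 'a::ring_1 \<Rightarrow> 'a) \<Rightarrow> ('a \<times> 'a) frag set \<Rightarrow> ('a \<times> 'a) frag set \<Rightarrow> ('a \<times> 'a) frag set"
  where
  "tensor_mult scale t t' =
     tensor_map (krel2 scale)
       (\<lambda>(x, y). frag_extend (\<lambda>(x', y'). frag_of (x * x', y * y')) (tensor_rep t')) t"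

locale hopf_algebra = k_algebra scale
  for scale :: "'k::field \<Rightarrow> 'a::ring_1 \<Rightarrow> 'a" +
  fixes \<Delta> :: "'a \<Rightarrow> ('a \<times> 'a) frag set"
    and \<epsilon> :: "'a \<Rightarrow> 'k"
    and \<sigma> :: "'a \<Rightarrow> 'a"
  assumes comult_in: "\<Delta> a \<in> quotient_space (krel2 scale)"
    and comult_add: "\<Delta> (a + b) = \<Delta> a + \<Delta> b"
    and comult_scale: "\<Delta> (scale c a) = tensor_scale scale c (\<Delta> a)"
    and comult_one: "\<Delta> 1 = coset (krel2 scale) (frag_of (1, 1))"
    and comult_mult: "\<Delta> (a * b) = tensor_mult scale (\<Delta> a) (\<Delta> b)"
    and coassoc:
      "tensor_map (krel3 scale)
         (\<lambda>(x, y). frag_extend (\<lambda>(p, q). frag_of (p, q, y)) (tensor_rep (\<Delta> x))) (\<Delta> a) =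
       tensor_map (krel3 scale)
         (\<lambda>(x, y). frag_extend (\<lambda>(p, q). frag_of (x, p, q)) (tensor_rep (\<Delta> y))) (\<Delta> a)"
    and counit_linear: "Vector_Spaces.linear scale (*) \<epsilon>"
    and counit_one: "\<epsilon> 1 = 1"
    and counit_mult: "\<epsilon> (a * b) = \<epsilon> a * \<epsilon> b"
    and counit_left: "tensor_eval (\<lambda>x y. scale (\<epsilon> x) y) (\<Delta> a) = a"
    and counit_right: "tensor_eval (\<lambda>x y. scale (\<epsilon> y) x) (\<Delta> a) = a"
    and antipode_linear: "Vector_Spaces.linear scale scale \<sigma>"
    and antipode_left: "tensor_eval (\<lambda>x y. \<sigma> x * y) (\<Delta> a) = scale (\<epsilon> a) 1"
    and antipode_right: "tensor_eval (\<lambda>x y. x * \<sigma> y) (\<Delta> a) = scale (\<epsilon> a) 1"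

definition subalgebra :: "('k::field \<Rightarrow> 'a::ring_1 \<Rightarrow> 'a) \<Rightarrow> 'a set \<Rightarrow> bool" where
  "subalgebra scale S \<longleftrightarrow> module.subspace scale S \<and> 1 \<in> S \<and> (\<forall>x\<in>S. \<forall>y\<in>S. x * y \<in> S)"

text \<open>\<open>A \<otimes> S\<close> is identified with its image in \<open>A \<otimes> A\<close>, as usual over a field.\<close>

definition left_coideal_subalgebra ::
    "('k::field \<Rightarrow> 'a::ring_1 \<Rightarrow> 'a) \<Rightarrow> ('a \<Rightarrow> ('a \<times> 'a) frag set) \<Rightarrow> 'a set \<Rightarrow> bool" where
  "left_coideal_subalgebra scale \<Delta> S \<longleftrightarrow>
     subalgebra scale S \<and>
     \<Delta> ` S \<subseteq> {coset (krel2 scale) u | u. Poly_Mapping.keys u \<subseteq> UNIV \<times> S}"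

definition left_normal ::
    "('a \<Rightarrow> ('a \<times> 'a) frag set) \<Rightarrow> ('a \<Rightarrow> 'a) \<Rightarrow> 'a::ring_1 set \<Rightarrow> bool" where
  "left_normal \<Delta> \<sigma> S \<longleftrightarrow> (\<forall>a. \<forall>x\<in>S. tensor_eval (\<lambda>p q. p * x * \<sigma> q) (\<Delta> a) \<in> S)"


section \<open>Depth two and normality of a ring extension \<open>B \<subseteq> A\<close>, where \<open>A\<close> is the whole type\<close>

text \<open>\<open>A\<^sup>n\<close> consists of the functions on \<open>nat\<close> vanishing from \<open>n\<close> on; sums and zero are those of
  \<^theory>\<open>HOL-Library.Function_Algebras\<close>.\<close>

definition free_mod :: "nat \<Rightarrow> (nat \<Rightarrow> 'a::ring_1) set" where
  "free_mod n = {v. \<forall>i\<ge>n. v i = 0}"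

definition subbimodule :: "'a::ring_1 set \<Rightarrow> nat \<Rightarrow> (nat \<Rightarrow> 'a) set \<Rightarrow> bool" where
  "subbimodule B n M \<longleftrightarrow>
     M \<subseteq> free_mod n \<and> 0 \<in> M \<and> (\<forall>v\<in>M. \<forall>w\<in>M. v + w \<in> M) \<and>
     (\<forall>a. \<forall>v\<in>M. (\<lambda>i. a * v i) \<in> M) \<and> (\<forall>b\<in>B. \<forall>v\<in>M. (\<lambda>i. v i * b) \<in> M)"

definition balanced_rel :: "'a::ring_1 set \<Rightarrow> ('a \<times> 'a) frag set" where
  "balanced_rel B = tensor_rel (*) (*) B"

definition right_depth_two :: "'a::ring_1 set \<Rightarrow> bool" where
  "right_depth_two B \<longleftrightarrow>
     (let N = balanced_rel B; T = quotient_space N in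
      \<exists>n\<ge>1. \<exists>M M' \<phi>.
        subbimodule B n M \<and> subbimodule B n M' \<and> M \<inter> M' = {0} \<and> M + M' = free_mod n \<and>
        bij_betw \<phi> T M \<and>
        (\<forall>t\<in>T. \<forall>t'\<in>T. \<phi> (t + t') = \<phi> t + \<phi> t') \<and>
        (\<forall>a. \<forall>t\<in>T. \<phi> (tensor_map N (\<lambda>(x, y). frag_of (a * x, y)) t) = (\<lambda>i. a * \<phi> t i)) \<and>
        (\<forall>b\<in>B. \<forall>t\<in>T. \<phi> (tensor_map N (\<lambda>(x, y). frag_of (x, y * b)) t) = (\<lambda>i. \<phi> t i * b)))"

definition add_prod :: "'a::ring_1 set \<Rightarrow> 'a set \<Rightarrow> 'a set" where
  "add_prod P Q = group_closure {x * y | x y. x \<in> P \<and> y \<in> Q}"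

definition invariant_ideal :: "'a::ring_1 set \<Rightarrow> bool" where
  "invariant_ideal J \<longleftrightarrow> add_prod UNIV J = add_prod J UNIV"

text \<open>In \<^theory>\<open>HOL-Algebra.Ideal\<close>, ideals are two-sided.\<close>

definition rieffel_normal :: "'a::ring_1 set \<Rightarrow> bool" where
  "rieffel_normal B \<longleftrightarrow>
     (\<forall>I :: 'a set. maximalideal I ring_of_type_algebra \<longrightarrow> invariant_ideal (B \<inter> I))"

end

theory Submission
  imports Defs
begin

text \<open>
  Let \<open>S\<^sup>+\<close> be the kernel of the counit on \<open>S\<close>. Each of the three conditions is equivalent to
  \<open>A S\<^sup>+ \<subseteq> S\<^sup>+ A\<close>.

  Left normality gives \<open>a x = (a\<^sub>1 x \<sigma>(a\<^sub>2)) a\<^sub>3\<close> and \<open>x a = a\<^sub>3 (\<sigma>\<inverse>(a\<^sub>2) x a\<^sub>1)\<close>, hence the inclusion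
  and Rieffel normality; Rieffel normality gives the inclusion for the maximal ideal \<open>ker \<epsilon>\<close>. Given
  the inclusion, the Galois map \<open>a \<otimes> b \<mapsto> a b\<^sub>1 \<otimes> b\<^sub>2\<close> is an isomorphism of bimodules from \<open>A \<otimes>\<^sub>S A\<close> to
  the free module \<open>A \<otimes> A / S\<^sup>+ A\<close>. Conversely, for depth two, write \<open>1 \<otimes> a x\<close> through a splitting as
  \<open>\<Sum>\<^sub>i c\<^sub>i x t\<^sub>i\<close> and apply \<open>\<epsilon> \<otimes> id\<close>.

  It remains to pass from the inclusion to left normality. Then \<open>K = S\<^sup>+ A\<close> is an ideal, the elements
  \<open>a\<^sub>1 x \<sigma>(a\<^sub>2)\<close> lie in the left coideal subalgebra \<open>S'\<close> of coinvariants of \<open>A \<rightarrow> A / K\<close>, and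
  \<open>S \<subseteq> S'\<close> have the same \<open>S\<^sup>+ A = S'\<^sup>+ A\<close>. So \<open>S = S'\<close> follows from
  \<open>dim S * dim (A / S\<^sup>+ A) = dim A\<close>, valid for every left coideal subalgebra. To prove this formula,
  let \<open>\<rho>\<close> be the maximum of \<open>dim (A / L A) / dim (S / L)\<close> over the proper right ideals \<open>L\<close> of \<open>S\<close>. The
  ideals attaining it are closed under intersection and, by the diagonal action on
  \<open>A \<otimes> S / L\<close>, under \<open>L \<mapsto> {s. \<Delta> s \<in> A \<otimes> L}\<close>. The smallest one is therefore a left coideal, so it
  is \<open>0\<close>, as otherwise it would generate \<open>A\<close>. Hence \<open>\<rho> = dim A / dim S\<close>, and the submodule \<open>S\<^sup>+\<close> of
  \<open>S\<close> attains it too.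
\<close>

section \<open>Additive maps and tensor products\<close>

text \<open>Plain additivity is the right level here: tensors are represented in a free abelian
  group, which carries no action of \<open>k\<close>.\<close>

definition additive_map :: "('x::ab_group_add \<Rightarrow> 'y::ab_group_add) \<Rightarrow> bool" where
  "additive_map h \<longleftrightarrow> (\<forall>u v. h (u + v) = h u + h v)"

lemma additive_map_simps:
  assumes "additive_map h"
  shows "h (u + v) = h u + h v" "h 0 = 0" "h (- u) = - h u" "h (u - v) = h u - h v"
    "h (\<Sum>i\<in>I. g i) = (\<Sum>i\<in>I. h (g i))"
proof -
  show *: "h (u + v) = h u + h v" for u v using assms by (simp add: additive_map_def)
  show 0: "h 0 = 0" using *[of 0 0] by simp
  show m: "h (- u) = - h u" for u using *[of u "- u"] 0 by (metis add.right_inverse add_eq_0_iff)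
  show "h (u - v) = h u - h v" using *[of u "- v"] m by simp
  show "h (\<Sum>i\<in>I. g i) = (\<Sum>i\<in>I. h (g i))"
    by (induction I rule: infinite_finite_induct) (auto simp: * 0)
qed

lemma group_closure_closed:
  assumes "u \<in> group_closure G" "\<And>g. g \<in> G \<Longrightarrow> P g" "P 0" "\<And>s t. P s \<Longrightarrow> P t \<Longrightarrow> P (s - t)"
  shows "P u"
  using assms(1) by induction (use assms in auto)

lemma additive_map_vanish_group_closure:
  assumes "additive_map h" "u \<in> group_closure G" "\<And>g. g \<in> G \<Longrightarrow> h g = 0"
  shows "h u = 0"
  by (rule group_closure_closed[OF assms(2)]) (use assms in \<open>auto simp: additive_map_simps\<close>)

definition is_subgroup :: "'x::ab_group_add set \<Rightarrow> bool" where
  "is_subgroup N \<longleftrightarrow> 0 \<in> N \<and> (\<forall>u\<in>N. \<forall>v\<in>N. u - v \<in> N)"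

lemma is_subgroupD:
  assumes "is_subgroup N"
  shows "0 \<in> N" "u \<in> N \<Longrightarrow> v \<in> N \<Longrightarrow> u - v \<in> N" "u \<in> N \<Longrightarrow> v \<in> N \<Longrightarrow> u + v \<in> N" "u \<in> N \<Longrightarrow> - u \<in> N"
proof -
  show 0: "0 \<in> N" and d: "u \<in> N \<Longrightarrow> v \<in> N \<Longrightarrow> u - v \<in> N" for u v
    using assms by (auto simp: is_subgroup_def)
  show m: "u \<in> N \<Longrightarrow> - u \<in> N" for u using d[OF 0, of u] by simp
  show "u \<in> N \<Longrightarrow> v \<in> N \<Longrightarrow> u + v \<in> N" using d[of u "- v"] m[of v] by simp
qed

lemma is_subgroup_sum:
  assumes "is_subgroup N" "\<And>i. i \<in> I \<Longrightarrow> f i \<in> N"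
  shows "(\<Sum>i\<in>I. f i) \<in> N"
  using assms(2) by (induction I rule: infinite_finite_induct) (auto simp: is_subgroupD[OF assms(1)])

lemma is_subgroup_group_closure: "is_subgroup (group_closure G)"
  by (auto simp: is_subgroup_def intro: group_closure.diff)

section \<open>Cosets and their chosen representatives\<close>

lemma mem_coset: "u \<in> coset N v \<longleftrightarrow> u - v \<in> N"
  by (auto simp: coset_def elt_set_plus_def algebra_simps)
     (metis add_diff_cancel_left' diff_add_cancel)

lemma coset_eq_iff:
  assumes "is_subgroup N"
  shows "coset N u = coset N v \<longleftrightarrow> u - v \<in> N"
proof
  assume "coset N u = coset N v"
  moreover have "u \<in> coset N u" by (simp add: mem_coset is_subgroupD[OF assms])
  ultimately show "u - v \<in> N" by (simp add: mem_coset)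
next
  assume uv: "u - v \<in> N"
  have "w - u \<in> N \<longleftrightarrow> w - v \<in> N" for w
    using is_subgroupD(3)[OF assms, of "w - u" "u - v"] is_subgroupD(2)[OF assms, of "w - v" "u - v"] uv
    by auto
  then show "coset N u = coset N v" by (auto simp: mem_coset)
qed

lemma tensor_rep_coset:
  assumes "is_subgroup N"
  shows "tensor_rep (coset N u) - u \<in> N"
proof -
  have "tensor_rep (coset N u) \<in> coset N u"
    unfolding tensor_rep_def by (rule someI[of _ u]) (simp add: mem_coset is_subgroupD[OF assms])
  then show ?thesis by (simp add: mem_coset)
qed

lemma coset_add:
  assumes "is_subgroup N"
  shows "coset N u + coset N v = coset N (u + v)"
proof (intro equalityI subsetI)
  fix w assume "w \<in> coset N u + coset N v"
  then obtain a b where "a - u \<in> N" "b - v \<in> N" "w = a + b"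
    by (auto simp: set_plus_def mem_coset)
  then show "w \<in> coset N (u + v)"
    using is_subgroupD(3)[OF assms, of "a - u" "b - v"] by (simp add: mem_coset algebra_simps)
next
  fix w assume "w \<in> coset N (u + v)"
  then have "w - v \<in> coset N u" "v \<in> coset N v"
    by (auto simp: mem_coset algebra_simps is_subgroupD[OF assms])
  then have "(w - v) + v \<in> coset N u + coset N v" by (rule set_plus_intro)
  then show "w \<in> coset N u + coset N v" by simp
qed

definition frag_lift :: "('x \<Rightarrow> 'c::ring_1) \<Rightarrow> 'x frag \<Rightarrow> 'c" where
  "frag_lift f u = (\<Sum>z\<in>Poly_Mapping.keys u. of_int (Poly_Mapping.lookup u z) * f z)"

lemma frag_lift_superset:
  assumes "finite F" "Poly_Mapping.keys u \<subseteq> F"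
  shows "frag_lift f u = (\<Sum>z\<in>F. of_int (Poly_Mapping.lookup u z) * f z)"
  unfolding frag_lift_def by (rule sum.mono_neutral_left) (use assms in \<open>auto simp: in_keys_iff\<close>)

lemma additive_map_frag_lift: "additive_map (frag_lift f)"
  unfolding additive_map_def
proof (intro allI)
  fix u v :: "'a frag"
  let ?F = "Poly_Mapping.keys u \<union> Poly_Mapping.keys v"
  have "Poly_Mapping.keys (u + v) \<subseteq> ?F" by (rule Poly_Mapping.keys_add)
  then show "frag_lift f (u + v) = frag_lift f u + frag_lift f v"
    by (simp add: frag_lift_superset[of ?F] lookup_add algebra_simps sum.distrib)
qed

lemmas frag_lift_simps = additive_map_simps[OF additive_map_frag_lift]

lemma frag_lift_of [simp]: "frag_lift f (frag_of z) = f z"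
  by (simp add: frag_lift_def)

lemma additive_map_frag_extend: "additive_map (frag_extend f)"
  by (simp add: additive_map_def frag_extend_add)

lemma additive_map_eq_frag:
  assumes "additive_map h" "additive_map g" "\<And>z. h (frag_of z) = g (frag_of z)"
  shows "h u = g u"
proof -
  have "Poly_Mapping.keys u \<subseteq> UNIV" by simp
  then show ?thesis
    by (induction u rule: frag_induction) (use assms in \<open>auto simp: additive_map_simps\<close>)
qed

definition balanced ::
    "('m::ab_group_add \<Rightarrow> 'r \<Rightarrow> 'm) \<Rightarrow> ('r \<Rightarrow> 'n::ab_group_add \<Rightarrow> 'n) \<Rightarrow> 'r set \<Rightarrow> ('m \<Rightarrow> 'n \<Rightarrow> 'c::ab_group_add) \<Rightarrow> bool" where
  "balanced ract lact R f \<longleftrightarrow> (\<forall>x x' y. f (x + x') y = f x y + f x' y) \<and>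
     (\<forall>x y y'. f x (y + y') = f x y + f x y') \<and> (\<forall>x y. \<forall>r\<in>R. f (ract x r) y = f x (lact r y))"

lemma is_subgroup_tensor_rel: "is_subgroup (tensor_rel ract lact R)"
  by (simp add: tensor_rel_def is_subgroup_group_closure)

lemma additive_map_vanish_tensor_rel:
  assumes "additive_map h" "u \<in> tensor_rel ract lact R" "balanced ract lact R (\<lambda>x y. h (frag_of (x, y)))"
  shows "h u = 0"
proof (rule additive_map_vanish_group_closure[OF assms(1) assms(2)[unfolded tensor_rel_def]])
  fix g
  assume "g \<in> {frag_of (x + x', y) - frag_of (x, y) - frag_of (x', y) |x x' y. True} \<union>
       {frag_of (x, y + y') - frag_of (x, y) - frag_of (x, y') |x y y'. True} \<union>
       {frag_of (ract x r, y) - frag_of (x, lact r y) |x y r. r \<in> R}"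
  then show "h g = 0"
    using assms(3) by (auto simp: additive_map_simps[OF assms(1)] balanced_def)
qed

text \<open>A balanced map kills the generators of \<open>tensor_rel\<close>, and the chosen
  representative differs from \<open>u\<close> by an element of that subgroup, so the choice does
  not matter.\<close>

lemma tensor_eval_coset:
  assumes "balanced ract lact R f"
  shows "tensor_eval f (coset (tensor_rel ract lact R) u) = frag_lift (\<lambda>(x, y). f x y) u"
proof -
  let ?N = "tensor_rel ract lact R"
  have "frag_lift (\<lambda>(x, y). f x y) (tensor_rep (coset ?N u) - u) = 0"
    by (rule additive_map_vanish_tensor_rel[OF additive_map_frag_lift tensor_rep_coset[OF is_subgroup_tensor_rel]])
       (use assms in simp)
  moreover have "tensor_eval f t = frag_lift (\<lambda>(x, y). f x y) (tensor_rep t)" for t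
    unfolding tensor_eval_def frag_lift_def by (rule sum.cong) auto
  ultimately show ?thesis by (simp add: frag_lift_simps)
qed

lemma tensor_rel_mem:
  shows "frag_of (x + x', y) - frag_of (x, y) - frag_of (x', y) \<in> tensor_rel ract lact R"
    "frag_of (x, y + y') - frag_of (x, y) - frag_of (x, y') \<in> tensor_rel ract lact R"
    "r \<in> R \<Longrightarrow> frag_of (ract x r, y) - frag_of (x, lact r y) \<in> tensor_rel ract lact R"
  unfolding tensor_rel_def by (rule group_closure.base; blast)+

text \<open>The hypotheses test \<open>f\<close> on the three kinds of generators. Its extension
  therefore maps all relations into \<open>N'\<close>, and the chosen representative may be replaced
  by \<open>u\<close>.\<close>

lemma tensor_map_coset:
  assumes N': "is_subgroup N'"
    and "\<And>x x' y. frag_extend f (frag_of (x + x', y) - frag_of (x, y) - frag_of (x', y)) \<in> N'"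
    and "\<And>x y y'. frag_extend f (frag_of (x, y + y') - frag_of (x, y) - frag_of (x, y')) \<in> N'"
    and "\<And>x y r. r \<in> R \<Longrightarrow> frag_extend f (frag_of (ract x r, y) - frag_of (x, lact r y)) \<in> N'"
  shows "tensor_map N' f (coset (tensor_rel ract lact R) u) = coset N' (frag_extend f u)"
proof -
  let ?N = "tensor_rel ract lact R"
  have "frag_extend f v \<in> N'" if "v \<in> ?N" for v
    by (rule group_closure_closed[OF that[unfolded tensor_rel_def]])
       (use assms in \<open>auto simp: frag_extend_diff is_subgroupD\<close>)
  from this[OF tensor_rep_coset[OF is_subgroup_tensor_rel, of _ _ _ u]] show ?thesis
    by (simp add: tensor_map_def coset_eq_iff[OF N'] frag_extend_diff)
qed


section \<open>Sweedler calculus in coordinates\<close>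

lemma frag_lift_frag_extend: "frag_lift f (frag_extend g u) = frag_lift (\<lambda>z. frag_lift f (g z)) u"
  by (rule additive_map_eq_frag[of "\<lambda>u. frag_lift f (frag_extend g u)"])
     (auto simp: additive_map_def frag_extend_add frag_lift_simps)

lemma tensor_eval_eq_frag_lift: "tensor_eval f t = frag_lift (\<lambda>(x, y). f x y) (tensor_rep t)"
  unfolding tensor_eval_def frag_lift_def by (rule sum.cong) auto

locale fd_hopf_algebra = hopf_algebra scale \<Delta> \<epsilon> \<sigma> + finite_dimensional_vector_space scale Basis
  for scale :: "'k::field \<Rightarrow> 'a::ring_1 \<Rightarrow> 'a"
    and \<Delta> :: "'a \<Rightarrow> ('a \<times> 'a) frag set"
    and \<epsilon> :: "'a \<Rightarrow> 'k"
    and \<sigma> :: "'a \<Rightarrow> 'a"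
    and Basis :: "'a set"
begin

abbreviation bal2 :: "('a \<Rightarrow> 'a \<Rightarrow> 'c::ab_group_add) \<Rightarrow> bool" where
  "bal2 \<equiv> balanced (\<lambda>x c. scale c x) scale UNIV"

definition bal3 :: "('a \<Rightarrow> 'a \<Rightarrow> 'a \<Rightarrow> 'c::ab_group_add) \<Rightarrow> bool" where
  "bal3 F \<longleftrightarrow> (\<forall>x x' y z. F (x + x') y z = F x y z + F x' y z) \<and>
     (\<forall>x y y' z. F x (y + y') z = F x y z + F x y' z) \<and>
     (\<forall>x y z z'. F x y (z + z') = F x y z + F x y z') \<and>
     (\<forall>x y z c. F (scale c x) y z = F x (scale c y) z) \<and>
     (\<forall>x y z c. F x (scale c y) z = F x y (scale c z))"

abbreviation coord :: "'a \<Rightarrow> 'a \<Rightarrow> 'k" where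
  "coord b x \<equiv> representation Basis x b"

text \<open>\<open>\<Delta> a = (\<Sum>b\<in>Basis. b \<otimes> D b a)\<close>, and \<open>sw f a\<close> is \<open>f a\<^sub>1 a\<^sub>2\<close> in Sweedler notation.\<close>

definition D :: "'a \<Rightarrow> 'a \<Rightarrow> 'a" where
  "D b a = tensor_eval (\<lambda>x y. scale (coord b x) y) (\<Delta> a)"

definition sw :: "('a \<Rightarrow> 'a \<Rightarrow> 'c::ab_group_add) \<Rightarrow> 'a \<Rightarrow> 'c" where
  "sw f a = (\<Sum>b\<in>Basis. f b (D b a))"

lemma linear_coord: "Vector_Spaces.linear scale (*) (coord b)"
  by (rule linear_representation) (auto simp: independent_Basis span_Basis)

lemma coord_add [simp]: "coord b (x + y) = coord b x + coord b y"
  and coord_scale [simp]: "coord b (scale c x) = c * coord b x"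
  using linear_coord[of b] by (auto simp: Vector_Spaces.linear_iff)

lemma coord_sum [simp]: "coord b (\<Sum>i\<in>I. f i) = (\<Sum>i\<in>I. coord b (f i))"
  by (rule additive_map_simps(5)) (simp add: additive_map_def)

lemma sum_coord: "(\<Sum>b\<in>Basis. scale (coord b x) b) = x"
  by (rule sum_representation_eq) (auto simp: independent_Basis span_Basis finite_Basis)

lemma coord_Basis: "b \<in> Basis \<Longrightarrow> coord c b = (if c = b then 1 else 0)"
  by (simp add: representation_basis independent_Basis)

lemma sigma_add [simp]: "\<sigma> (x + y) = \<sigma> x + \<sigma> y"
  and sigma_scale [simp]: "\<sigma> (scale c x) = scale c (\<sigma> x)"
  using antipode_linear by (auto simp: Vector_Spaces.linear_iff)

lemma eps_add [simp]: "\<epsilon> (x + y) = \<epsilon> x + \<epsilon> y"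
  and eps_scale [simp]: "\<epsilon> (scale c x) = c * \<epsilon> x"
  using counit_linear by (auto simp: Vector_Spaces.linear_iff)

declare counit_one [simp] counit_mult [simp]

lemmas scale_mult = scale_mult_left[symmetric] scale_mult_right[symmetric]

text \<open>Expand \<open>x\<close> in the basis and move the coordinates across the balanced map.
  This collapses the coordinate sums in many calculations below.\<close>

lemma bal2_eval:
  fixes f :: "'a \<Rightarrow> 'a \<Rightarrow> 'c::ab_group_add"
  assumes "bal2 f"
  shows "(\<Sum>b\<in>Basis. f b (scale (coord b x) y)) = f x y"
proof -
  have a: "additive_map (\<lambda>x. f x y)" using assms by (auto simp: balanced_def additive_map_def)
  have "f x y = f (\<Sum>b\<in>Basis. scale (coord b x) b) y" by (simp add: sum_coord)
  also have "\<dots> = (\<Sum>b\<in>Basis. f (scale (coord b x) b) y)" by (rule additive_map_simps(5)[OF a])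
  also have "\<dots> = (\<Sum>b\<in>Basis. f b (scale (coord b x) y))" using assms by (simp add: balanced_def)
  finally show ?thesis by simp
qed

lemma bal2D:
  assumes "bal2 f"
  shows "f (x + x') y = f x y + f x' y" "f x (y + y') = f x y + f x y'" "f (scale c x) y = f x (scale c y)"
    "f (\<Sum>i\<in>I. g i) y = (\<Sum>i\<in>I. f (g i) y)" "f x (\<Sum>i\<in>I. g i) = (\<Sum>i\<in>I. f x (g i))"
proof -
  have "additive_map (\<lambda>x. f x y)" "additive_map (f x)" for x y
    using assms by (auto simp: balanced_def additive_map_def)
  from additive_map_simps(5)[OF this(1)] additive_map_simps(5)[OF this(2)]
  show "f (\<Sum>i\<in>I. g i) y = (\<Sum>i\<in>I. f (g i) y)" "f x (\<Sum>i\<in>I. g i) = (\<Sum>i\<in>I. f x (g i))" by auto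
qed (use assms in \<open>auto simp: balanced_def\<close>)

lemma bal3D:
  assumes "bal3 F"
  shows "bal2 (\<lambda>x y. F x y z)" "bal2 (\<lambda>x y. F x z y)" "bal2 (\<lambda>x y. F z x y)"
  using assms by (auto simp: bal3_def balanced_def)

lemma comult_coset:
  obtains u where "\<Delta> a = coset (krel2 scale) u"
  using comult_in[of a] by (auto simp: quotient_space_def)

lemma tensor_eval_coset2:
  assumes "bal2 f"
  shows "tensor_eval f (coset (krel2 scale) u) = frag_lift (\<lambda>(x, y). f x y) u"
  unfolding krel2_def by (rule tensor_eval_coset[OF assms])

lemma bal2_coord: "bal2 (\<lambda>x y. scale (coord b x) y)"
  by (auto simp: balanced_def scale_left_distrib scale_right_distrib)

text \<open>Passes from representatives to finite sums over the basis: by additivity it is enough to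
  treat a pure tensor, where \<open>bal2_eval\<close> applies.\<close>

lemma tensor_eval_comult:
  fixes f :: "'a \<Rightarrow> 'a \<Rightarrow> 'c::ring_1"
  assumes f: "bal2 f"
  shows "tensor_eval f (\<Delta> a) = sw f a"
proof -
  obtain u where u: "\<Delta> a = coset (krel2 scale) u" by (rule comult_coset)
  let ?l = "\<lambda>b. frag_lift (\<lambda>(x, y). scale (coord b x) y)"
  have "frag_lift (\<lambda>(x, y). f x y) u = (\<Sum>b\<in>Basis. f b (?l b u))"
    by (rule additive_map_eq_frag[OF additive_map_frag_lift])
       (auto simp: additive_map_def frag_lift_simps bal2D[OF f] sum.distrib bal2_eval[OF f])
  then show ?thesis
    by (simp add: sw_def D_def u tensor_eval_coset2 f bal2_coord)
qed

lemma sw_coord: "sw (\<lambda>x y. scale (coord b x) y) a = D b a"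
  by (simp add: D_def tensor_eval_comult bal2_coord)

lemma D_add [simp]: "D b (x + y) = D b x + D b y"
proof -
  obtain u v where uv: "\<Delta> x = coset (krel2 scale) u" "\<Delta> y = coset (krel2 scale) v" by (metis comult_coset)
  have "is_subgroup (krel2 scale)" by (simp add: krel2_def is_subgroup_tensor_rel)
  then show ?thesis
    by (simp add: D_def comult_add uv coset_add tensor_eval_coset2 bal2_coord frag_lift_simps)
qed

lemma D_scale [simp]: "D b (scale c x) = scale c (D b x)"
proof -
  have a: "additive_map (scale c)" by (simp add: additive_map_def scale_right_distrib)
  have *: "scale c (frag_lift g u) = frag_lift (\<lambda>z. scale c (g z)) u" for g and u :: "('a \<times> 'a) frag"
    by (rule additive_map_eq_frag[of "\<lambda>u. scale c (frag_lift g u)"])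
       (auto simp: additive_map_def frag_lift_simps scale_right_distrib)
  have "D b (scale c x) = frag_lift (\<lambda>(x, y). scale (coord b x) y)
      (frag_extend (\<lambda>(x, y). frag_of (scale c x, y)) (tensor_rep (\<Delta> x)))"
    by (simp add: D_def comult_scale tensor_scale_def tensor_map_def tensor_eval_coset2 bal2_coord)
  also have "\<dots> = scale c (D b x)"
    unfolding frag_lift_frag_extend D_def tensor_eval_eq_frag_lift *
    by (simp add: case_prod_unfold mult.commute)
  finally show ?thesis .
qed

lemma linear_D: "Vector_Spaces.linear scale scale (D b)"
  by (auto simp: Vector_Spaces.linear_iff vector_space_axioms)

lemma additive_D: "additive_map (D b)" by (simp add: additive_map_def)

lemma D_sum [simp]: "D b (\<Sum>i\<in>I. f i) = (\<Sum>i\<in>I. D b (f i))"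
  by (rule additive_map_simps(5)[OF additive_D])

lemma D_zero [simp]: "D b 0 = 0"
  by (rule additive_map_simps(2)[OF additive_D])

lemma D_one: "D b 1 = scale (coord b 1) 1"
  by (simp add: D_def comult_one tensor_eval_coset2 bal2_coord)

lemma additive_map_sw: "additive_map h \<Longrightarrow> h (sw f a) = sw (\<lambda>x y. h (f x y)) a"
  by (simp add: sw_def additive_map_simps)

text \<open>In the product of \<open>\<Delta> x\<close> and \<open>\<Delta> y\<close> the first legs
  are products \<open>b * b'\<close> of basis elements; their coordinates at \<open>c\<close> become
  the scalars.\<close>

lemma D_mult: "D c (x * y) = (\<Sum>b\<in>Basis. \<Sum>b'\<in>Basis. scale (coord c (b * b')) (D b x * D b' y))"
proof -
  \<comment> \<open>The inner evaluation at fixed \<open>p\<close> and \<open>q\<close>. Being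
    balanced itself, it can be fed into the outer evaluation at \<open>\<Delta> x\<close>.\<close>
  define G where "G = (\<lambda>p q. tensor_eval (\<lambda>p' q'. scale (coord c (p * p')) (q * q')) (\<Delta> y))"
  have b1: "bal2 (\<lambda>p' q'. scale (coord c (p * p')) (q * q'))" for p q
    by (auto simp: balanced_def algebra_simps scale_left_distrib scale_right_distrib scale_mult)
  have G: "G p q = sw (\<lambda>p' q'. scale (coord c (p * p')) (q * q')) y" for p q
    unfolding G_def by (rule tensor_eval_comult[OF b1])
  have b2: "bal2 G"
    by (auto simp: balanced_def G sw_def algebra_simps scale_left_distrib scale_right_distrib scale_mult sum.distrib)
  have "D c (x * y) = frag_lift (\<lambda>(x, y). scale (coord c x) y)
     (frag_extend (\<lambda>(x, ya). frag_extend (\<lambda>(x', y'). frag_of (x * x', ya * y')) (tensor_rep (\<Delta> y)))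
       (tensor_rep (\<Delta> x)))"
    by (simp add: D_def comult_mult tensor_mult_def tensor_map_def tensor_eval_coset2 bal2_coord)
  also have "\<dots> = tensor_eval G (\<Delta> x)"
    unfolding frag_lift_frag_extend G_def tensor_eval_eq_frag_lift
    by (simp add: case_prod_unfold frag_lift_frag_extend)
  also have "\<dots> = sw G x" by (rule tensor_eval_comult[OF b2])
  finally show ?thesis by (simp add: G sw_def)
qed

lemma frag_lift_krel3:
  assumes F: "bal3 F" and u: "u \<in> krel3 scale"
  shows "frag_lift (\<lambda>(x, y, z). F x y z) u = 0"
  by (rule additive_map_vanish_group_closure[OF additive_map_frag_lift u[unfolded krel3_def]])
     (use F in \<open>auto simp: frag_lift_simps bal3_def\<close>)

text \<open>Both sides of \<open>coassoc\<close> are cosets of \<open>krel3\<close>, and a map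
  balanced in three arguments vanishes on \<open>krel3\<close>.\<close>

lemma coassoc_eval:
  fixes F :: "'a \<Rightarrow> 'a \<Rightarrow> 'a \<Rightarrow> 'c::ring_1"
  assumes F: "bal3 F"
  shows "tensor_eval (\<lambda>x y. tensor_eval (\<lambda>p q. F p q y) (\<Delta> x)) (\<Delta> a) =
         tensor_eval (\<lambda>x y. tensor_eval (\<lambda>p q. F x p q) (\<Delta> y)) (\<Delta> a)"
proof -
  let ?N = "krel3 scale" and ?F = "frag_lift (\<lambda>(x, y, z). F x y z)"
  let ?u = "frag_extend (\<lambda>(x, y). frag_extend (\<lambda>(p, q). frag_of (p, q, y)) (tensor_rep (\<Delta> x))) (tensor_rep (\<Delta> a))"
  let ?v = "frag_extend (\<lambda>(x, y). frag_extend (\<lambda>(p, q). frag_of (x, p, q)) (tensor_rep (\<Delta> y))) (tensor_rep (\<Delta> a))"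
  have N: "is_subgroup ?N" by (simp add: krel3_def is_subgroup_group_closure)
  have "coset ?N ?u = coset ?N ?v" using coassoc[of a] by (simp add: tensor_map_def)
  then have "?u - ?v \<in> ?N" by (simp add: coset_eq_iff[OF N])
  from frag_lift_krel3[OF F this] have "?F ?u = ?F ?v" by (simp only: frag_lift_simps right_minus_eq)
  then show ?thesis
    by (simp add: frag_lift_frag_extend tensor_eval_eq_frag_lift case_prod_unfold)
qed

text \<open>Evaluate coassociativity with the coordinates \<open>b\<close> and \<open>c\<close> on
  the first two legs and the identity on the third.\<close>

lemma D_D: "D c (D b a) = (\<Sum>e\<in>Basis. scale (coord c (D b e)) (D e a))"
proof -
  let ?F = "\<lambda>x y z. scale (coord b x) (scale (coord c y) z)"
  have b3: "bal3 ?F"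
    by (auto simp: bal3_def scale_left_distrib scale_right_distrib algebra_simps)
  have 1: "tensor_eval (\<lambda>p q. ?F p q y) (\<Delta> x) = scale (coord c (D b x)) y" for x y
  proof -
    have "tensor_eval (\<lambda>p q. ?F p q y) (\<Delta> x) = sw (\<lambda>p q. ?F p q y) x"
      by (rule tensor_eval_comult) (use bal3D[OF b3] in blast)
    also have "\<dots> = scale (coord c (sw (\<lambda>x y. scale (coord b x) y) x)) y"
      by (simp add: sw_def scale_sum_left)
    finally show ?thesis by (simp add: sw_coord)
  qed
  have 2: "tensor_eval (\<lambda>p q. ?F x p q) (\<Delta> y) = scale (coord b x) (D c y)" for x y
  proof -
    have "tensor_eval (\<lambda>p q. ?F x p q) (\<Delta> y) = sw (\<lambda>p q. ?F x p q) y"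
      by (rule tensor_eval_comult) (use bal3D[OF b3] in blast)
    also have "\<dots> = scale (coord b x) (sw (\<lambda>x y. scale (coord c x) y) y)"
      by (simp add: sw_def scale_sum_right)
    finally show ?thesis by (simp add: sw_coord)
  qed
  have "sw (\<lambda>x y. scale (coord c (D b x)) y) a = sw (\<lambda>x y. scale (coord b x) (D c y)) a"
    using coassoc_eval[OF b3, of a] unfolding 1 2
    by (subst (asm) (1 2) tensor_eval_comult)
       (auto simp: balanced_def scale_left_distrib scale_right_distrib mult.commute)
  also have "\<dots> = D c (sw (\<lambda>x y. scale (coord b x) y) a)"
    by (simp add: sw_def)
  finally show ?thesis by (simp add: sw_coord) (simp add: sw_def)
qed

section \<open>Rules for Sweedler sums\<close>

lemma sw_add: "bal2 f \<Longrightarrow> sw f (a + b) = sw f a + sw f b"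
  by (simp add: sw_def bal2D sum.distrib)

lemma sw_scale: "bal2 f \<Longrightarrow> sw f (scale c a) = sw (\<lambda>x y. f x (scale c y)) a"
  by (simp add: sw_def bal2D)

lemma sw_one: "bal2 f \<Longrightarrow> sw f 1 = f 1 1"
  by (simp add: sw_def D_one bal2_eval)

lemma sw_swap: "sw (\<lambda>x y. sw (\<lambda>p q. G x y p q) b) a = sw (\<lambda>p q. sw (\<lambda>x y. G x y p q) a) b"
  unfolding sw_def by (rule sum.swap)

lemma sw_mult:
  assumes f: "bal2 f"
  shows "sw f (x * y) = sw (\<lambda>p q. sw (\<lambda>p' q'. f (p * p') (q * q')) y) x"
proof -
  have "sw f (x * y) = (\<Sum>c\<in>Basis. \<Sum>b\<in>Basis. \<Sum>b'\<in>Basis. f c (scale (coord c (b * b')) (D b x * D b' y)))"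
    by (simp add: sw_def D_mult bal2D[OF f])
  also have "\<dots> = (\<Sum>b\<in>Basis. \<Sum>b'\<in>Basis. \<Sum>c\<in>Basis. f c (scale (coord c (b * b')) (D b x * D b' y)))"
    by (subst sum.swap) (rule sum.cong[OF refl], rule sum.swap)
  finally show ?thesis by (simp add: bal2_eval[OF f] sw_def)
qed

text \<open>Derived from the coordinate form \<open>D_D\<close>, because \<open>coassoc_eval\<close>
  takes values in rings only.\<close>

lemma sw_coassoc:
  assumes F: "bal3 F"
  shows "sw (\<lambda>x y. sw (\<lambda>p q. F p q y) x) a = sw (\<lambda>x y. sw (\<lambda>p q. F x p q) y) a"
proof -
  note b = bal3D[OF F]
  have "sw (\<lambda>x y. sw (\<lambda>p q. F x p q) y) a =
     (\<Sum>b\<in>Basis. \<Sum>c\<in>Basis. \<Sum>e\<in>Basis. F b c (scale (coord c (D b e)) (D e a)))"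
    by (simp add: sw_def D_D bal2D[OF b(3)])
  also have "\<dots> = (\<Sum>b\<in>Basis. \<Sum>e\<in>Basis. \<Sum>c\<in>Basis. F b c (scale (coord c (D b e)) (D e a)))"
    by (rule sum.cong[OF refl], rule sum.swap)
  also have "\<dots> = (\<Sum>b\<in>Basis. \<Sum>e\<in>Basis. F b (D b e) (D e a))"
    by (simp add: bal2_eval[OF b(3)])
  also have "\<dots> = sw (\<lambda>x y. sw (\<lambda>p q. F p q y) x) a"
    by (subst sum.swap) (simp add: sw_def)
  finally show ?thesis by simp
qed

text \<open>The additive \<open>h\<close> serves as a context, so that this rule and the next three
  apply inside larger expressions.\<close>

lemma sw_counit_left: "additive_map h \<Longrightarrow> sw (\<lambda>x y. h (scale (\<epsilon> x) y)) a = h a"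
proof -
  have "bal2 (\<lambda>x y. scale (\<epsilon> x) y)"
    by (auto simp: balanced_def scale_left_distrib scale_right_distrib)
  then have "sw (\<lambda>x y. scale (\<epsilon> x) y) a = a" using counit_left[of a] by (simp add: tensor_eval_comult)
  then show "additive_map h \<Longrightarrow> ?thesis" by (metis additive_map_sw)
qed

lemma sw_counit_right: "additive_map h \<Longrightarrow> sw (\<lambda>x y. h (scale (\<epsilon> y) x)) a = h a"
proof -
  have "bal2 (\<lambda>x y. scale (\<epsilon> y) x)"
    by (auto simp: balanced_def scale_left_distrib scale_right_distrib mult.commute)
  then have "sw (\<lambda>x y. scale (\<epsilon> y) x) a = a" using counit_right[of a] by (simp add: tensor_eval_comult)
  then show "additive_map h \<Longrightarrow> ?thesis" by (metis additive_map_sw)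
qed

lemma sw_antipode_left: "additive_map h \<Longrightarrow> sw (\<lambda>x y. h (\<sigma> x * y)) a = h (scale (\<epsilon> a) 1)"
proof -
  have "bal2 (\<lambda>x y. \<sigma> x * y)"
    by (auto simp: balanced_def algebra_simps scale_mult)
  then have "sw (\<lambda>x y. \<sigma> x * y) a = scale (\<epsilon> a) 1" using antipode_left[of a] by (simp add: tensor_eval_comult)
  then show "additive_map h \<Longrightarrow> ?thesis" by (metis additive_map_sw)
qed

lemma sw_antipode_right: "additive_map h \<Longrightarrow> sw (\<lambda>x y. h (x * \<sigma> y)) a = h (scale (\<epsilon> a) 1)"
proof -
  have "bal2 (\<lambda>x y. x * \<sigma> y)"
    by (auto simp: balanced_def algebra_simps scale_mult)
  then have "sw (\<lambda>x y. x * \<sigma> y) a = scale (\<epsilon> a) 1" using antipode_right[of a] by (simp add: tensor_eval_comult)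
  then show "additive_map h \<Longrightarrow> ?thesis" by (metis additive_map_sw)
qed

lemma left_normal_iff: "left_normal \<Delta> \<sigma> S \<longleftrightarrow> (\<forall>a. \<forall>x\<in>S. sw (\<lambda>p q. p * x * \<sigma> q) a \<in> S)"
proof -
  have "bal2 (\<lambda>p q. p * x * \<sigma> q)" for x
    by (auto simp: balanced_def algebra_simps scale_mult)
  then show ?thesis by (simp add: left_normal_def tensor_eval_comult)
qed

text \<open>\<open>D b x\<close> is a combination of the second legs of a representative of
  \<open>\<Delta> x\<close>, and these may be taken in \<open>S\<close>.\<close>

lemma left_coideal_D:
  assumes "left_coideal_subalgebra scale \<Delta> S" "x \<in> S"
  shows "D b x \<in> S"
proof -
  have S: "subspace S" using assms(1) by (simp add: left_coideal_subalgebra_def subalgebra_def)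
  obtain u where u: "\<Delta> x = coset (krel2 scale) u" "Poly_Mapping.keys u \<subseteq> UNIV \<times> S"
    using assms by (auto simp: left_coideal_subalgebra_def)
  have "frag_lift (\<lambda>(x, y). scale (coord b x) y) u \<in> S"
  using u(2) proof (induction u rule: frag_induction)
    case zero
    then show ?case by (simp add: frag_lift_simps subspace_0[OF S])
  next
    case (one z)
    then show ?case by (auto simp: subspace_scale[OF S])
  next
    case (diff s t)
    then show ?case by (simp add: frag_lift_simps subspace_diff[OF S])
  qed
  then show ?thesis by (simp add: D_def u(1) tensor_eval_coset2 bal2_coord)
qed

end


section \<open>The antipode is an anti-homomorphism\<close>

context fd_hopf_algebra
begin

lemmas bal_simps = balanced_def bal3_def sw_def algebra_simps scale_left_distrib scale_right_distrib
  scale_mult sum.distrib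

section \<open>Cancellation of antipode pairs\<close>

lemma sw_right_scalar:
  assumes H: "bal2 H"
  shows "sw (\<lambda>x y. H x (scale (\<epsilon> y) 1)) a = H a 1"
proof -
  have "additive_map (\<lambda>x. H x 1)" by (simp add: additive_map_def bal2D[OF H])
  from sw_counit_right[OF this, of a] show ?thesis by (simp add: bal2D(3)[OF H])
qed

lemma sw_left_scalar:
  assumes H: "bal2 H"
  shows "sw (\<lambda>x y. H (scale (\<epsilon> x) 1) y) a = H 1 a"
proof -
  have "additive_map (\<lambda>x. H 1 x)" by (simp add: additive_map_def bal2D[OF H])
  from sw_counit_left[OF this, of a] show ?thesis by (simp add: bal2D(3)[OF H])
qed

lemma bal2_additive:
  assumes "bal2 H"
  shows "additive_map (H x)" "additive_map (\<lambda>x. H x y)"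
  by (auto simp: additive_map_def bal2D[OF assms])

text \<open>The second bracketing follows from the first by coassociativity. This lemma and the next
  three differ in whether the cancelling pair occupies the last or the first two legs, and in which
  factor carries \<open>\<sigma>\<close>.\<close>

lemma sw_id_S:
  assumes H: "bal2 H"
  shows "sw (\<lambda>x y. sw (\<lambda>p q. H x (p * \<sigma> q)) y) a = H a 1"
    and "sw (\<lambda>x y. sw (\<lambda>p q. H p (q * \<sigma> y)) x) a = H a 1"
proof -
  show 1: "sw (\<lambda>x y. sw (\<lambda>p q. H x (p * \<sigma> q)) y) a = H a 1"
    by (simp add: sw_antipode_right[OF bal2_additive(1)[OF H]] sw_right_scalar[OF H])
  have "bal3 (\<lambda>x p q. H x (p * \<sigma> q))" by (auto simp: bal_simps bal2D[OF H])
  from sw_coassoc[OF this] 1 show "sw (\<lambda>x y. sw (\<lambda>p q. H p (q * \<sigma> y)) x) a = H a 1" by (rule trans)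
qed

lemma sw_id_S':
  assumes H: "bal2 H"
  shows "sw (\<lambda>x y. sw (\<lambda>p q. H x (\<sigma> p * q)) y) a = H a 1"
    and "sw (\<lambda>x y. sw (\<lambda>p q. H p (\<sigma> q * y)) x) a = H a 1"
proof -
  show 1: "sw (\<lambda>x y. sw (\<lambda>p q. H x (\<sigma> p * q)) y) a = H a 1"
    by (simp add: sw_antipode_left[OF bal2_additive(1)[OF H]] sw_right_scalar[OF H])
  have "bal3 (\<lambda>x p q. H x (\<sigma> p * q))" by (auto simp: bal_simps bal2D[OF H])
  from sw_coassoc[OF this] 1 show "sw (\<lambda>x y. sw (\<lambda>p q. H p (\<sigma> q * y)) x) a = H a 1" by (rule trans)
qed

lemma sw_S_id:
  assumes H: "bal2 H"
  shows "sw (\<lambda>x y. sw (\<lambda>p q. H (p * \<sigma> q) y) x) a = H 1 a"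
    and "sw (\<lambda>x y. sw (\<lambda>p q. H (x * \<sigma> p) q) y) a = H 1 a"
proof -
  show 1: "sw (\<lambda>x y. sw (\<lambda>p q. H (p * \<sigma> q) y) x) a = H 1 a"
    by (simp add: sw_antipode_right[OF bal2_additive(2)[OF H]] sw_left_scalar[OF H])
  have "bal3 (\<lambda>p q y. H (p * \<sigma> q) y)" by (auto simp: bal_simps bal2D[OF H])
  from sw_coassoc[OF this, symmetric] 1 show "sw (\<lambda>x y. sw (\<lambda>p q. H (x * \<sigma> p) q) y) a = H 1 a" by (rule trans)
qed

lemma sw_S_id':
  assumes H: "bal2 H"
  shows "sw (\<lambda>x y. sw (\<lambda>p q. H (\<sigma> p * q) y) x) a = H 1 a"
    and "sw (\<lambda>x y. sw (\<lambda>p q. H (\<sigma> x * p) q) y) a = H 1 a"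
proof -
  show 1: "sw (\<lambda>x y. sw (\<lambda>p q. H (\<sigma> p * q) y) x) a = H 1 a"
    by (simp add: sw_antipode_left[OF bal2_additive(2)[OF H]] sw_left_scalar[OF H])
  have "bal3 (\<lambda>p q y. H (\<sigma> p * q) y)" by (auto simp: bal_simps bal2D[OF H])
  from sw_coassoc[OF this, symmetric] 1 show "sw (\<lambda>x y. sw (\<lambda>p q. H (\<sigma> x * p) q) y) a = H 1 a" by (rule trans)
qed

text \<open>Inserting trivial factors turns \<open>\<sigma>(x y)\<close> into
  \<open>\<sigma>(x_1 y_1) x_2 y_2 \<sigma>(y_3) \<sigma>(x_3)\<close>, where the first three
  factors collapse by the antipode axiom for a product.\<close>

lemma sigma_mult: "\<sigma> (x * y) = \<sigma> y * \<sigma> x"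
proof -
  have "\<sigma> (x * y) = sw (\<lambda>x' x3. sw (\<lambda>x1 x2. \<sigma> (x1 * y) * (x2 * \<sigma> x3)) x') x"
    by (subst sw_id_S(2)[where H = "\<lambda>u v. \<sigma> (u * y) * v"]) (auto simp: bal_simps)
  also have "\<dots> = sw (\<lambda>x' x3. sw (\<lambda>x1 x2. sw (\<lambda>y' y3. sw (\<lambda>y1 y2. \<sigma> (x1 * y1) * (x2 * (y2 * \<sigma> y3) * \<sigma> x3)) y') y) x') x"
    by (subst sw_id_S(2)[where H = "\<lambda>u v. \<sigma> (_ * u) * (_ * v * \<sigma> _)"]) (auto simp: bal_simps)
  also have "\<dots> = sw (\<lambda>x' x3. sw (\<lambda>y' y3. sw (\<lambda>x1 x2. sw (\<lambda>y1 y2. \<sigma> (x1 * y1) * (x2 * y2) * (\<sigma> y3 * \<sigma> x3)) y') x') y) x"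
    by (subst (2) sw_swap) (simp add: mult.assoc)
  also have "\<dots> = sw (\<lambda>x' x3. sw (\<lambda>y' y3. sw (\<lambda>p q. \<sigma> p * q * (\<sigma> y3 * \<sigma> x3)) (x' * y')) y) x"
    by (subst sw_mult) (auto simp: bal_simps)
  also have "\<dots> = sw (\<lambda>x' x3. sw (\<lambda>y' y3. scale (\<epsilon> (x' * y')) 1 * (\<sigma> y3 * \<sigma> x3)) y) x"
    by (subst sw_antipode_left[where h = "\<lambda>z. z * _"]) (auto simp: additive_map_def algebra_simps)
  also have "\<dots> = sw (\<lambda>x' x3. scale (\<epsilon> x') (sw (\<lambda>y' y3. \<sigma> (scale (\<epsilon> y') y3) * \<sigma> x3) y)) x"
    by (simp add: sw_def scale_mult scale_sum_right mult.commute)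
  also have "\<dots> = sw (\<lambda>x' x3. scale (\<epsilon> x') (\<sigma> y * \<sigma> x3)) x"
    by (subst sw_counit_left[where h = "\<lambda>z. \<sigma> z * _"]) (auto simp: additive_map_def algebra_simps)
  also have "\<dots> = sw (\<lambda>x' x3. \<sigma> y * \<sigma> (scale (\<epsilon> x') x3)) x"
    by (simp add: scale_mult)
  also have "\<dots> = \<sigma> y * \<sigma> x"
    by (subst sw_counit_left[where h = "\<lambda>z. _ * \<sigma> z"]) (auto simp: additive_map_def algebra_simps)
  finally show ?thesis .
qed

lemma sigma_one [simp]: "\<sigma> 1 = 1"
proof -
  have "\<sigma> 1 * 1 = 1"
    using sw_antipode_left[of "\<lambda>z. z" 1] sw_one[of "\<lambda>x y. \<sigma> x * y"] by (auto simp: balanced_def algebra_simps scale_mult additive_map_def)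
  then show ?thesis by simp
qed

lemma additive_eps: "additive_map \<epsilon>" and additive_sigma: "additive_map \<sigma>"
  by (auto simp: additive_map_def)

lemma eps_sigma [simp]: "\<epsilon> (\<sigma> a) = \<epsilon> a"
proof -
  have "\<epsilon> (\<sigma> a) = sw (\<lambda>x y. \<epsilon> (\<sigma> (scale (\<epsilon> y) x))) a"
    by (subst sw_counit_right[where h = "\<lambda>z. \<epsilon> (\<sigma> z)"]) (auto simp: additive_map_def)
  also have "\<dots> = sw (\<lambda>x y. \<epsilon> (\<sigma> x * y)) a" by (simp add: mult.commute)
  also have "\<dots> = \<epsilon> a" by (subst sw_antipode_left[OF additive_eps]) simp
  finally show ?thesis .
qed

text \<open>The pattern of \<open>sigma_mult\<close> on the coalgebra side:
  \<open>\<Delta>(\<sigma> a)\<close> equals \<open>\<Delta>(\<sigma> a_1) \<Delta>(a_2) (\<sigma>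
  a_4 \<otimes> \<sigma> a_3)\<close>, and the first two factors collapse.\<close>

lemma sw_sigma:
  assumes f: "bal2 f"
  shows "sw f (\<sigma> a) = sw (\<lambda>x y. f (\<sigma> y) (\<sigma> x)) a"
proof -
  note bs = bal_simps bal2D[OF f]
  have "sw f (\<sigma> a) = sw (\<lambda>x y. sw (\<lambda>u v. sw (\<lambda>p q. f (p * (u * \<sigma> v)) q) (\<sigma> x)) y) a"
    by (subst sw_id_S(1)[where H = "\<lambda>x z. sw (\<lambda>p q. f (p * z) q) (\<sigma> x)"]) (auto simp: bs)
  also have "\<dots> = sw (\<lambda>x y. sw (\<lambda>u v. sw (\<lambda>u' u3. sw (\<lambda>u1 u2. sw (\<lambda>p q. f (p * (u1 * \<sigma> v)) (q * (u2 * \<sigma> u3))) (\<sigma> x)) u') u) y) a"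
    by (subst sw_id_S(2)[where H = "\<lambda>u z. sw (\<lambda>p q. f (p * (u * \<sigma> _)) (q * z)) (\<sigma> _)"]) (auto simp: bs)
  also have "\<dots> = sw (\<lambda>x y. sw (\<lambda>u v. sw (\<lambda>u' u3. sw (\<lambda>p q. f (p * \<sigma> v) (q * \<sigma> u3)) (\<sigma> x * u')) u) y) a"
  proof -
    have "sw (\<lambda>u1 u2. sw (\<lambda>p q. f (p * (u1 * \<sigma> v)) (q * (u2 * \<sigma> u3))) (\<sigma> x)) u'
      = sw (\<lambda>p q. f (p * \<sigma> v) (q * \<sigma> u3)) (\<sigma> x * u')" for v u3 x u'
      by (subst sw_swap, subst sw_mult) (auto simp: balanced_def algebra_simps scale_mult bal2D[OF f])
    then show ?thesis by simp
  qed
  also have "\<dots> = sw (\<lambda>y v. sw (\<lambda>x u. sw (\<lambda>u' u3. sw (\<lambda>p q. f (p * \<sigma> v) (q * \<sigma> u3)) (\<sigma> x * u')) u) y) a"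
    by (subst sw_coassoc) (auto simp: bs)
  also have "\<dots> = sw (\<lambda>y v. sw (\<lambda>u u3. sw (\<lambda>x u'. sw (\<lambda>p q. f (p * \<sigma> v) (q * \<sigma> u3)) (\<sigma> x * u')) u) y) a"
    by (subst sw_coassoc[where F = "\<lambda>x u' u3. sw (\<lambda>p q. f (p * \<sigma> _) (q * \<sigma> u3)) (\<sigma> x * u')"]) (auto simp: bs)
  also have "\<dots> = sw (\<lambda>y v. sw (\<lambda>p q. f (p * \<sigma> v) (q * \<sigma> y)) 1) a"
    by (subst sw_S_id'(1)[where H = "\<lambda>z w. sw (\<lambda>p q. f (p * \<sigma> _) (q * \<sigma> w)) z"]) (auto simp: bs)
  also have "\<dots> = sw (\<lambda>x y. f (\<sigma> y) (\<sigma> x)) a"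
    by (subst sw_one) (auto simp: bs)
  finally show ?thesis .
qed

end


section \<open>Integrals and bijectivity of the antipode\<close>

context fd_hopf_algebra
begin

lemma trace_cyclic:
  assumes "Vector_Spaces.linear scale scale \<phi>" "Vector_Spaces.linear scale scale \<psi>"
  shows "(\<Sum>b\<in>Basis. coord b (\<phi> (\<psi> b))) = (\<Sum>b\<in>Basis. coord b (\<psi> (\<phi> b)))"
proof -
  have *: "coord b (f x) = (\<Sum>c\<in>Basis. coord c x * coord b (f c))"
    if "Vector_Spaces.linear scale scale f" for f b x
  proof -
    have f: "additive_map f" "f (scale r y) = scale r (f y)" for r y
      using that by (auto simp: Vector_Spaces.linear_iff additive_map_def)
    have "coord b (f x) = coord b (f (\<Sum>c\<in>Basis. scale (coord c x) c))" by (simp add: sum_coord)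
    also have "\<dots> = (\<Sum>c\<in>Basis. coord c x * coord b (f c))"
      by (simp add: additive_map_simps(5)[OF f(1)] f(2))
    finally show ?thesis .
  qed
  have "(\<Sum>b\<in>Basis. coord b (\<phi> (\<psi> b))) = (\<Sum>b\<in>Basis. \<Sum>c\<in>Basis. coord c (\<psi> b) * coord b (\<phi> c))"
    by (intro sum.cong refl *[OF assms(1)])
  also have "\<dots> = (\<Sum>c\<in>Basis. \<Sum>b\<in>Basis. coord b (\<phi> c) * coord c (\<psi> b))"
    by (subst sum.swap) (simp add: mult.commute)
  also have "\<dots> = (\<Sum>c\<in>Basis. coord c (\<psi> (\<phi> c)))"
  proof (intro sum.cong refl)
    fix c
    show "(\<Sum>b\<in>Basis. coord b (\<phi> c) * coord c (\<psi> b)) = coord c (\<psi> (\<phi> c))"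
      by (rule *[OF assms(2), symmetric])
  qed
  finally show ?thesis .
qed

text \<open>A left integral of the dual algebra: under convolution, \<open>g * f = g(1) f\<close>
  for every functional \<open>g\<close>.\<close>

definition is_integral :: "('a \<Rightarrow> 'k) \<Rightarrow> bool" where
  "is_integral f \<longleftrightarrow> Vector_Spaces.linear scale (*) f \<and> (\<forall>x. sw (\<lambda>p q. scale (f q) p) x = scale (f x) 1)"

text \<open>The functionals \<open>x \<mapsto> Tr (y \<mapsto> x\<^sub>1 \<sigma>\<^sup>2(y\<^sub>1) f (x\<^sub>2 \<sigma>\<^sup>2(y\<^sub>2)))\<close> are integrals by cyclicity of the trace;
  for \<open>f\<close> the coordinates, their values at the images of the basis under \<open>\<sigma>\<close> sum to \<open>1\<close>.\<close>

lemma ex_integral: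
  obtains \<Lambda> w where "is_integral \<Lambda>" "\<Lambda> w \<noteq> 0"
proof -
  define E where "E = (\<lambda>j z. sw (\<lambda>p q. scale (coord j q) p) z)"
  define \<Lambda> where "\<Lambda> = (\<lambda>j x. \<Sum>b\<in>Basis. coord b (E j (x * \<sigma> (\<sigma> b))))"
  have E_lin: "E j (x + y) = E j x + E j y" "E j (scale c x) = scale c (E j x)" for j x y c
    by (auto simp: E_def bal_simps scale_sum_right)
  \<comment> \<open>By coassociativity \<open>E j\<close> is a map of left comodules.\<close>
  have E_comult: "sw G (E j z) = sw (\<lambda>p q. G p (E j q)) z" if G: "bal2 G" for G :: "'a \<Rightarrow> 'a \<Rightarrow> 'a" and j z
  proof -
    have "sw G (E j z) = sw (\<lambda>x y. sw (\<lambda>p q. G p (scale (coord j y) q)) x) z"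
    proof -
      have "additive_map (sw G)" by (simp add: additive_map_def sw_add[OF G])
      from additive_map_sw[OF this, of "\<lambda>p q. scale (coord j q) p" z] show ?thesis
        by (simp add: E_def sw_scale[OF G])
    qed
    also have "\<dots> = sw (\<lambda>x y. sw (\<lambda>p q. G x (scale (coord j q) p)) y) z"
      by (rule sw_coassoc) (auto simp: bal_simps bal2D[OF G])
    also have "\<dots> = sw (\<lambda>p q. G p (E j q)) z"
      using additive_map_sw[OF bal2_additive(1)[OF G]] by (simp add: E_def)
    finally show ?thesis .
  qed
  \<comment> \<open>The comodule property turns the right side into \<open>x_1 \<sigma>(y_1
    \<sigma>(y_2)) \<otimes> E j (x_2 \<sigma>(\<sigma> y_3))\<close>, where the antipode pair
    cancels.\<close>
  have shift: "sw (\<lambda>p q. G p (E j (q * \<sigma> (\<sigma> y)))) x =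
      sw (\<lambda>y1 y2. sw (\<lambda>p q. G (p * \<sigma> y1) q) (E j (x * \<sigma> (\<sigma> y2)))) y"
    if G: "bal2 G" for G :: "'a \<Rightarrow> 'a \<Rightarrow> 'a" and x y j
  proof -
    have "sw (\<lambda>p q. G (p * \<sigma> y1) q) (E j (x * \<sigma> (\<sigma> y2))) =
        sw (\<lambda>x1 x2. sw (\<lambda>s t. G (x1 * (\<sigma> (\<sigma> s) * \<sigma> y1)) (E j (x2 * \<sigma> (\<sigma> t)))) y2) x" for y1 y2
    proof -
      have "sw (\<lambda>p q. G (p * \<sigma> y1) q) (E j (x * \<sigma> (\<sigma> y2))) = sw (\<lambda>p q. G (p * \<sigma> y1) (E j q)) (x * \<sigma> (\<sigma> y2))"
        by (rule E_comult) (auto simp: balanced_def algebra_simps scale_mult bal2D[OF G])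
      also have "\<dots> = sw (\<lambda>x1 x2. sw (\<lambda>s t. G (x1 * s * \<sigma> y1) (E j (x2 * t))) (\<sigma> (\<sigma> y2))) x"
        by (rule sw_mult) (auto simp: balanced_def algebra_simps scale_mult bal2D[OF G] E_lin)
      also have "\<dots> = sw (\<lambda>x1 x2. sw (\<lambda>s t. G (x1 * (\<sigma> (\<sigma> s) * \<sigma> y1)) (E j (x2 * \<sigma> (\<sigma> t)))) y2) x"
      proof -
        have "sw (\<lambda>s t. G (x1 * s * \<sigma> y1) (E j (x2 * t))) (\<sigma> (\<sigma> y2)) =
            sw (\<lambda>s t. G (x1 * \<sigma> t * \<sigma> y1) (E j (x2 * \<sigma> s))) (\<sigma> y2)" for x1 x2
          by (rule sw_sigma) (auto simp: balanced_def algebra_simps scale_mult bal2D[OF G] E_lin)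
        moreover have "sw (\<lambda>s t. G (x1 * \<sigma> t * \<sigma> y1) (E j (x2 * \<sigma> s))) (\<sigma> y2) = sw (\<lambda>s t. G (x1 * (\<sigma> (\<sigma> s) * \<sigma> y1)) (E j (x2 * \<sigma> (\<sigma> t)))) y2" for x1 x2
          unfolding mult.assoc
          by (rule sw_sigma) (auto simp: balanced_def algebra_simps scale_mult bal2D[OF G] E_lin)
        ultimately show ?thesis by simp
      qed
      finally show ?thesis .
    qed
    then have "sw (\<lambda>y1 y2. sw (\<lambda>p q. G (p * \<sigma> y1) q) (E j (x * \<sigma> (\<sigma> y2)))) y =
       sw (\<lambda>x1 x2. sw (\<lambda>y1 y2. sw (\<lambda>s t. G (x1 * \<sigma> (y1 * \<sigma> s)) (E j (x2 * \<sigma> (\<sigma> t)))) y2) y) x"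
      by (simp add: sigma_mult sw_swap[of _ x])
    also have "\<dots> = sw (\<lambda>x1 x2. G x1 (E j (x2 * \<sigma> (\<sigma> y)))) x"
    proof -
      have "sw (\<lambda>y1 y2. sw (\<lambda>s t. G (x1 * \<sigma> (y1 * \<sigma> s)) (E j (x2 * \<sigma> (\<sigma> t)))) y2) y =
         G (x1 * \<sigma> 1) (E j (x2 * \<sigma> (\<sigma> y)))" for x1 x2
        by (rule sw_S_id(2)[where H = "\<lambda>u v. G (x1 * \<sigma> u) (E j (x2 * \<sigma> (\<sigma> v)))"])
           (auto simp: balanced_def algebra_simps scale_mult bal2D[OF G] E_lin)
      then show ?thesis by simp
    qed
    finally show ?thesis by simp
  qed
  have \<Lambda>_lin: "Vector_Spaces.linear scale (*) (\<Lambda> j)" for j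
    using linear_coord by (auto simp: Vector_Spaces.linear_iff \<Lambda>_def algebra_simps scale_mult E_lin sum.distrib sum_distrib_left)
  have integral: "is_integral (\<Lambda> j)" for j
    unfolding is_integral_def
  proof (intro conjI allI \<Lambda>_lin)
    fix x
    define g where "g = (\<lambda>y. E j (x * \<sigma> (\<sigma> y)))"
    have g: "Vector_Spaces.linear scale scale (\<lambda>y. D e (g y))" for e
      by (auto simp: Vector_Spaces.linear_iff vector_space_axioms g_def algebra_simps scale_mult E_lin)
    have b2: "bal2 (\<lambda>p q. scale (coord b q) p)" for b
      by (auto simp: bal_simps)
    have "sw (\<lambda>p q. scale (\<Lambda> j q) p) x = (\<Sum>b\<in>Basis. sw (\<lambda>p q. scale (coord b (E j (q * \<sigma> (\<sigma> b)))) p) x)"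
      unfolding \<Lambda>_def sw_def scale_sum_left by (rule sum.swap)
    also have "\<dots> = (\<Sum>b\<in>Basis. sw (\<lambda>c y. sw (\<lambda>e q. scale (coord b q) (e * \<sigma> c)) (g y)) b)"
      unfolding g_def by (intro sum.cong refl shift b2)
    also have "\<dots> = (\<Sum>c\<in>Basis. \<Sum>e\<in>Basis. scale (\<Sum>b\<in>Basis. coord b (D e (g (D c b)))) (e * \<sigma> c))"
      unfolding sw_def scale_sum_left
      by (subst sum.swap) (rule sum.cong[OF refl], rule sum.swap)
    \<comment> \<open>Cyclicity moves \<open>D c\<close> from before \<open>g\<close> to after
      \<open>D e\<close>. Then \<open>e\<close> and \<open>c\<close> run over consecutive legs of
      \<open>g b\<close>, so that \<open>e * \<sigma> c\<close> cancels.\<close>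
    also have "\<dots> = (\<Sum>c\<in>Basis. \<Sum>e\<in>Basis. scale (\<Sum>b\<in>Basis. coord b (D c (D e (g b)))) (e * \<sigma> c))"
      by (intro sum.cong refl arg_cong2[where f = scale] trace_cyclic g linear_D)
    also have "\<dots> = (\<Sum>e\<in>Basis. \<Sum>c\<in>Basis. scale (\<Sum>b\<in>Basis. coord b (D c (D e (g b)))) (e * \<sigma> c))"
      by (rule sum.swap)
    also have "\<dots> = (\<Sum>b\<in>Basis. sw (\<lambda>e z. sw (\<lambda>c w. scale (coord b w) (e * \<sigma> c)) z) (g b))"
      unfolding sw_def scale_sum_left
      by (subst (2) sum.swap) (rule sum.cong[OF refl], rule sum.swap)
    also have "\<dots> = (\<Sum>b\<in>Basis. scale (coord b (g b)) 1)"
      by (intro sum.cong refl sw_S_id(2)[where H = "\<lambda>u v. scale (coord _ v) u"] b2)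
    also have "\<dots> = scale (\<Lambda> j x) 1" by (simp add: \<Lambda>_def g_def scale_sum_left)
    finally show "sw (\<lambda>p q. scale (\<Lambda> j q) p) x = scale (\<Lambda> j x) 1" .
  qed
  \<comment> \<open>Another use of cyclicity, for each fixed \<open>i\<close>, leaves the
    \<open>j\<close>-th coordinates of \<open>\<sigma>(p) q\<close> taken over
    \<open>\<sigma> j\<close>, that is, of \<open>\<epsilon>(j) 1\<close>.\<close>
  have "(\<Sum>j\<in>Basis. \<Lambda> j (\<sigma> j)) = (\<Sum>j\<in>Basis. \<Sum>i\<in>Basis. coord j (D i (\<sigma> (\<sigma> i * j))))"
  proof -
    have "coord i (E j m) = coord j (D i m)" if "i \<in> Basis" for i j m
      using that finite_Basis by (simp add: E_def sw_def coord_Basis if_distrib[of "(*) _"] cong: if_cong)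
    then show ?thesis by (simp add: \<Lambda>_def sigma_mult)
  qed
  also have "\<dots> = (\<Sum>i\<in>Basis. \<Sum>j\<in>Basis. coord j (D i (\<sigma> (\<sigma> i * j))))" by (rule sum.swap)
  also have "\<dots> = (\<Sum>i\<in>Basis. \<Sum>j\<in>Basis. coord j (\<sigma> i * D i (\<sigma> j)))"
    by (intro sum.cong refl trace_cyclic)
       (auto simp: Vector_Spaces.linear_iff vector_space_axioms algebra_simps scale_mult)
  also have "\<dots> = (\<Sum>j\<in>Basis. coord j (sw (\<lambda>p q. \<sigma> p * q) (\<sigma> j)))"
    unfolding sw_def coord_sum by (rule sum.swap)
  also have "\<dots> = (\<Sum>j\<in>Basis. \<epsilon> (scale (coord j 1) j))"
    using sw_antipode_left[of "\<lambda>z. z"] by (simp add: additive_map_def mult.commute)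
  also have "\<dots> = 1"
    by (simp only: additive_map_simps(5)[OF additive_eps, symmetric] sum_coord counit_one)
  finally have "(\<Sum>j\<in>Basis. \<Lambda> j (\<sigma> j)) = 1" .
  then obtain j where "\<Lambda> j (\<sigma> j) \<noteq> 0" by (metis (no_types, lifting) sum.neutral zero_neq_one)
  with integral that show ?thesis by blast
qed

text \<open>An integral recovers \<open>h\<close> from \<open>\<sigma> h\<close>: if
  \<open>\<sigma> h = 0\<close>, all \<open>\<Lambda>(x \<sigma>(h_1)) h_2\<close> vanish, while
  \<open>\<Lambda>(w) h\<close> is a sum of images of such elements under the operators
  \<open>D c\<close>.\<close>

lemma inj_sigma: "inj \<sigma>"
proof -
  have "h = 0" if "\<sigma> h = 0" for h
  proof -
    obtain \<Lambda> w where \<Lambda>: "is_integral \<Lambda>" and w: "\<Lambda> w \<noteq> 0" by (rule ex_integral)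
    have \<Lambda>_lin: "\<Lambda> (x + y) = \<Lambda> x + \<Lambda> y" "\<Lambda> (scale c x) = c * \<Lambda> x" for x y c
      using \<Lambda> by (auto simp: is_integral_def Vector_Spaces.linear_iff)
    have \<Lambda>_int: "scale (\<Lambda> x) 1 = sw (\<lambda>p q. scale (\<Lambda> q) p) x" for x
      using \<Lambda> by (simp add: is_integral_def)
    \<comment> \<open>By the integral property, \<open>\<Lambda>(x \<sigma>(h_1)) h_2 = x_1
      \<sigma>(h_2) h_3 \<Lambda>(x_2 \<sigma>(h_1)) = x_1 \<Lambda>(x_2
      \<sigma>(h))\<close>.\<close>
    have zero: "sw (\<lambda>h1 h2. scale (\<Lambda> (x * \<sigma> h1)) h2) h = 0" for x
    proof -
      have "sw (\<lambda>h1 h2. scale (\<Lambda> (x * \<sigma> h1)) h2) h = sw (\<lambda>h1 h2. scale (\<Lambda> (x * \<sigma> h1)) 1 * h2) h"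
        by (simp add: scale_mult)
      also have "\<dots> = sw (\<lambda>h' h3. sw (\<lambda>p q. scale (\<Lambda> q) (p * h3)) (x * \<sigma> h')) h"
        unfolding \<Lambda>_int by (simp add: sw_def sum_distrib_right scale_mult)
      also have "\<dots> = sw (\<lambda>h' h3. sw (\<lambda>h1 h2. sw (\<lambda>p q. scale (\<Lambda> (q * \<sigma> h1)) (p * \<sigma> h2 * h3)) x) h') h"
      proof -
        have "sw (\<lambda>p q. scale (\<Lambda> q) (p * h3)) (x * \<sigma> h') =
          sw (\<lambda>p q. sw (\<lambda>p' q'. scale (\<Lambda> (q * q')) (p * p' * h3)) (\<sigma> h')) x" for h' h3
          by (rule sw_mult) (auto simp: bal_simps \<Lambda>_lin)
        moreover have "sw (\<lambda>p' q'. scale (\<Lambda> (q * q')) (p * p' * h3)) (\<sigma> h') =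
          sw (\<lambda>h1 h2. scale (\<Lambda> (q * \<sigma> h1)) (p * \<sigma> h2 * h3)) h'" for p q h' h3
          by (rule sw_sigma) (auto simp: bal_simps \<Lambda>_lin)
        ultimately show ?thesis by (simp add: sw_swap[of _ _ x])
      qed
      also have "\<dots> = sw (\<lambda>p q. sw (\<lambda>h' h3. sw (\<lambda>h1 h2. scale (\<Lambda> (q * \<sigma> h1)) (p * (\<sigma> h2 * h3))) h') h) x"
        by (simp add: sw_swap[of _ _ x] mult.assoc)
      also have "\<dots> = sw (\<lambda>p q. scale (\<Lambda> (q * \<sigma> h)) (p * 1)) x"
      proof -
        have "sw (\<lambda>h' h3. sw (\<lambda>h1 h2. scale (\<Lambda> (q * \<sigma> h1)) (p * (\<sigma> h2 * h3))) h') h = scale (\<Lambda> (q * \<sigma> h)) (p * 1)" for p q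
          by (rule sw_id_S'(2)[where H = "\<lambda>u v. scale (\<Lambda> (q * \<sigma> u)) (p * v)"]) (auto simp: bal_simps \<Lambda>_lin)
        then show ?thesis by simp
      qed
      also have "\<dots> = 0" using that \<Lambda>_lin(2)[of 0 0] by (simp add: sw_def)
      finally show ?thesis .
    qed
    have "scale (\<Lambda> w) h = scale (\<Lambda> (w * \<sigma> 1)) h" by simp
    also have "\<dots> = sw (\<lambda>h1 h'. sw (\<lambda>h2 h3. scale (\<Lambda> (w * \<sigma> (h1 * \<sigma> h2))) h3) h') h"
      by (rule sw_S_id(2)[symmetric, where H = "\<lambda>u v. scale (\<Lambda> (w * \<sigma> u)) v"]) (auto simp: bal_simps \<Lambda>_lin)
    \<comment> \<open>The leg \<open>h_2\<close> runs over the basis elements \<open>c\<close>, and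
      \<open>\<sigma>(h_1 \<sigma>(c)) = \<sigma>(\<sigma> c) \<sigma>(h_1)\<close>. What remains is
      \<open>zero\<close> at \<open>x = w \<sigma>(\<sigma> c)\<close>.\<close>
    also have "\<dots> = (\<Sum>c\<in>Basis. sw (\<lambda>h1 h'. D c (scale (\<Lambda> ((w * \<sigma> (\<sigma> c)) * \<sigma> h1)) h')) h)"
      unfolding sw_def D_scale sigma_mult mult.assoc by (rule sum.swap)
    also have "\<dots> = (\<Sum>c\<in>Basis. D c (sw (\<lambda>h1 h2. scale (\<Lambda> ((w * \<sigma> (\<sigma> c)) * \<sigma> h1)) h2) h))"
      by (simp add: additive_map_sw[OF additive_D])
    also have "\<dots> = 0" by (simp only: zero) simp
    finally show ?thesis using w by simp
  qed
  then show ?thesis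
    by (metis additive_map_simps(4)[OF additive_sigma] eq_iff_diff_eq_0 injI)
qed

section \<open>The inverse of the antipode\<close>

lemma bij_sigma: "bij \<sigma>"
proof -
  have "surj \<sigma>"
  proof -
    interpret finite_dimensional_vector_space_pair scale Basis scale Basis
      by unfold_locales
    show ?thesis by (rule linear_injective_imp_surjective[OF antipode_linear inj_sigma]) simp
  qed
  with inj_sigma show ?thesis by (simp add: bij_def)
qed

definition \<tau> :: "'a \<Rightarrow> 'a" where "\<tau> = inv_into UNIV \<sigma>"

lemma sigma_tau [simp]: "\<sigma> (\<tau> x) = x" and tau_sigma [simp]: "\<tau> (\<sigma> x) = x"
  using bij_sigma by (simp_all add: \<tau>_def bij_def surj_f_inv_f)

lemma tau_add [simp]: "\<tau> (x + y) = \<tau> x + \<tau> y"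
  and tau_scale [simp]: "\<tau> (scale c x) = scale c (\<tau> x)"
  and tau_mult: "\<tau> (x * y) = \<tau> y * \<tau> x"
  by (metis sigma_tau tau_sigma sigma_add, metis sigma_tau tau_sigma sigma_scale,
      metis sigma_tau tau_sigma sigma_mult)

lemma tau_one [simp]: "\<tau> 1 = 1"
  by (metis sigma_one tau_sigma)

lemma sw_tau:
  assumes f: "bal2 f"
  shows "sw f (\<tau> a) = sw (\<lambda>x y. f (\<tau> y) (\<tau> x)) a"
proof -
  have "sw (\<lambda>u v. f (\<tau> v) (\<tau> u)) (\<sigma> (\<tau> a)) = sw (\<lambda>x y. f (\<tau> (\<sigma> x)) (\<tau> (\<sigma> y))) (\<tau> a)"
    by (rule sw_sigma) (auto simp: bal_simps bal2D[OF f])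
  then show ?thesis by simp
qed

text \<open>Applying \<open>\<tau>\<close> to the right antipode axiom reverses the factors.\<close>

lemma sw_skew_right: "additive_map h \<Longrightarrow> sw (\<lambda>x y. h (y * \<tau> x)) a = h (scale (\<epsilon> a) 1)"
  using sw_antipode_right[of "\<lambda>z. h (\<tau> z)" a] by (simp add: tau_mult additive_map_def)

end


section \<open>Ranks of modules over a subalgebra\<close>

context vector_space
begin

text \<open>The functions \<open>'a \<Rightarrow> 'a\<close>, which serve as a module below, need
  not form a finite dimensional space, so finiteness is carried by a spanning set
  \<open>F\<close>.\<close>

lemma finite_basis_in_span:
  assumes "finite F" "V \<subseteq> span F"
  obtains B where "B \<subseteq> V" "independent B" "V \<subseteq> span B" "finite B" "card B = dim V"
proof -
  obtain B where B: "B \<subseteq> V" "independent B" "V \<subseteq> span B" "card B = dim V" by (rule basis_exists)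
  moreover have "finite B" using independent_span_bound[OF assms(1) B(2)] B(1) assms(2) by blast
  ultimately show ?thesis using that by blast
qed

lemma dim_mono_in_span:
  assumes "finite F" "Y \<subseteq> span F" "W \<subseteq> Y"
  shows "dim W \<le> dim Y"
proof -
  obtain B where "Y \<subseteq> span B" "finite B" "card B = dim Y" using finite_basis_in_span[OF assms(1,2)] by metis
  then show ?thesis using dim_le_card[of W B] assms(3) by auto
qed

end

context vector_space_pair
begin

text \<open>Rank-nullity for the map \<open>U \<rightarrow> V / W\<close> induced by \<open>f\<close>.\<close>

lemma dim_image_mod:
  assumes f: "Vector_Spaces.linear s1 s2 f"
    and U: "vs1.subspace U" "finite F" "U \<subseteq> vs1.span F"
    and W: "vs2.subspace W" "finite G" "W \<subseteq> vs2.span G"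
  shows "vs2.dim {x + f u |x u. x \<in> W \<and> u \<in> U} + vs1.dim {u \<in> U. f u \<in> W} = vs2.dim W + vs1.dim U"
proof -
  interpret f: Vector_Spaces.linear s1 s2 f by (rule f)
  let ?K = "{u \<in> U. f u \<in> W}"
  have K: "vs1.subspace ?K"
    using U(1) W(1) by (auto simp: vs1.subspace_def vs2.subspace_def f.add f.scale f.zero)
  obtain BX where BX: "BX \<subseteq> W" "vs2.independent BX" "W \<subseteq> vs2.span BX" "finite BX" "card BX = vs2.dim W"
    by (rule vs2.finite_basis_in_span[OF W(2,3)])
  have spX: "vs2.span BX = W" using BX W(1) by (simp add: vs2.span_minimal subset_antisym)
  have KF: "?K \<subseteq> vs1.span F" using U(3) by auto
  obtain B0 where B0: "B0 \<subseteq> ?K" "vs1.independent B0" "?K \<subseteq> vs1.span B0" "finite B0" "card B0 = vs1.dim ?K"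
    by (rule vs1.finite_basis_in_span[OF U(2) KF])
  have "B0 \<subseteq> U" using B0(1) by auto
  then obtain B where B: "B0 \<subseteq> B" "B \<subseteq> U" "vs1.independent B" "U \<subseteq> vs1.span B"
    using vs1.maximal_independent_subset_extend[OF _ B0(2)] by metis
  have finB: "finite B" using vs1.independent_span_bound[OF U(2) B(3)] B(2) U(3) by blast
  have cardB: "card B = vs1.dim U" by (rule vs1.basis_card_eq_dim[OF B(2,4,3)])
  have spU: "vs1.span B = U" using B U(1) by (simp add: vs1.span_minimal subset_antisym)
  \<comment> \<open>Basis vectors outside \<open>B0\<close> stay independent modulo
    \<open>W\<close>: a dependency would put some \<open>c - u\<close> into the kernel, which
    \<open>B0\<close> spans, against the independence of \<open>B\<close>.\<close>
  have ind: "vs2.independent (BX \<union> f ` C) \<and> card (BX \<union> f ` C) = card BX + card C"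
    if "finite C" "C \<subseteq> B - B0" for C
    using that
  proof (induction C rule: finite_induct)
    case empty
    then show ?case using BX by simp
  next
    case (insert c C)
    have notin: "f c \<notin> vs2.span (BX \<union> f ` C)"
    proof
      assume "f c \<in> vs2.span (BX \<union> f ` C)"
      then obtain x u where xu: "f c = x + f u" "x \<in> W" "u \<in> vs1.span C"
        unfolding vs2.span_Un spX f.span_image by auto
      have "vs1.span C \<subseteq> U" using insert.prems B(2) spU vs1.span_mono[of C B] by auto
      then have "c - u \<in> U" using xu insert.prems B(2) vs1.subspace_diff[OF U(1)] by blast
      moreover have "f (c - u) \<in> W" using xu by (simp add: f.diff)
      ultimately have "c - u \<in> vs1.span B0" using B0(3) by auto
      then have "(c - u) + u \<in> vs1.span (B0 \<union> C)"
        using xu(3) by (intro vs1.span_add) (auto intro: vs1.span_mono[THEN subsetD])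
      then have "c \<in> vs1.span (B - {c})"
        using insert.hyps insert.prems B(1) vs1.span_mono[of "B0 \<union> C" "B - {c}"] by auto
      then show False using B(3) insert.prems by (auto simp: vs1.dependent_def)
    qed
    then have "f c \<notin> BX \<union> f ` C" by (meson vs2.span_base)
    moreover have "BX \<union> f ` insert c C = insert (f c) (BX \<union> f ` C)" by auto
    ultimately show ?case
      using insert vs2.independent_insertI[OF notin] BX(4) by auto
  qed
  have "finite (B - B0)" using finB by simp
  note ind = ind[OF this subset_refl]
  have "vs2.span (BX \<union> f ` (B - B0)) = {x + f u |x u. x \<in> W \<and> u \<in> U}" (is "?l = ?r")
  proof (intro equalityI subsetI)
    fix v assume "v \<in> ?l"
    then obtain x u where "v = x + f u" "x \<in> W" "u \<in> vs1.span (B - B0)"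
      unfolding vs2.span_Un spX f.span_image by auto
    then show "v \<in> ?r" using vs1.span_mono[of "B - B0" B] spU by auto
  next
    fix v assume "v \<in> ?r"
    then obtain x u where v: "v = x + f u" "x \<in> W" "u \<in> U" by auto
    have "u \<in> vs1.span (B0 \<union> (B - B0))" using v(3) B(1,4) by (auto simp: Un_absorb1)
    then obtain a b where u: "u = a + b" "a \<in> vs1.span B0" "b \<in> vs1.span (B - B0)"
      unfolding vs1.span_Un by auto
    have "vs1.span B0 \<subseteq> ?K" by (rule vs1.span_minimal[OF B0(1) K])
    then have "x + f a \<in> W" using u(2) v(2) vs2.subspace_add[OF W(1)] by auto
    moreover have "v = (x + f a) + f b" by (simp add: v u f.add)
    ultimately show "v \<in> ?l" unfolding vs2.span_Un spX f.span_image using u(3) by blast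
  qed
  then have "vs2.dim ?r = card (BX \<union> f ` (B - B0))" using ind by (metis vs2.dim_span_eq_card_independent)
  also have "\<dots> = card BX + (card B - card B0)" using ind B(1) B0(4) by (simp add: card_Diff_subset)
  finally show ?thesis
    using BX(5) B0(5) cardB card_mono[OF finB B(1)] by simp
qed

end

locale fd_subalgebra = k_algebra scale + finite_dimensional_vector_space scale Basis
  for scale :: "'k::field \<Rightarrow> 'a::ring_1 \<Rightarrow> 'a" and Basis :: "'a set" +
  fixes S :: "'a set"
  assumes subalgebra_S: "subalgebra scale S"
begin

lemma subspace_S: "subspace S" and one_S: "1 \<in> S" and mult_S: "x \<in> S \<Longrightarrow> y \<in> S \<Longrightarrow> x * y \<in> S"
  using subalgebra_S by (auto simp: subalgebra_def)

definition right_ideal :: "'a set \<Rightarrow> bool" where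
  "right_ideal L \<longleftrightarrow> subspace L \<and> L \<subseteq> S \<and> (\<forall>x\<in>L. \<forall>s\<in>S. x * s \<in> L)"

text \<open>The right ideal \<open>L A\<close>, formed inside \<open>A\<close> and not as a tensor
  product over \<open>S\<close>.\<close>

definition ext :: "'a set \<Rightarrow> 'a set" where
  "ext L = span {x * a |x a. x \<in> L}"

lemma right_ideal_S: "right_ideal S"
  by (auto simp: right_ideal_def subspace_S mult_S)

lemma ext_superset: "L \<subseteq> ext L"
  unfolding ext_def by (rule subsetI, rule span_base) (use mult_1_right[symmetric] in blast)

lemma ext_mult: "x \<in> ext L \<Longrightarrow> x * b \<in> ext L"
  unfolding ext_def
proof (induction x rule: span_induct_alt)
  case base
  then show ?case by (simp add: span_zero)
next
  case (step c x y)
  then obtain l a where "x = l * a" "l \<in> L" by auto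
  then have "scale c (x * b) \<in> span {x * a |x a. x \<in> L}"
    by (intro span_scale span_base) (auto simp: mult.assoc)
  with step show ?case
    by (simp add: distrib_right scale_mult_left[symmetric] span_add)
qed

lemma ext_eq_UNIV: "1 \<in> ext L \<Longrightarrow> ext L = UNIV"
  using ext_mult[of 1 L] by auto

lemma ext_subset: "subspace W \<Longrightarrow> (\<And>x a. x \<in> L \<Longrightarrow> x * a \<in> W) \<Longrightarrow> ext L \<subseteq> W"
  unfolding ext_def by (rule span_minimal) auto

lemma ext_mono: "L \<subseteq> M \<Longrightarrow> ext L \<subseteq> ext M"
  unfolding ext_def by (rule span_mono) auto

lemma subspace_ext: "subspace (ext L)"
  by (simp add: ext_def)

lemma ext_S: "ext S = UNIV"
  using ext_eq_UNIV ext_superset one_S by blast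

lemma ext_zero: "ext {0} = {0}"
  using ext_subset[of "{0}" "{0}"] ext_superset[of "{0}"] by (auto simp: subspace_single_0)

lemma right_ideal_zero: "right_ideal {0}"
  by (auto simp: right_ideal_def subspace_single_0 subspace_0[OF subspace_S])

end

text \<open>A bound \<open>\<rho>\<close> on \<open>dim (A / LA) / dim (S / L)\<close> makes \<open>\<rho> * dim W - dim (W A)\<close> monotone in the
  \<open>S\<close>-submodule \<open>W\<close>, because it extends from the cyclic modules \<open>S / L\<close> to all subquotients.\<close>

locale bounded_rank = fd_subalgebra scale Basis S
  for scale :: "'k::field \<Rightarrow> 'a::ring_1 \<Rightarrow> 'a" and Basis S +
  fixes \<rho> :: real
  assumes rank_bound: "right_ideal L \<Longrightarrow> real (dim (UNIV :: 'a set)) - real (dim (ext L)) \<le> \<rho> * (real (dim S) - real (dim L))"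
begin

text \<open>Equality \<open>excess L = excess S\<close> says that \<open>L\<close> attains
  \<open>rank_bound\<close>.\<close>

definition excess :: "'a set \<Rightarrow> real" where
  "excess L = \<rho> * real (dim L) - real (dim (ext L))"

lemma excess_le: "right_ideal L \<Longrightarrow> excess L \<le> excess S"
  using rank_bound[of L] by (simp add: excess_def ext_S algebra_simps)

text \<open>\<open>excess\<close> is supermodular: dimensions are modular, \<open>(L + M) A\<close>
  lies in \<open>L A + M A\<close>, and \<open>(L \<inter> M) A\<close> lies in
  \<open>L A \<inter> M A\<close>. As \<open>excess S\<close> bounds the values at
  \<open>L + M\<close> and \<open>L \<inter> M\<close>, both attain it.\<close>

lemma exact_Int:
  assumes L: "right_ideal L" "excess L = excess S" and M: "right_ideal M" "excess M = excess S"
  shows "right_ideal (L \<inter> M)" "excess (L \<inter> M) = excess S"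
proof -
  show 1: "right_ideal (L \<inter> M)" using L(1) M(1) by (auto simp: right_ideal_def subspace_inter)
  let ?LM = "{x + y |x y. x \<in> L \<and> y \<in> M}" and ?E = "{x + y |x y. x \<in> ext L \<and> y \<in> ext M}"
  have sL: "subspace L" and sM: "subspace M" using L(1) M(1) by (auto simp: right_ideal_def)
  have LM: "right_ideal ?LM"
    unfolding right_ideal_def
  proof (intro conjI ballI)
    show "subspace ?LM" by (rule subspace_sums[OF sL sM])
    show "?LM \<subseteq> S" using L(1) M(1) subspace_add[OF subspace_S] unfolding right_ideal_def by blast
    fix z s assume "z \<in> ?LM" "s \<in> S"
    then obtain x y where "z = x + y" "x \<in> L" "y \<in> M" by auto
    with \<open>s \<in> S\<close> L(1) M(1) have "z * s = x * s + y * s" "x * s \<in> L" "y * s \<in> M"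
      by (auto simp: right_ideal_def algebra_simps)
    then show "z * s \<in> ?LM" by blast
  qed
  have "ext ?LM \<subseteq> ?E"
  proof (rule ext_subset[OF subspace_sums[OF subspace_ext subspace_ext]])
    fix z a assume "z \<in> ?LM"
    then obtain x y where "z = x + y" "x \<in> L" "y \<in> M" by auto
    then have "z * a = x * a + y * a" "x * a \<in> ext L" "y * a \<in> ext M"
      using ext_superset ext_mult by (auto simp: algebra_simps) blast+
    then show "z * a \<in> ?E" by blast
  qed
  then have "dim (ext ?LM) \<le> dim ?E" by (rule dim_subset)
  moreover have "dim ?E + dim (ext L \<inter> ext M) = dim (ext L) + dim (ext M)"
    by (rule dim_sums_Int[OF subspace_ext subspace_ext])
  moreover have "dim (ext (L \<inter> M)) \<le> dim (ext L \<inter> ext M)"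
    using ext_mono[of "L \<inter> M" L] ext_mono[of "L \<inter> M" M] by (intro dim_subset) auto
  moreover have "dim ?LM + dim (L \<inter> M) = dim L + dim M" by (rule dim_sums_Int[OF sL sM])
  from arg_cong[OF this, of "\<lambda>n. \<rho> * real n"]
  have "\<rho> * real (dim ?LM) + \<rho> * real (dim (L \<inter> M)) = \<rho> * real (dim L) + \<rho> * real (dim M)"
    by (simp only: of_nat_add distrib_left)
  ultimately have "excess (L \<inter> M) + excess ?LM \<ge> excess L + excess M"
    by (simp add: excess_def)
  with excess_le[OF LM] excess_le[OF 1] L M show "excess (L \<inter> M) = excess S" by linarith
qed

end

locale bounded_rank_module = bounded_rank scale Basis S \<rho> + V: vector_space sv
  for scale :: "'k::field \<Rightarrow> 'a::ring_1 \<Rightarrow> 'a" and Basis S \<rho>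
    and sv :: "'k \<Rightarrow> 'v::ab_group_add \<Rightarrow> 'v" +
  fixes act :: "'v \<Rightarrow> 'a \<Rightarrow> 'v"
  assumes act_add_left: "act (v + v') a = act v a + act v' a"
    and act_scale_left: "act (sv c v) a = sv c (act v a)"
    and act_add_right: "act v (a + a') = act v a + act v a'"
    and act_scale_right: "act v (scale c a) = sv c (act v a)"
    and act_one: "act v 1 = v"
    and act_mult: "act v (a * b) = act (act v a) b"
begin

text \<open>Submodules over \<open>S\<close>, not over \<open>A\<close>; they are finite dimensional
  although the ambient space need not be.\<close>

definition submodule :: "'v set \<Rightarrow> bool" where
  "submodule W \<longleftrightarrow> V.subspace W \<and> (\<exists>F. finite F \<and> W \<subseteq> V.span F) \<and> (\<forall>x\<in>W. \<forall>s\<in>S. act x s \<in> W)"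

definition extV :: "'v set \<Rightarrow> 'v set" where
  "extV W = V.span {act x a |x a. x \<in> W}"

definition excessV :: "'v set \<Rightarrow> real" where
  "excessV W = \<rho> * real (V.dim W) - real (V.dim (extV W))"

text \<open>The annihilator in \<open>S\<close> of the class of \<open>v\<close> modulo
  \<open>W\<close>, so that \<open>(W + v S) / W\<close> is \<open>S\<close> modulo it.\<close>

definition transporter :: "'v \<Rightarrow> 'v set \<Rightarrow> 'a set" where
  "transporter v W = {s \<in> S. act v s \<in> W}"

lemma linear_act: "Vector_Spaces.linear scale sv (act v)"
  by (auto simp: Vector_Spaces.linear_iff vector_space_axioms V.vector_space_axioms act_add_right act_scale_right)

lemma linear_act_left: "Vector_Spaces.linear sv sv (\<lambda>v. act v a)"
  by (auto simp: Vector_Spaces.linear_iff V.vector_space_axioms act_add_left act_scale_left)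

lemma act_extV: "x \<in> extV W \<Longrightarrow> act x b \<in> extV W"
proof -
  interpret l: Vector_Spaces.linear sv sv "\<lambda>v. act v b" by (rule linear_act_left)
  assume "x \<in> extV W"
  then have "act x b \<in> V.span ((\<lambda>v. act v b) ` {act x a |x a. x \<in> W})"
    unfolding extV_def l.span_image by blast
  moreover have "(\<lambda>v. act v b) ` {act x a |x a. x \<in> W} \<subseteq> {act x a |x a. x \<in> W}"
    using act_mult[symmetric] by blast
  ultimately show ?thesis unfolding extV_def using V.span_mono by blast
qed

lemma extV_superset: "W \<subseteq> extV W"
  unfolding extV_def by (rule subsetI, rule V.span_base) (use act_one[symmetric] in blast)

lemma extV_finite:
  assumes "submodule W"
  obtains F where "finite F" "extV W \<subseteq> V.span F"
proof -
  obtain F where F: "finite F" "W \<subseteq> V.span F" using assms by (auto simp: submodule_def)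
  let ?G = "(\<lambda>(v, b). act v b) ` (F \<times> Basis)"
  have "act x a \<in> V.span ?G" if "x \<in> W" for x a
  proof -
    interpret l: Vector_Spaces.linear sv sv "\<lambda>v. act v a" by (rule linear_act_left)
    have "act x a \<in> V.span ((\<lambda>v. act v a) ` F)"
      unfolding l.span_image using F(2) that by blast
    moreover have "act v a \<in> V.span ?G" if "v \<in> F" for v
    proof -
      interpret r: Vector_Spaces.linear scale sv "act v" by (rule linear_act)
      have "act v a \<in> V.span (act v ` Basis)"
        unfolding r.span_image span_Basis by blast
      moreover have "act v ` Basis \<subseteq> ?G" using that by force
      ultimately show ?thesis using V.span_mono by blast
    qed
    then have "V.span ((\<lambda>v. act v a) ` F) \<subseteq> V.span ?G"
      by (intro V.span_minimal) auto
    ultimately show ?thesis by blast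
  qed
  then have "extV W \<subseteq> V.span ?G" unfolding extV_def by (intro V.span_minimal) auto
  moreover have "finite ?G" using F(1) finite_Basis by simp
  ultimately show ?thesis using that by blast
qed

lemma right_ideal_transporter:
  assumes "submodule W"
  shows "right_ideal (transporter v W)"
proof -
  interpret r: Vector_Spaces.linear scale sv "act v" by (rule linear_act)
  have W: "V.subspace W" "\<And>x s. x \<in> W \<Longrightarrow> s \<in> S \<Longrightarrow> act x s \<in> W"
    using assms by (auto simp: submodule_def)
  have "transporter v W = S \<inter> act v -` W" by (auto simp: transporter_def)
  then have "subspace (transporter v W)"
    using r.subspace_vimage[OF W(1)] subspace_inter[OF subspace_S] by simp
  then show ?thesis
    using W(2) by (auto simp: right_ideal_def transporter_def act_mult mult_S)
qed

text \<open>For the transporter \<open>I\<close> of \<open>v\<close>, the quotient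
  \<open>Y / W\<close> is \<open>S / I\<close>, and \<open>Y A / W A\<close> is a quotient of
  \<open>A / I A\<close> because \<open>v I A\<close> lies in \<open>W A\<close>.\<close>

lemma add_generator:
  fixes v
  assumes W: "submodule W"
  defines "Y \<equiv> {x + act v s |x s. x \<in> W \<and> s \<in> S}"
  shows "submodule Y" "V.dim Y + dim (transporter v W) = V.dim W + dim S"
    "V.dim (extV Y) + dim (ext (transporter v W)) \<le> V.dim (extV W) + dim (UNIV :: 'a set)"
proof -
  interpret r: Vector_Spaces.linear scale sv "act v" by (rule linear_act)
  interpret P: vector_space_pair scale sv by unfold_locales
  obtain F where F: "finite F" "W \<subseteq> V.span F" using W by (auto simp: submodule_def)
  have sX: "V.subspace W" using W by (auto simp: submodule_def)
  obtain G where G: "finite G" "extV W \<subseteq> V.span G" by (rule extV_finite[OF W])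
  show dimY: "V.dim Y + dim (transporter v W) = V.dim W + dim S"
    unfolding Y_def transporter_def
    by (rule P.dim_image_mod[OF linear_act subspace_S finite_Basis _ sX F]) (simp add: span_Basis)
  show Y: "submodule Y"
    unfolding submodule_def
  proof (intro conjI ballI)
    have "Y = {x + y |x y. x \<in> W \<and> y \<in> act v ` S}" by (auto simp: Y_def)
    then show "V.subspace Y" using V.subspace_sums[OF sX r.subspace_image[OF subspace_S]] by simp
    have "Y \<subseteq> V.span (F \<union> act v ` Basis)"
      unfolding V.span_Un r.span_image span_Basis Y_def using F(2) by blast
    then show "\<exists>F. finite F \<and> Y \<subseteq> V.span F"
      using F(1) finite_Basis by (intro exI[of _ "F \<union> act v ` Basis"]) simp
    fix y s assume "y \<in> Y" "s \<in> S"
    then obtain x t where "y = x + act v t" "x \<in> W" "t \<in> S" by (auto simp: Y_def)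
    then have "act y s = act x s + act v (t * s)" "act x s \<in> W" "t * s \<in> S"
      using W \<open>s \<in> S\<close> by (auto simp: act_add_left act_mult submodule_def mult_S)
    then show "act y s \<in> Y" by (auto simp: Y_def)
  qed
  let ?Z = "{y + act v a |y a. y \<in> extV W \<and> a \<in> UNIV}"
  have sE: "V.subspace (extV W)" by (simp add: extV_def)
  have "V.dim ?Z + dim {a \<in> UNIV. act v a \<in> extV W} = V.dim (extV W) + dim (UNIV :: 'a set)"
    by (rule P.dim_image_mod[OF linear_act subspace_UNIV finite_Basis _ sE G]) (simp add: span_Basis)
  moreover have "V.dim (extV Y) \<le> V.dim ?Z"
  proof (rule V.dim_mono_in_span)
    show "finite (G \<union> act v ` Basis)" using G(1) finite_Basis by simp
    show "?Z \<subseteq> V.span (G \<union> act v ` Basis)"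
      unfolding V.span_Un r.span_image span_Basis using G(2) by blast
    have "?Z = {x + y |x y. x \<in> extV W \<and> y \<in> act v ` UNIV}" by auto
    then have sZ: "V.subspace ?Z" using V.subspace_sums[OF sE r.subspace_image[OF subspace_UNIV]] by simp
    show "extV Y \<subseteq> ?Z"
      unfolding extV_def[of Y]
    proof (rule V.span_minimal[OF _ sZ], safe)
      fix y a assume "y \<in> Y"
      then obtain x t where "y = x + act v t" "x \<in> W" "t \<in> S" by (auto simp: Y_def)
      then have "act y a = act x a + act v (t * a)" "act x a \<in> extV W"
        using extV_superset act_extV by (auto simp: act_add_left act_mult) blast
      then show "\<exists>x b. act y a = x + act v b \<and> x \<in> extV W \<and> b \<in> UNIV" by auto
    qed
  qed
  moreover have "dim (ext (transporter v W)) \<le> dim {a \<in> UNIV. act v a \<in> extV W}"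
  proof (rule dim_subset, rule ext_subset)
    show "subspace {a \<in> UNIV. act v a \<in> extV W}"
      using r.subspace_vimage[OF sE] by (simp add: vimage_def)
    show "x * a \<in> {a \<in> UNIV. act v a \<in> extV W}" if "x \<in> transporter v W" for x a
      using that act_extV[OF subsetD[OF extV_superset]] by (auto simp: transporter_def act_mult)
  qed
  ultimately show "V.dim (extV Y) + dim (ext (transporter v W)) \<le> V.dim (extV W) + dim (UNIV :: 'a set)"
    by linarith
qed

lemma excessV_add_generator:
  assumes W: "submodule W"
  shows "excessV W + (excess S - excess (transporter v W)) \<le> excessV {x + act v s |x s. x \<in> W \<and> s \<in> S}"
proof -
  let ?Y = "{x + act v s |x s. x \<in> W \<and> s \<in> S}"
  from arg_cong[OF add_generator(2)[OF W, of v], of "\<lambda>n. \<rho> * real n"]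
  have "\<rho> * real (V.dim ?Y) + \<rho> * real (dim (transporter v W)) = \<rho> * real (V.dim W) + \<rho> * real (dim S)"
    by (simp only: of_nat_add distrib_left)
  moreover have "real (V.dim (extV ?Y)) + dim (ext (transporter v W)) \<le> V.dim (extV W) + dim (UNIV :: 'a set)"
    using add_generator(3)[OF W, of v] by linarith
  ultimately show ?thesis by (simp add: excess_def excessV_def ext_S)
qed

text \<open>\<open>Y\<close> is reached by adding one generator at a time. For \<open>y\<close>
  outside \<open>W\<close> the transporter omits \<open>1\<close>, so the dimension grows strictly,
  and \<open>rank_bound\<close> makes each change of the excess nonnegative.\<close>

lemma excessV_mono:
  assumes "submodule W" "submodule Y" "W \<subseteq> Y"
  shows "excessV W \<le> excessV Y"
  using assms
proof (induction "V.dim Y - V.dim W" arbitrary: W rule: less_induct)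
  case less
  show ?case
  proof (cases "W = Y")
    case False
    then obtain y where y: "y \<in> Y" "y \<notin> W" using less.prems by auto
    let ?Z = "{x + act y s |x s. x \<in> W \<and> s \<in> S}"
    note Z = add_generator(1,2)[OF less.prems(1), of y]
    have ZY: "?Z \<subseteq> Y"
      using less.prems y by (auto simp: submodule_def intro!: V.subspace_add)
    have T: "right_ideal (transporter y W)" by (rule right_ideal_transporter[OF less.prems(1)])
    have "1 \<notin> transporter y W" using y by (simp add: transporter_def act_one)
    then have "transporter y W \<subset> S" using one_S by (auto simp: transporter_def)
    then have "dim (transporter y W) < dim S"
      using T subspace_S by (intro dim_psubset) (simp add: right_ideal_def span_eq_iff[THEN iffD2])
    then have "V.dim W < V.dim ?Z" using Z(2) by linarith
    moreover have "V.dim ?Z \<le> V.dim Y"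
      using less.prems(2) ZY V.dim_mono_in_span by (auto simp: submodule_def)
    ultimately have "excessV ?Z \<le> excessV Y"
      using Z(1) less ZY by (intro less.hyps) auto
    moreover have "excessV W \<le> excessV ?Z"
      using excessV_add_generator[OF less.prems(1), of y] excess_le[OF T] by linarith
    ultimately show ?thesis by simp
  qed simp
qed

text \<open>\<open>W + y S\<close> lies between \<open>W\<close> and \<open>Y\<close>, so its excess
  is the common value, which forces the gain in \<open>excessV_add_generator\<close> to be
  zero.\<close>

lemma exact_transporter:
  assumes "submodule W" "submodule Y" "W \<subseteq> Y" "excessV W = excessV Y" "y \<in> Y"
  shows "excess (transporter y W) = excess S"
proof -
  let ?Z = "{x + act y s |x s. x \<in> W \<and> s \<in> S}"
  have "?Z \<subseteq> Y" using assms by (auto simp: submodule_def intro!: V.subspace_add)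
  from excessV_mono[OF add_generator(1)[OF assms(1)] assms(2) this]
    excessV_add_generator[OF assms(1), of y] excess_le[OF right_ideal_transporter[OF assms(1), of y]] assms(4)
  show ?thesis by linarith
qed

end


section \<open>The dimension of a left coideal subalgebra\<close>

lemma sum_fun_apply: "(\<Sum>i\<in>I. f i) x = (\<Sum>i\<in>I. f i x)"
  for f :: "'i \<Rightarrow> 'x \<Rightarrow> 'c::comm_monoid_add"
  by (induction I rule: infinite_finite_induct) auto

context fd_hopf_algebra
begin

text \<open>A function \<open>t\<close> supported on the basis stands for \<open>(\<Sum>b\<in>Basis. b \<otimes> t b) \<in> A \<otimes> A\<close>;
  \<open>tact\<close> is the diagonal right action of \<open>A\<close>. Off the basis \<open>tact\<close> is chosen so that it is an
  action on all functions.\<close>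

definition fscale :: "'k \<Rightarrow> ('a \<Rightarrow> 'a) \<Rightarrow> 'a \<Rightarrow> 'a" where
  "fscale c t = (\<lambda>b. scale c (t b))"

definition tens :: "'a \<Rightarrow> 'a \<Rightarrow> 'a \<Rightarrow> 'a" where
  "tens x y = (\<lambda>b. scale (coord b x) y)"

definition tact :: "('a \<Rightarrow> 'a) \<Rightarrow> 'a \<Rightarrow> 'a \<Rightarrow> 'a" where
  "tact t a = (\<lambda>b. if b \<in> Basis then \<Sum>c\<in>Basis. sw (\<lambda>p q. scale (coord b (c * p)) (t c * q)) a else t b * a)"

text \<open>\<open>A \<otimes> L\<close> in this encoding; the support condition removes the
  functions that stand for no tensor.\<close>

definition tensor_right :: "'a set \<Rightarrow> ('a \<Rightarrow> 'a) set" where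
  "tensor_right L = {t. \<forall>b. t b \<in> L \<and> (b \<notin> Basis \<longrightarrow> t b = 0)}"

sublocale F: vector_space fscale
  by unfold_locales (auto simp: fscale_def fun_eq_iff scale_left_distrib scale_right_distrib)

lemma coord_notin: "b \<notin> Basis \<Longrightarrow> coord b x = 0"
  using representation_ne_zero by blast

lemma bal2_tens: "bal2 tens"
  by (auto simp: balanced_def tens_def fun_eq_iff scale_left_distrib scale_right_distrib mult.commute)

lemma sw_fun_apply: "sw f a e = sw (\<lambda>x y. f x y e) a"
  by (simp add: sw_def sum_fun_apply)

lemma sum_sw: "(\<Sum>i\<in>I. sw (\<lambda>x y. G i x y) a) = sw (\<lambda>x y. \<Sum>i\<in>I. G i x y) a"
  unfolding sw_def by (rule sum.swap)

lemma tact_tens: "tact (tens x y) a = sw (\<lambda>p q. tens (x * p) (y * q)) a"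
proof
  fix b
  have bal: "bal2 (\<lambda>u v. scale (coord b (u * p)) (v * q))" for p q
    by (auto simp: bal_simps)
  show "tact (tens x y) a b = sw (\<lambda>p q. tens (x * p) (y * q)) a b"
    using bal2_eval[OF bal, where x = x and y = y]
    by (simp add: tact_def sum_sw tens_def sw_fun_apply coord_notin) (simp add: sw_def)
qed

lemma tact_add_left: "tact (t + t') a = tact t a + tact t' a"
  by (auto simp: tact_def fun_eq_iff sw_def algebra_simps scale_right_distrib sum.distrib)

lemma tact_scale_left: "tact (fscale c t) a = fscale c (tact t a)"
  by (auto simp: tact_def fscale_def fun_eq_iff sw_def scale_mult scale_sum_right mult.commute)

lemma tact_add_right: "tact t (a + a') = tact t a + tact t a'"
  by (auto simp: tact_def fun_eq_iff sw_def algebra_simps scale_right_distrib sum.distrib)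

lemma tact_scale_right: "tact t (scale c a) = fscale c (tact t a)"
  by (auto simp: tact_def fscale_def fun_eq_iff sw_def scale_mult scale_sum_right mult.commute)

lemma tact_one: "tact t 1 = t"
proof
  fix b
  have "sw (\<lambda>p q. scale (coord b (c * p)) (t c * q)) 1 = scale (coord b (c * 1)) (t c * 1)" for c
    by (rule sw_one) (auto simp: bal_simps)
  then show "tact t 1 b = t b"
    using finite_Basis by (simp add: tact_def coord_Basis if_distrib[of "\<lambda>z. scale z _"] cong: if_cong)
qed

lemma tact_mult: "tact t (a * a') = tact (tact t a) a'"
proof
  fix b
  show "tact t (a * a') b = tact (tact t a) a' b"
  proof (cases "b \<in> Basis")
    case True
    have bal: "bal2 (\<lambda>u v. scale (coord b (u * p)) (v * q))" for p q
      by (auto simp: bal_simps)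
    have 1: "sw (\<lambda>p q. scale (coord b (e * p)) (t e * q)) (a * a') =
        sw (\<lambda>p' q'. sw (\<lambda>p q. scale (coord b (e * (p' * p))) (t e * (q' * q))) a') a" for e
      by (rule sw_mult) (auto simp: bal_simps)
    have "tact (tact t a) a' b =
        (\<Sum>c\<in>Basis. sw (\<lambda>p q. scale (coord b (c * p)) ((\<Sum>e\<in>Basis. sw (\<lambda>p' q'. scale (coord c (e * p')) (t e * q')) a) * q)) a')"
      using True by (simp add: tact_def)
    also have "\<dots> = (\<Sum>c\<in>Basis. sw (\<lambda>p q. \<Sum>e\<in>Basis. sw (\<lambda>p' q'. scale (coord b (c * p)) (scale (coord c (e * p')) (t e * q') * q)) a) a')"
      by (simp add: sw_def sum_distrib_right scale_sum_right)
    also have "\<dots> = sw (\<lambda>p q. \<Sum>c\<in>Basis. \<Sum>e\<in>Basis. sw (\<lambda>p' q'. scale (coord b (c * p)) (scale (coord c (e * p')) (t e * q') * q)) a) a'"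
      by (rule sum_sw)
    also have "\<dots> = sw (\<lambda>p q. \<Sum>e\<in>Basis. sw (\<lambda>p' q'. \<Sum>c\<in>Basis. scale (coord b (c * p)) (scale (coord c (e * p')) (t e * q') * q)) a) a'"
      by (subst sum.swap) (simp only: sum_sw)
    also have "\<dots> = sw (\<lambda>p q. \<Sum>e\<in>Basis. sw (\<lambda>p' q'. scale (coord b (e * p' * p)) (t e * q' * q)) a) a'"
      by (simp only: bal2_eval[OF bal])
    also have "\<dots> = (\<Sum>e\<in>Basis. sw (\<lambda>p' q'. sw (\<lambda>p q. scale (coord b (e * p' * p)) (t e * q' * q)) a') a)"
      by (simp only: sum_sw[symmetric] sw_swap[of _ a a'])
    finally show ?thesis using True by (simp add: tact_def 1 mult.assoc)
  qed (simp add: tact_def mult.assoc)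
qed

lemma subspace_tensor_right: "subspace L \<Longrightarrow> F.subspace (tensor_right L)"
  by (auto simp: tensor_right_def F.subspace_def subspace_def fscale_def)

text \<open>Induction on the support \<open>C\<close>: each new basis element adds an independent
  copy of \<open>L\<close>, counted by \<open>dim_image_mod\<close> with zero kernel.\<close>

lemma dim_tensor_right:
  assumes L: "subspace L"
  shows "F.dim (tensor_right L) = card Basis * dim L" "\<exists>G. finite G \<and> tensor_right L \<subseteq> F.span G"
proof -
  interpret P: vector_space_pair scale fscale by unfold_locales
  define T where "T = (\<lambda>C. {t :: 'a \<Rightarrow> 'a. \<forall>b. t b \<in> L \<and> (b \<notin> C \<longrightarrow> t b = 0)})"
  have "F.dim (T C) = card C * dim L \<and> (\<exists>G. finite G \<and> T C \<subseteq> F.span G)" if "finite C" for C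
    using that
  proof (induction C rule: finite_induct)
    case empty
    have "T {} = {0}" using subspace_0[OF L] by (auto simp: T_def fun_eq_iff)
    moreover have "F.dim {0} = 0" by (rule F.dim_unique[of "{}"]) (auto simp: F.independent_empty)
    ultimately show ?case by (metis F.span_empty card.empty finite.emptyI mult_0 subset_refl)
  next
    case (insert b C)
    define f where "f = (\<lambda>x (e::'a). if e = b then x else (0::'a))"
    have f: "Vector_Spaces.linear scale fscale f"
      by (auto simp: Vector_Spaces.linear_iff vector_space_axioms F.vector_space_axioms f_def fscale_def fun_eq_iff)
    interpret f: Vector_Spaces.linear scale fscale f by (rule f)
    obtain G where G: "finite G" "T C \<subseteq> F.span G" using insert by blast
    have sT: "F.subspace (T C)" using L by (auto simp: T_def F.subspace_def subspace_def fscale_def)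
    have T_insert: "T (insert b C) = {x + f u |x u. x \<in> T C \<and> u \<in> L}"
    proof (intro equalityI subsetI)
      fix t assume t: "t \<in> T (insert b C)"
      have "t = t(b := 0) + f (t b)" by (auto simp: f_def fun_eq_iff)
      moreover have "t(b := 0) \<in> T C" using t subspace_0[OF L] by (auto simp: T_def)
      moreover have "t b \<in> L" using t by (auto simp: T_def)
      ultimately show "t \<in> {x + f u |x u. x \<in> T C \<and> u \<in> L}" by blast
    next
      fix t assume "t \<in> {x + f u |x u. x \<in> T C \<and> u \<in> L}"
      then show "t \<in> T (insert b C)" using subspace_add[OF L] by (auto simp: T_def f_def)
    qed
    have "{u \<in> L. f u \<in> T C} = {0}"
      using insert.hyps subspace_0[OF L] by (auto simp: T_def f_def)
    moreover have "F.dim (T (insert b C)) + dim {u \<in> L. f u \<in> T C} = F.dim (T C) + dim L"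
      unfolding T_insert by (rule P.dim_image_mod[OF f L finite_Basis _ sT G]) (simp add: span_Basis)
    ultimately have "F.dim (T (insert b C)) = card (insert b C) * dim L"
      using insert by simp
    moreover have "T (insert b C) \<subseteq> F.span (G \<union> f ` Basis)"
      unfolding T_insert F.span_Un f.span_image span_Basis using G(2) by blast
    moreover have "finite (G \<union> f ` Basis)" using G(1) finite_Basis by simp
    ultimately show ?case by blast
  qed
  from this[OF finite_Basis] show "F.dim (tensor_right L) = card Basis * dim L" "\<exists>G. finite G \<and> tensor_right L \<subseteq> F.span G"
    by (auto simp: T_def tensor_right_def)
qed

end

locale coideal_subalgebra = fd_hopf_algebra scale \<Delta> \<epsilon> \<sigma> Basis
  for scale :: "'k::field \<Rightarrow> 'a::ring_1 \<Rightarrow> 'a" and \<Delta> \<epsilon> \<sigma> Basis +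
  fixes S :: "'a set"
  assumes subalgebra: "subalgebra scale S" and D_S: "x \<in> S \<Longrightarrow> D b x \<in> S"
begin

sublocale fd_subalgebra scale Basis S
  using subalgebra by unfold_locales

text \<open>If \<open>\<epsilon>\<close> vanished on \<open>L\<close>, then
  \<open>x = x_1 \<epsilon>(x_2)\<close> would be zero for all \<open>x\<close> in \<open>L\<close>.
  If \<open>\<epsilon> x\<close> is nonzero, stability puts
  \<open>x_2 \<tau>(x_1) = \<epsilon>(x) 1\<close> into \<open>L A\<close>.\<close>

lemma costable_ideal_ext:
  assumes L: "right_ideal L" and D: "\<And>x b. x \<in> L \<Longrightarrow> b \<in> Basis \<Longrightarrow> D b x \<in> L" and "L \<noteq> {0}"
  shows "ext L = UNIV"
proof -
  have "\<exists>x\<in>L. \<epsilon> x \<noteq> 0"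
  proof (rule ccontr)
    assume *: "\<not> (\<exists>x\<in>L. \<epsilon> x \<noteq> 0)"
    have "x = 0" if "x \<in> L" for x
    proof -
      have "x = sw (\<lambda>p q. scale (\<epsilon> q) p) x" using sw_counit_right[of "\<lambda>z. z" x] by (simp add: additive_map_def)
      also have "\<dots> = 0" unfolding sw_def using * D[OF that] by (intro sum.neutral) auto
      finally show ?thesis .
    qed
    moreover have "0 \<in> L" using L by (auto simp: right_ideal_def subspace_0)
    ultimately show False using assms(3) by auto
  qed
  then obtain x where x: "x \<in> L" "\<epsilon> x \<noteq> 0" by blast
  have "sw (\<lambda>p q. q * \<tau> p) x \<in> ext L"
    unfolding sw_def using D[OF x(1)] ext_superset[of L]
    by (intro subspace_sum[OF subspace_ext] ext_mult) auto
  then have "scale (\<epsilon> x) 1 \<in> ext L" using sw_skew_right[of "\<lambda>z. z" x] by (simp add: additive_map_def)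
  from subspace_scale[OF subspace_ext this, of "inverse (\<epsilon> x)"] x(2) show ?thesis
    by (intro ext_eq_UNIV) simp
qed

text \<open>The augmentation ideal \<open>S^+\<close>.\<close>

definition aug :: "'a set" where
  "aug = {x \<in> S. \<epsilon> x = 0}"

lemma eps_diff: "\<epsilon> (x - y) = \<epsilon> x - \<epsilon> y" and eps_zero: "\<epsilon> 0 = 0"
  using additive_map_simps[OF additive_eps] by auto

lemma minus_eps_in_aug: "x \<in> S \<Longrightarrow> x - scale (\<epsilon> x) 1 \<in> aug"
  by (simp add: aug_def eps_diff subspace_diff subspace_S subspace_scale one_S)

lemma right_ideal_aug: "right_ideal aug"
proof -
  have "subspace aug"
    using subspace_S by (auto simp: aug_def subspace_def eps_zero)
  then show ?thesis by (auto simp: right_ideal_def aug_def mult_S)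
qed

lemma dim_aug: "dim S = Suc (dim aug)"
proof -
  have s: "span aug = aug" using right_ideal_aug by (simp add: right_ideal_def)
  have "1 \<notin> aug" by (simp add: aug_def)
  then have "dim (insert 1 aug) = Suc (dim aug)" by (simp add: dim_insert s)
  moreover have "span (insert 1 aug) = S"
  proof
    show "span (insert 1 aug) \<subseteq> S"
      by (rule span_minimal) (auto simp: aug_def one_S subspace_S)
    show "S \<subseteq> span (insert 1 aug)"
    proof
      fix x assume "x \<in> S"
      have "x = (x - scale (\<epsilon> x) 1) + scale (\<epsilon> x) 1" by simp
      also have "\<dots> \<in> span (insert 1 aug)"
        using minus_eps_in_aug[OF \<open>x \<in> S\<close>] by (intro span_add span_scale) (auto intro: span_base)
      finally show "x \<in> span (insert 1 aug)" .
    qed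
  qed
  ultimately show ?thesis by (metis dim_span)
qed

end

locale coideal_rank = coideal_subalgebra scale \<Delta> \<epsilon> \<sigma> Basis S + bounded_rank scale Basis S \<rho>
  for scale :: "'k::field \<Rightarrow> 'a::ring_1 \<Rightarrow> 'a" and \<Delta> \<epsilon> \<sigma> Basis S \<rho>
begin

text \<open>\<open>A \<otimes> A\<close> with the diagonal action serves to handle
  \<open>\<Delta>\<close>; the regular module \<open>R\<close> gives monotonicity of the excess on
  right ideals of \<open>S\<close>.\<close>

sublocale T: bounded_rank_module scale Basis S \<rho> fscale tact
  by unfold_locales
     (auto simp: tact_add_left tact_add_right tact_scale_left tact_scale_right tact_one tact_mult)

sublocale R: bounded_rank_module scale Basis S \<rho> scale "(*)"
  by unfold_locales (auto simp: algebra_simps scale_mult)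

text \<open>As \<open>\<Delta> s\<close> lies in \<open>A \<otimes> S\<close>, its second legs keep
  \<open>L\<close> stable.\<close>

lemma submodule_tensor_right:
  assumes L: "right_ideal L"
  shows "T.submodule (tensor_right L)"
  unfolding T.submodule_def
proof (intro conjI ballI)
  have sL: "subspace L" using L by (simp add: right_ideal_def)
  show "F.subspace (tensor_right L)" by (rule subspace_tensor_right[OF sL])
  show "\<exists>G. finite G \<and> tensor_right L \<subseteq> F.span G" by (rule dim_tensor_right[OF sL])
  fix t s assume t: "t \<in> tensor_right L" and s: "s \<in> S"
  have "sw (\<lambda>p q. scale (coord b (c * p)) (t c * q)) s \<in> L" for b c
    unfolding sw_def
    using t L D_S[OF s] by (intro subspace_sum[OF sL] subspace_scale[OF sL]) (auto simp: tensor_right_def right_ideal_def)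
  then show "tact t s \<in> tensor_right L"
    using t subspace_0[OF sL] by (auto simp: tensor_right_def tact_def intro!: subspace_sum[OF sL])
qed

text \<open>The harder inclusion untwists the diagonal action:
  \<open>x \<otimes> l a = (x \<sigma>(a_1) \<otimes> l) a_2\<close>.\<close>

lemma extV_tensor_right: "T.extV (tensor_right L) = tensor_right (ext L)" if sL: "subspace L"
proof
  show "T.extV (tensor_right L) \<subseteq> tensor_right (ext L)"
    unfolding T.extV_def
  proof (rule F.span_minimal[OF _ subspace_tensor_right[OF subspace_ext]], safe)
    fix t a assume t: "t \<in> tensor_right L"
    have "sw (\<lambda>p q. scale (coord b (c * p)) (t c * q)) a \<in> ext L" for b c
      unfolding sw_def using t ext_superset
      by (intro subspace_sum[OF subspace_ext] subspace_scale[OF subspace_ext] ext_mult) (auto simp: tensor_right_def)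
    then show "tact t a \<in> tensor_right (ext L)"
      using t subspace_0[OF subspace_ext] by (auto simp: tensor_right_def tact_def intro!: subspace_sum[OF subspace_ext])
  qed
  have E: "F.subspace (T.extV (tensor_right L))" by (simp add: T.extV_def)
  have "tens x (l * a) \<in> T.extV (tensor_right L)" if l: "l \<in> L" for x l a
  proof -
    have "tens x (l * a) = tens (x * 1) (l * a)" by simp
    also have "\<dots> = sw (\<lambda>a1 a'. sw (\<lambda>p q. tens (x * (\<sigma> a1 * p)) (l * q)) a') a"
      by (rule sw_S_id'(2)[symmetric, where H = "\<lambda>u v. tens (x * u) (l * v)"])
         (auto simp: balanced_def algebra_simps scale_mult bal2D[OF bal2_tens])
    also have "\<dots> = sw (\<lambda>a1 a2. tact (tens (x * \<sigma> a1) l) a2) a"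
      by (simp add: tact_tens mult.assoc)
    also have "\<dots> \<in> T.extV (tensor_right L)"
      unfolding sw_def
    proof (rule F.subspace_sum[OF E])
      fix b
      have "tens (x * \<sigma> b) l \<in> tensor_right L"
        using subspace_scale[OF sL l] by (auto simp: tensor_right_def tens_def coord_notin)
      then show "tact (tens (x * \<sigma> b) l) (D b a) \<in> T.extV (tensor_right L)"
        unfolding T.extV_def by (intro F.span_base) blast
    qed
    finally show ?thesis .
  qed
  then have gen: "tens x y \<in> T.extV (tensor_right L)" if "y \<in> ext L" for x y
  proof -
    interpret l: Vector_Spaces.linear scale fscale "tens x"
      using bal2D[OF bal2_tens]
      by (auto simp: Vector_Spaces.linear_iff vector_space_axioms F.vector_space_axioms tens_def fscale_def mult.commute)
    have "ext L \<subseteq> tens x -` T.extV (tensor_right L)"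
      using \<open>\<And>x l a. l \<in> L \<Longrightarrow> tens x (l * a) \<in> T.extV (tensor_right L)\<close>
      by (intro ext_subset l.subspace_vimage[OF E]) auto
    then show ?thesis using that by auto
  qed
  show "tensor_right (ext L) \<subseteq> T.extV (tensor_right L)"
  proof
    fix t assume t: "t \<in> tensor_right (ext L)"
    have "t = (\<Sum>b\<in>Basis. tens b (t b))"
      using t finite_Basis
      by (auto simp: fun_eq_iff sum_fun_apply tens_def coord_Basis tensor_right_def if_distrib[of "\<lambda>z. scale z _"] coord_notin cong: if_cong)
    also have "\<dots> \<in> T.extV (tensor_right L)"
      using t by (intro F.subspace_sum[OF E] gen) (auto simp: tensor_right_def)
    finally show "t \<in> T.extV (tensor_right L)" .
  qed
qed

lemma excessV_tensor_right: "subspace L \<Longrightarrow> T.excessV (tensor_right L) = real (card Basis) * excess L"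
  by (simp add: T.excessV_def excess_def extV_tensor_right dim_tensor_right(1) subspace_ext algebra_simps)

text \<open>\<open>M\<close> is the transporter of \<open>1 \<otimes> 1\<close> into
  \<open>A \<otimes> L\<close>. The submodules \<open>A \<otimes> L\<close> and
  \<open>A \<otimes> S\<close> have the same excess, so \<open>exact_transporter\<close>
  applies.\<close>

lemma exact_comult:
  assumes L: "right_ideal L" "excess L = excess S"
  defines "M \<equiv> {s \<in> S. \<forall>b\<in>Basis. D b s \<in> L}"
  shows "right_ideal M" "excess M = excess S"
proof -
  have sL: "subspace L" and LS: "L \<subseteq> S" using L(1) by (auto simp: right_ideal_def)
  have D0: "sw tens s b = (if b \<in> Basis then D b s else 0)" for s b
    using finite_Basis unfolding sw_fun_apply
    by (auto simp: sw_def tens_def coord_Basis coord_notin if_distrib[of "\<lambda>z. scale z _"] cong: if_cong)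
  have M: "M = T.transporter (tens 1 1) (tensor_right L)"
    using subspace_0[OF sL]
    by (auto simp: M_def T.transporter_def tact_tens tensor_right_def D0)
  show "right_ideal M" unfolding M by (rule T.right_ideal_transporter[OF submodule_tensor_right[OF L(1)]])
  show "excess M = excess S"
    unfolding M
  proof (rule T.exact_transporter[OF submodule_tensor_right[OF L(1)] submodule_tensor_right[OF right_ideal_S]])
    show "tensor_right L \<subseteq> tensor_right S" using LS by (auto simp: tensor_right_def)
    show "T.excessV (tensor_right L) = T.excessV (tensor_right S)"
      by (simp add: excessV_tensor_right sL subspace_S L(2))
    show "tens 1 1 \<in> tensor_right S"
      using subspace_scale[OF subspace_S one_S] by (auto simp: tensor_right_def tens_def coord_notin)
  qed
qed

end

context coideal_subalgebra
begin

theorem dim_quotient: "real (dim S) * (real (dim (UNIV :: 'a set)) - real (dim (ext aug))) = real (dim (UNIV :: 'a set))"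
proof -
  let ?d = "dim (UNIV :: 'a set)"
  define ratio where "ratio = (\<lambda>L. (real ?d - real (dim (ext L))) / (real (dim S) - real (dim L)))"
  let ?R = "{L. right_ideal L \<and> L \<noteq> S}"
  have lt: "dim L < dim S" if "L \<in> ?R" for L
    using that subspace_S by (intro dim_psubset) (auto simp: right_ideal_def span_eq_iff[THEN iffD2])
  \<comment> \<open>A ratio depends only on two dimensions bounded by that of \<open>A\<close>, so
    the maximum exists even if there are infinitely many ideals.\<close>
  have "ratio ` ?R \<subseteq> (\<lambda>(m, n). (real ?d - real m) / (real (dim S) - real n)) ` ({..?d} \<times> {..?d})"
  proof (rule image_subsetI)
    fix L
    have "ratio L = (\<lambda>(m, n). (real ?d - real m) / (real (dim S) - real n)) (dim (ext L), dim L)"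
      by (simp add: ratio_def)
    then show "ratio L \<in> (\<lambda>(m, n). (real ?d - real m) / (real (dim S) - real n)) ` ({..?d} \<times> {..?d})"
      by (rule image_eqI) (use dim_subset[OF subset_UNIV] in simp)
  qed
  then have fin: "finite (ratio ` ?R)" by (rule finite_subset) simp
  have "{0} \<noteq> S" using one_S by auto
  then have zero: "{0} \<in> ?R" using right_ideal_zero by auto
  define \<rho> where "\<rho> = Max (ratio ` ?R)"
  have le: "ratio L \<le> \<rho>" if "L \<in> ?R" for L
    unfolding \<rho>_def using fin that by (intro Max_ge) auto
  have "\<rho> \<in> ratio ` ?R" unfolding \<rho>_def using fin zero by (intro Max_in) auto
  then obtain L0 where L0: "L0 \<in> ?R" "\<rho> = ratio L0" by auto
  interpret coideal_rank scale \<Delta> \<epsilon> \<sigma> Basis S \<rho>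
  proof
    fix L assume L: "right_ideal L"
    show "real ?d - real (dim (ext L)) \<le> \<rho> * (real (dim S) - real (dim L))"
    proof (cases "L = S")
      case True
      then show ?thesis by (simp add: ext_S)
    next
      case False
      with L have L: "L \<in> ?R" by simp
      from le[OF L] lt[OF L] show ?thesis by (simp add: ratio_def pos_divide_le_eq)
    qed
  qed
  have exact0: "excess L0 = excess S"
  proof -
    have "\<rho> * (real (dim S) - real (dim L0)) = real ?d - real (dim (ext L0))"
      using lt[OF L0(1)] by (simp add: L0(2) ratio_def)
    then show ?thesis unfolding excess_def ext_S right_diff_distrib by linarith
  qed
  \<comment> \<open>A proper right ideal of least dimension attaining the maximum. Intersecting it
    with the ideal from \<open>exact_comult\<close> cannot shrink it, which makes it stable under
    all \<open>D b\<close>.\<close>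
  define L where "L = arg_min dim (\<lambda>L. L \<in> ?R \<and> excess L = excess S)"
  have L: "right_ideal L" "L \<noteq> S" "excess L = excess S"
    using arg_min_natI[of "\<lambda>L. L \<in> ?R \<and> excess L = excess S" L0 dim] L0(1) exact0 by (auto simp: L_def)
  have min: "dim L \<le> dim M" if "M \<in> ?R" "excess M = excess S" for M
    unfolding L_def by (rule arg_min_nat_le) (use that in auto)
  have d_pos: "?d > 0" using lt[OF zero] dim_subset[OF subset_UNIV, of S] by linarith
  have "\<rho> > 0"
  proof -
    have "ratio {0} > 0" using d_pos lt[OF zero] by (simp add: ratio_def ext_zero)
    with le[OF zero] show ?thesis by linarith
  qed
  have costable: "D b x \<in> L" if "x \<in> L" "b \<in> Basis" for x b
  proof -
    let ?M = "{s \<in> S. \<forall>b\<in>Basis. D b s \<in> L}"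
    note M = exact_comult[OF L(1,3)]
    note LM = exact_Int[OF L(1,3) M]
    have "L \<inter> ?M \<noteq> S" using L(1,2) by (auto simp: right_ideal_def)
    then have "dim L \<le> dim (L \<inter> ?M)" using LM by (intro min) auto
    then have "L \<inter> ?M = L"
      using LM(1) L(1) by (intro subspace_dim_equal) (auto simp: right_ideal_def)
    then show ?thesis using that by auto
  qed
  have "L = {0}"
  proof (rule ccontr)
    assume "L \<noteq> {0}"
    \<comment> \<open>With \<open>L A = A\<close> and equal excess, positivity of
      \<open>\<rho>\<close> forces \<open>dim L = dim S\<close>, contrary to properness.\<close>
    then have "ext L = UNIV" by (intro costable_ideal_ext L(1) costable)
    then have "dim L = dim S" using L(3) \<open>\<rho> > 0\<close> by (simp add: excess_def ext_S)
    with lt[of L] L show False by simp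
  qed
  then have S0: "excess S = 0" using L(3) by (simp add: excess_def ext_zero)
  have sub: "R.submodule M" if "right_ideal M" for M
    using that span_Basis finite_Basis by (auto simp: R.submodule_def right_ideal_def)
  have ex: "R.excessV M = excess M" for M
    by (simp add: R.excessV_def R.extV_def excess_def ext_def)
  \<comment> \<open>The excess grows from \<open>0\<close> at \<open>{0}\<close> and is bounded by
    \<open>excess S = 0\<close>, so \<open>aug\<close> attains the maximum as well.\<close>
  have "0 \<le> excess aug"
    using R.excessV_mono[OF sub[OF right_ideal_zero] sub[OF right_ideal_aug]] right_ideal_aug
    by (simp add: ex) (simp add: excess_def ext_zero right_ideal_def subspace_0)
  then have "real (dim (ext aug)) = \<rho> * real (dim aug)"
    using excess_le[OF right_ideal_aug] S0 by (simp add: excess_def)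
  moreover have "\<rho> * real (dim S) = real ?d" using S0 by (simp add: excess_def ext_S)
  moreover have "real (dim S) = real (dim aug) + 1" using dim_aug by simp
  ultimately have "real ?d - real (dim (ext aug)) = \<rho>" by (simp add: algebra_simps)
  with \<open>\<rho> * real (dim S) = real ?d\<close> show ?thesis by (simp add: mult.commute)
qed

end


section \<open>Coinvariants and left normality\<close>

context coideal_subalgebra
begin

text \<open>The condition \<open>A S^+ \<subseteq> S^+ A\<close>, which makes \<open>S^+ A\<close> a
  two-sided ideal.\<close>

definition aug_left_stable :: bool where
  "aug_left_stable \<longleftrightarrow> (\<forall>a. \<forall>x\<in>aug. a * x \<in> ext aug)"

lemma ext_aug_left: "aug_left_stable \<Longrightarrow> y \<in> ext aug \<Longrightarrow> a * y \<in> ext aug"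
proof -
  assume st: "aug_left_stable" and y: "y \<in> ext aug"
  have "subspace {y. a * y \<in> ext aug}"
    using subspace_ext[of aug] by (auto simp: subspace_def algebra_simps scale_mult)
  then have "ext aug \<subseteq> {y. a * y \<in> ext aug}"
  proof (rule ext_subset)
    fix x b assume "x \<in> aug"
    then have "a * x \<in> ext aug" using st by (auto simp: aug_left_stable_def)
    from ext_mult[OF this, of b] show "x * b \<in> {y. a * y \<in> ext aug}" by (simp add: mult.assoc)
  qed
  with y show ?thesis by auto
qed

lemma eps_ext_aug: "x \<in> ext aug \<Longrightarrow> \<epsilon> x = 0"
proof -
  have "ext aug \<subseteq> {x. \<epsilon> x = 0}"
    by (rule ext_subset) (auto simp: subspace_def eps_zero aug_def)
  then show "x \<in> ext aug \<Longrightarrow> \<epsilon> x = 0" by auto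
qed

lemma sw_counit_right': "sw (\<lambda>p q. scale (\<epsilon> q) p) x = x"
  using sw_counit_right[of "\<lambda>z. z" x] by (simp add: additive_map_def)

lemma sw_counit_left': "sw (\<lambda>p q. scale (\<epsilon> p) q) x = x"
  using sw_counit_left[of "\<lambda>z. z" x] by (simp add: additive_map_def)

lemma coord_eq_eps_D: "b \<in> Basis \<Longrightarrow> coord b x = \<epsilon> (D b x)"
proof -
  assume b: "b \<in> Basis"
  have "coord b x = coord b (sw (\<lambda>p q. scale (\<epsilon> q) p) x)" by (simp add: sw_counit_right')
  also have "\<dots> = \<epsilon> (D b x)"
    using b finite_Basis by (simp add: sw_def coord_Basis if_distrib[of "(*) _"] cong: if_cong)
  finally show ?thesis .
qed

text \<open>The condition \<open>x_1 \<otimes> x_2 = x \<otimes> 1\<close> in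
  \<open>A \<otimes> A / S^+ A\<close>, tested on each coefficient of the first leg.\<close>

definition coinvariants :: "'a set" where
  "coinvariants = {x. \<forall>b\<in>Basis. D b x - scale (coord b x) 1 \<in> ext aug}"

text \<open>For products, the two factors of \<open>D b x * D b' y\<close> are replaced by scalars
  one after the other, which uses that \<open>S^+ A\<close> is also a left ideal. Stability under
  \<open>D\<close> is coassociativity.\<close>

lemma coideal_coinvariants:
  assumes st: "aug_left_stable"
  shows "coideal_subalgebra scale \<Delta> \<epsilon> \<sigma> Basis coinvariants"
proof
  note K = subspace_ext[of aug]
  have sub: "subspace coinvariants"
    unfolding subspace_def coinvariants_def
  proof (intro conjI allI ballI CollectI)
    show "D b 0 - scale (coord b 0) 1 \<in> ext aug" for b
      by (simp add: representation_zero subspace_0[OF K])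
  next
    fix x y b
    assume "x \<in> {x. \<forall>b\<in>Basis. D b x - scale (coord b x) 1 \<in> ext aug}"
      "y \<in> {x. \<forall>b\<in>Basis. D b x - scale (coord b x) 1 \<in> ext aug}" "b \<in> Basis"
    then have "(D b x - scale (coord b x) 1) + (D b y - scale (coord b y) 1) \<in> ext aug"
      by (intro subspace_add[OF K]) auto
    then show "D b (x + y) - scale (coord b (x + y)) 1 \<in> ext aug"
      by (simp add: scale_left_distrib algebra_simps)
  next
    fix c x b
    assume "x \<in> {x. \<forall>b\<in>Basis. D b x - scale (coord b x) 1 \<in> ext aug}" "b \<in> Basis"
    then have "scale c (D b x - scale (coord b x) 1) \<in> ext aug"
      by (intro subspace_scale[OF K]) auto
    then show "D b (scale c x) - scale (coord b (scale c x)) 1 \<in> ext aug"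
      by (simp add: scale_right_diff_distrib)
  qed
  have mult: "x * y \<in> coinvariants" if x: "x \<in> coinvariants" and y: "y \<in> coinvariants" for x y
    unfolding coinvariants_def
  proof (intro CollectI ballI)
    fix c assume "c \<in> Basis"
    have "scale (coord c (x * y)) 1 = scale (coord c ((\<Sum>b\<in>Basis. scale (coord b x) b) * (\<Sum>b\<in>Basis. scale (coord b y) b))) 1"
      by (simp only: sum_coord)
    also have "\<dots> = (\<Sum>b\<in>Basis. \<Sum>b'\<in>Basis. scale (coord c (b * b')) (scale (coord b x * coord b' y) 1))"
      by (simp add: sum_product scale_mult scale_sum_left mult_ac)
    finally have "D c (x * y) - scale (coord c (x * y)) 1 =
       (\<Sum>b\<in>Basis. \<Sum>b'\<in>Basis. scale (coord c (b * b')) (D b x * D b' y - scale (coord b x * coord b' y) 1))"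
      by (simp add: D_mult scale_right_diff_distrib sum_subtractf)
    also have "\<dots> \<in> ext aug"
    proof (intro subspace_sum[OF K] subspace_scale[OF K])
      fix b b' assume b: "b \<in> Basis" "b' \<in> Basis"
      have "D b x * (D b' y - scale (coord b' y) 1) \<in> ext aug"
        using y b by (intro ext_aug_left[OF st]) (auto simp: coinvariants_def)
      moreover have "scale (coord b' y) (D b x - scale (coord b x) 1) \<in> ext aug"
        using x b by (intro subspace_scale[OF K]) (auto simp: coinvariants_def)
      ultimately have "D b x * (D b' y - scale (coord b' y) 1) + scale (coord b' y) (D b x - scale (coord b x) 1) \<in> ext aug"
        by (rule subspace_add[OF K])
      then show "D b x * D b' y - scale (coord b x * coord b' y) 1 \<in> ext aug"
        by (simp add: right_diff_distrib scale_right_diff_distrib scale_mult mult.commute)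
    qed
    finally show "D c (x * y) - scale (coord c (x * y)) 1 \<in> ext aug" .
  qed
  have one: "1 \<in> coinvariants" by (simp add: coinvariants_def D_one subspace_0[OF K])
  show "subalgebra scale coinvariants"
    using sub one mult by (auto simp: subalgebra_def)
  fix x e assume x: "x \<in> coinvariants"
  show "D e x \<in> coinvariants"
    unfolding coinvariants_def
  proof (intro CollectI ballI)
    fix b assume "b \<in> Basis"
    have "coord b (D e x) = coord b (D e (\<Sum>g\<in>Basis. scale (coord g x) g))" by (simp only: sum_coord)
    then have "scale (coord b (D e x)) 1 = (\<Sum>g\<in>Basis. scale (coord b (D e g)) (scale (coord g x) 1))"
      by (simp add: scale_sum_left mult.commute)
    then have "D b (D e x) - scale (coord b (D e x)) 1 = (\<Sum>g\<in>Basis. scale (coord b (D e g)) (D g x - scale (coord g x) 1))"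
      by (simp add: D_D scale_right_diff_distrib sum_subtractf)
    also have "\<dots> \<in> ext aug"
      using x by (intro subspace_sum[OF K] subspace_scale[OF K]) (auto simp: coinvariants_def)
    finally show "D b (D e x) - scale (coord b (D e x)) 1 \<in> ext aug" .
  qed
qed

text \<open>For \<open>x\<close> in \<open>S\<close> the element \<open>D b x\<close> of
  \<open>S\<close> has counit \<open>coord b x\<close>.\<close>

lemma subset_coinvariants: "S \<subseteq> coinvariants"
  using minus_eps_in_aug D_S ext_superset[of aug] by (auto simp: coinvariants_def coord_eq_eps_D)

text \<open>\<open>dim_quotient\<close> holds for both subalgebras, and their augmentation ideals
  generate the same right ideal of \<open>A\<close>, so the dimensions agree.\<close>

lemma coinvariants_eq:
  assumes "aug_left_stable"
  shows "coinvariants = S"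
proof -
  interpret C: coideal_subalgebra scale \<Delta> \<epsilon> \<sigma> Basis coinvariants
    by (rule coideal_coinvariants[OF assms])
  note K = subspace_ext[of aug]
  have "C.aug \<subseteq> ext aug"
  proof
    fix x assume x: "x \<in> C.aug"
    \<comment> \<open>Applying \<open>\<epsilon>\<close> to the first leg of the coinvariance
      condition gives \<open>x = \<epsilon>(x) 1 = 0\<close> modulo \<open>S^+ A\<close>.\<close>
    have "x = sw (\<lambda>p q. scale (\<epsilon> p) q) x - scale (\<epsilon> (\<Sum>b\<in>Basis. scale (coord b x) b)) 1"
      using x by (simp only: sum_coord sw_counit_left') (simp add: C.aug_def)
    also have "\<dots> = (\<Sum>b\<in>Basis. scale (\<epsilon> b) (D b x - scale (coord b x) 1))"
      by (simp add: sw_def additive_map_simps(5)[OF additive_eps] scale_sum_left sum_subtractf scale_right_diff_distrib mult.commute)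
    also have "\<dots> \<in> ext aug"
    proof (intro subspace_sum[OF K] subspace_scale[OF K])
      fix b assume "b \<in> Basis"
      moreover have "x \<in> coinvariants" using x by (simp add: C.aug_def)
      ultimately show "D b x - scale (coord b x) 1 \<in> ext aug" by (simp add: coinvariants_def)
    qed
    finally show "x \<in> ext aug" .
  qed
  then have "ext C.aug \<subseteq> ext aug"
    by (intro ext_subset[OF K] ext_mult) auto
  moreover have "ext aug \<subseteq> ext C.aug"
    using subset_coinvariants by (intro ext_mono) (auto simp: aug_def C.aug_def)
  ultimately have "ext C.aug = ext aug" by simp
  with dim_quotient C.dim_quotient
  have "real (dim S) * (real (dim (UNIV :: 'a set)) - real (dim (ext aug))) =
    real (dim coinvariants) * (real (dim (UNIV :: 'a set)) - real (dim (ext aug)))" by simp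
  moreover have "dim (UNIV :: 'a set) > 0"
    using dim_aug dim_subset[OF subset_UNIV, of S] by linarith
  then have "real (dim (UNIV :: 'a set)) - real (dim (ext aug)) \<noteq> 0"
    using dim_quotient by (metis mult_zero_right of_nat_0_less_iff less_irrefl)
  ultimately have "dim S = dim coinvariants" by simp
  then show ?thesis using subspace_dim_equal[OF subspace_S C.subspace_S subset_coinvariants] by simp
qed

text \<open>For \<open>y = a_1 x \<sigma>(a_2)\<close> one has \<open>\<Delta> y = a_1 x_1
  \<sigma>(a_4) \<otimes> a_2 x_2 \<sigma>(a_3)\<close>. Modulo \<open>A \<otimes> S^+ A\<close> the
  leg \<open>x_2\<close> may be replaced by its counit, which leaves \<open>y \<otimes> 1\<close>;
  thus \<open>y\<close> is coinvariant.\<close>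

lemma left_normal_if_aug_left_stable:
  assumes st: "aug_left_stable"
  shows "left_normal \<Delta> \<sigma> S"
  unfolding left_normal_iff
proof (intro allI ballI)
  fix a x assume x: "x \<in> S"
  note K = subspace_ext[of aug]
  let ?y = "sw (\<lambda>p q. p * x * \<sigma> q) a"
  have "?y \<in> coinvariants"
    unfolding coinvariants_def
  proof (intro CollectI ballI)
    fix b assume "b \<in> Basis"
    define f where "f = (\<lambda>u v. scale (coord b u) v)"
    have f: "bal2 f" unfolding f_def by (rule bal2_coord)
    note bs = bal_simps bal2D[OF f]
    have 1: "sw f (p * x * \<sigma> q) =
        sw (\<lambda>p1 p2. sw (\<lambda>q1 q2. sw (\<lambda>x1 x2. f (p1 * x1 * \<sigma> q2) (p2 * x2 * \<sigma> q1)) x) q) p" for p q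
    proof -
      have "sw f (p * x * \<sigma> q) = sw (\<lambda>p1 p2. sw (\<lambda>x1 x2. sw (\<lambda>u v. f (p1 * x1 * u) (p2 * x2 * v)) (\<sigma> q)) x) p"
        by (subst sw_mult[OF f], subst sw_mult) (auto simp: bs)
      also have "\<dots> = sw (\<lambda>p1 p2. sw (\<lambda>x1 x2. sw (\<lambda>q1 q2. f (p1 * x1 * \<sigma> q2) (p2 * x2 * \<sigma> q1)) q) x) p"
        by (subst sw_sigma) (auto simp: bs)
      finally show ?thesis by (simp only: sw_swap[of _ q x])
    qed
    have "additive_map (sw f)" by (simp add: additive_map_def sw_add[OF f])
    then have Dy: "D b ?y = sw (\<lambda>p q. sw f (p * x * \<sigma> q)) a"
      unfolding sw_coord[symmetric] f_def by (rule additive_map_sw)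
    have Dy': "D b ?y = sw (\<lambda>p q. sw (\<lambda>p1 p2. sw (\<lambda>q1 q2. sw (\<lambda>x1 x2. f (p1 * x1 * \<sigma> q2) (p2 * x2 * \<sigma> q1)) x) q) p) a"
      unfolding Dy 1 ..
    \<comment> \<open>With \<open>\<epsilon>(x_2) 1\<close> in place of \<open>x_2\<close>, the
      factors \<open>a_2 \<sigma>(a_3)\<close> cancel.\<close>
    have "sw (\<lambda>p q. sw (\<lambda>p1 p2. sw (\<lambda>q1 q2. sw (\<lambda>x1 x2. f (p1 * x1 * \<sigma> q2) (scale (\<epsilon> x2) (p2 * \<sigma> q1))) x) q) p) a
       = sw (\<lambda>p q. sw (\<lambda>p1 p2. sw (\<lambda>q1 q2. f (p1 * x * \<sigma> q2) (p2 * \<sigma> q1)) q) p) a"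
    proof -
      have "sw (\<lambda>x1 x2. f (p1 * x1 * \<sigma> q2) (scale (\<epsilon> x2) (p2 * \<sigma> q1))) x = f (p1 * x * \<sigma> q2) (p2 * \<sigma> q1)" for p1 p2 q1 q2
        using sw_counit_right[of "\<lambda>z. f (p1 * z * \<sigma> q2) (p2 * \<sigma> q1)" x]
        by (simp add: additive_map_def bal2D[OF f] algebra_simps scale_mult)
      then show ?thesis by simp
    qed
    also have "\<dots> = sw (\<lambda>p1 r. sw (\<lambda>p2 q. sw (\<lambda>q1 q2. f (p1 * x * \<sigma> q2) (p2 * \<sigma> q1)) q) r) a"
      by (rule sw_coassoc) (auto simp: bs)
    also have "\<dots> = sw (\<lambda>p1 r. sw (\<lambda>s q2. sw (\<lambda>p2 q1. f (p1 * x * \<sigma> q2) (p2 * \<sigma> q1)) s) r) a"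
      by (subst sw_coassoc) (auto simp: bs)
    also have "\<dots> = sw (\<lambda>p1 r. f (p1 * x * \<sigma> r) 1) a"
    proof -
      have "sw (\<lambda>s q2. sw (\<lambda>p2 q1. f (p1 * x * \<sigma> q2) (p2 * \<sigma> q1)) s) r = f (p1 * x * \<sigma> r) 1" for p1 r
        by (rule sw_S_id(1)[where H = "\<lambda>u v. f (p1 * x * \<sigma> v) u"]) (auto simp: bs)
      then show ?thesis by simp
    qed
    also have "\<dots> = scale (coord b ?y) 1"
      by (simp add: f_def sw_def scale_sum_left)
    finally have cy: "scale (coord b ?y) 1 = sw (\<lambda>p q. sw (\<lambda>p1 p2. sw (\<lambda>q1 q2. sw (\<lambda>x1 x2. f (p1 * x1 * \<sigma> q2) (scale (\<epsilon> x2) (p2 * \<sigma> q1))) x) q) p) a"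
      by (rule sym)
    \<comment> \<open>Each term of the difference contains a factor
      \<open>x_2 - \<epsilon>(x_2) 1\<close> in \<open>S^+\<close>, hence lies in the two-sided
      ideal.\<close>
    have "D b ?y - scale (coord b ?y) 1 =
       sw (\<lambda>p q. sw (\<lambda>p1 p2. sw (\<lambda>q1 q2. sw (\<lambda>x1 x2.
         scale (coord b (p1 * x1 * \<sigma> q2)) (p2 * (x2 - scale (\<epsilon> x2) 1) * \<sigma> q1)) x) q) p) a"
      unfolding Dy' cy f_def
      by (simp add: sw_def sum_subtractf algebra_simps scale_right_diff_distrib scale_mult)
    also have "\<dots> \<in> ext aug"
      unfolding sw_def
      using ext_superset[of aug] minus_eps_in_aug[OF D_S[OF x]]
      by (intro subspace_sum[OF K] subspace_scale[OF K] ext_mult ext_aug_left[OF st]) auto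
    finally show "D b ?y - scale (coord b ?y) 1 \<in> ext aug" .
  qed
  then show "?y \<in> S" by (simp add: coinvariants_eq[OF st])
qed

text \<open>Insert \<open>\<sigma>(a_2) a_3\<close> behind \<open>x\<close>.\<close>

lemma ad_conj: "a * x = (\<Sum>b\<in>Basis. sw (\<lambda>p q. p * x * \<sigma> q) b * D b a)"
proof -
  have "a * x = sw (\<lambda>r a3. sw (\<lambda>p q. p * x * (\<sigma> q * a3)) r) a"
    by (subst sw_id_S'(2)[where H = "\<lambda>u v. u * x * v"]) (auto simp: bal_simps)
  then show ?thesis by (simp add: sw_def sum_distrib_right mult.assoc)
qed

text \<open>As \<open>\<sigma>\<close> undoes \<open>\<tau>\<close>, the adjoint action of
  \<open>\<tau> b\<close> sends \<open>x\<close> to \<open>\<tau>(b_2) x b_1\<close>; afterwards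
  \<open>a_3 \<tau>(a_2)\<close> cancels.\<close>

lemma ad_conj_skew: "x * a = (\<Sum>b\<in>Basis. D b a * sw (\<lambda>p q. p * x * \<sigma> q) (\<tau> b))"
proof -
  have "sw (\<lambda>p q. p * x * \<sigma> q) (\<tau> b) = sw (\<lambda>a1 a2. \<tau> a2 * x * a1) b" for b
    by (subst sw_tau) (auto simp: bal_simps)
  then have "(\<Sum>b\<in>Basis. D b a * sw (\<lambda>p q. p * x * \<sigma> q) (\<tau> b)) = sw (\<lambda>r a3. sw (\<lambda>a1 a2. a3 * \<tau> a2 * x * a1) r) a"
    by (simp add: sw_def sum_distrib_left mult.assoc)
  also have "\<dots> = sw (\<lambda>a1 r. sw (\<lambda>a2 a3. a3 * \<tau> a2 * x * a1) r) a"
    by (rule sw_coassoc) (auto simp: bal_simps)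
  also have "\<dots> = sw (\<lambda>a1 r. scale (\<epsilon> r) 1 * x * a1) a"
    by (subst sw_skew_right[where h = "\<lambda>z. z * x * _"]) (auto simp: additive_map_def algebra_simps)
  also have "\<dots> = sw (\<lambda>a1 r. x * scale (\<epsilon> r) a1) a" by (simp add: scale_mult)
  also have "\<dots> = x * a"
    by (rule sw_counit_right) (simp add: additive_map_def algebra_simps)
  finally show ?thesis by simp
qed

text \<open>Since \<open>\<epsilon>\<close> is multiplicative, the adjoint action keeps
  \<open>S^+\<close> stable, and \<open>ad_conj\<close> applies.\<close>

lemma aug_left_stable_if_left_normal:
  assumes "left_normal \<Delta> \<sigma> S"
  shows "aug_left_stable"
  unfolding aug_left_stable_def
proof (intro allI ballI)
  fix a x assume x: "x \<in> aug"
  have "sw (\<lambda>p q. p * x * \<sigma> q) b \<in> aug" for b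
    using assms x by (auto simp: left_normal_iff aug_def additive_map_sw[OF additive_eps]) (simp add: sw_def)
  then show "a * x \<in> ext aug"
    unfolding ad_conj[of a x] using ext_superset[of aug]
    by (intro subspace_sum[OF subspace_ext] ext_mult) auto
qed

end


section \<open>Rieffel normality and depth two\<close>

lemma ring_of_type_algebra_simps:
  "carrier ring_of_type_algebra = UNIV"
  "monoid.mult ring_of_type_algebra = (*)" "monoid.one ring_of_type_algebra = 1"
  "ring.zero ring_of_type_algebra = 0" "ring.add ring_of_type_algebra = (+)"
  by (simp_all add: ring_of_type_algebra_def)

lemma ring_ring_of_type_algebra: "ring (ring_of_type_algebra :: 'a::ring_1 ring)"
proof -
  have "\<exists>y. x + y = 0" for x :: 'a
    using add.right_inverse by blast
  then show ?thesis
    unfolding ring_of_type_algebra_def using add.right_inverse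
    by unfold_locales (auto simp: algebra_simps Units_def)
qed

lemma ideal_ring_of_type_algebra_iff:
  "ideal I (ring_of_type_algebra :: 'a::ring_1 ring) \<longleftrightarrow>
     is_subgroup I \<and> (\<forall>x\<in>I. \<forall>a. a * x \<in> I \<and> x * a \<in> I)"
proof
  assume "ideal I (ring_of_type_algebra :: 'a ring)"
  then interpret ideal I "ring_of_type_algebra :: 'a ring" .
  have mult: "a * x \<in> I \<and> x * a \<in> I" if "x \<in> I" for a x
    using I_l_closed[OF that, of a] I_r_closed[OF that, of a] by (simp add: ring_of_type_algebra_simps)
  have "u - v \<in> I" if "u \<in> I" "v \<in> I" for u v
    using additive_subgroup.a_closed[OF additive_subgroup_axioms that(1), of "- 1 * v"] mult[OF that(2), of "- 1"]
    by (simp add: ring_of_type_algebra_simps)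
  moreover have "0 \<in> I" using additive_subgroup.zero_closed[OF additive_subgroup_axioms] by (simp add: ring_of_type_algebra_simps)
  ultimately show "is_subgroup I \<and> (\<forall>x\<in>I. \<forall>a. a * x \<in> I \<and> x * a \<in> I)"
    using mult by (auto simp: is_subgroup_def)
next
  assume I: "is_subgroup I \<and> (\<forall>x\<in>I. \<forall>a. a * x \<in> I \<and> x * a \<in> I)"
  interpret R: ring "ring_of_type_algebra :: 'a ring" by (rule ring_ring_of_type_algebra)
  have minus: "a_inv ring_of_type_algebra x = - x" for x :: 'a
    by (rule R.minus_equality) (auto simp: ring_of_type_algebra_simps)
  show "ideal I (ring_of_type_algebra :: 'a ring)"
  proof (rule idealI[OF R.ring_axioms])
    show "subgroup I (add_monoid (ring_of_type_algebra :: 'a ring))"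
    proof (rule R.add.subgroupI)
      show "I \<subseteq> carrier ring_of_type_algebra" by (simp add: ring_of_type_algebra_simps)
      show "I \<noteq> {}" using I by (auto simp: is_subgroup_def)
      show "a_inv ring_of_type_algebra x \<in> I" if "x \<in> I" for x using that I by (simp add: minus is_subgroupD)
      show "x \<oplus>\<^bsub>ring_of_type_algebra\<^esub> y \<in> I" if "x \<in> I" "y \<in> I" for x y
        using that I by (simp add: ring_of_type_algebra_simps is_subgroupD)
    qed
  qed (use I in \<open>auto simp: ring_of_type_algebra_simps\<close>)
qed

context coideal_subalgebra
begin

text \<open>\<open>S \<inter> I\<close> is stable under the adjoint action, so
  \<open>ad_conj\<close> and \<open>ad_conj_skew\<close> give the two inclusions.\<close>

lemma rieffel_normal_if_left_normal:
  assumes "left_normal \<Delta> \<sigma> S"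
  shows "rieffel_normal S"
  unfolding rieffel_normal_def invariant_ideal_def
proof (intro allI impI)
  fix I :: "'a set"
  assume "maximalideal I ring_of_type_algebra"
  then have "ideal I ring_of_type_algebra" by (rule maximalideal.axioms)
  then have I: "is_subgroup I" "x \<in> I \<Longrightarrow> a * x \<in> I" "x \<in> I \<Longrightarrow> x * a \<in> I" for x a
    by (auto simp: ideal_ring_of_type_algebra_iff)
  have ad: "sw (\<lambda>p q. p * x * \<sigma> q) a \<in> S \<inter> I" if "x \<in> S \<inter> I" for x a
    using assms that I(2,3) by (auto simp: left_normal_iff sw_def intro!: is_subgroup_sum[OF I(1)])
  have gc: "is_subgroup (add_prod P Q)" "x \<in> P \<Longrightarrow> y \<in> Q \<Longrightarrow> x * y \<in> add_prod P Q"
    for P Q :: "'a set" and x y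
    unfolding add_prod_def by (auto simp: is_subgroup_group_closure intro!: group_closure.base)
  show "add_prod UNIV (S \<inter> I) = add_prod (S \<inter> I) UNIV"
  proof (intro equalityI subsetI)
    fix z assume "z \<in> add_prod UNIV (S \<inter> I)"
    then have "z \<in> group_closure {x * y |x y. x \<in> UNIV \<and> y \<in> S \<inter> I}" by (simp add: add_prod_def)
    then show "z \<in> add_prod (S \<inter> I) UNIV"
    proof (rule group_closure_closed)
      fix g assume "g \<in> {x * y |x y. x \<in> UNIV \<and> y \<in> S \<inter> I}"
      then obtain a x where g: "g = a * x" and x: "x \<in> S \<inter> I" by auto
      show "g \<in> add_prod (S \<inter> I) UNIV"
        unfolding g ad_conj[of a x] by (intro is_subgroup_sum[OF gc(1)] gc(2) ad[OF x]) auto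
    qed (auto simp: is_subgroupD[OF gc(1)])
  next
    fix z assume "z \<in> add_prod (S \<inter> I) UNIV"
    then have "z \<in> group_closure {x * y |x y. x \<in> S \<inter> I \<and> y \<in> UNIV}" by (simp add: add_prod_def)
    then show "z \<in> add_prod UNIV (S \<inter> I)"
    proof (rule group_closure_closed)
      fix g assume "g \<in> {x * y |x y. x \<in> S \<inter> I \<and> y \<in> UNIV}"
      then obtain a x where g: "g = x * a" and x: "x \<in> S \<inter> I" by auto
      show "g \<in> add_prod UNIV (S \<inter> I)"
        unfolding g ad_conj_skew[of x a] by (intro is_subgroup_sum[OF gc(1)] gc(2) ad[OF x]) auto
    qed (auto simp: is_subgroupD[OF gc(1)])
  qed
qed

text \<open>The kernel of \<open>\<epsilon>\<close> has codimension one: together with any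
  \<open>x\<close> outside it, it yields every \<open>y\<close>.\<close>

lemma maximalideal_counit: "maximalideal {x. \<epsilon> x = 0} (ring_of_type_algebra :: 'a ring)"
proof (rule maximalidealI)
  show "ideal {x. \<epsilon> x = 0} (ring_of_type_algebra :: 'a ring)"
    by (auto simp: ideal_ring_of_type_algebra_iff is_subgroup_def eps_zero eps_diff)
  show "carrier (ring_of_type_algebra :: 'a ring) \<noteq> {x. \<epsilon> x = 0}"
    using counit_one by (auto simp: ring_of_type_algebra_simps set_eq_iff intro!: exI[of _ 1])
  fix J assume J: "ideal J (ring_of_type_algebra :: 'a ring)" "{x. \<epsilon> x = 0} \<subseteq> J"
  then have J': "is_subgroup J" "x \<in> J \<Longrightarrow> x * a \<in> J" for x a
    by (auto simp: ideal_ring_of_type_algebra_iff)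
  show "J = {x. \<epsilon> x = 0} \<or> J = carrier ring_of_type_algebra"
  proof (cases "J = {x. \<epsilon> x = 0}")
    case False
    with J(2) obtain x where x: "x \<in> J" "\<epsilon> x \<noteq> 0" by auto
    have "y \<in> J" for y
    proof -
      let ?c = "\<epsilon> y / \<epsilon> x"
      have "y - x * scale ?c 1 \<in> J" using x(2) J(2) by (auto simp: eps_diff)
      moreover have "x * scale ?c 1 \<in> J" by (rule J'(2)[OF x(1)])
      ultimately have "(y - x * scale ?c 1) + x * scale ?c 1 \<in> J" by (rule is_subgroupD(3)[OF J'(1)])
      then show ?thesis by simp
    qed
    then show ?thesis by (auto simp: ring_of_type_algebra_simps)
  qed simp
qed

lemma aug_left_stable_if_rieffel_normal:
  assumes "rieffel_normal S"
  shows "aug_left_stable"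
  unfolding aug_left_stable_def
proof (intro allI ballI)
  fix a x assume x: "x \<in> aug"
  have S: "S \<inter> {x. \<epsilon> x = 0} = aug" by (auto simp: aug_def)
  have "invariant_ideal aug"
    using assms maximalideal_counit unfolding rieffel_normal_def S[symmetric] by blast
  then have eq: "add_prod UNIV aug = add_prod aug UNIV" by (simp add: invariant_ideal_def)
  have "a * x \<in> add_prod UNIV aug"
    unfolding add_prod_def using x by (intro group_closure.base) blast
  then have "a * x \<in> group_closure {x * y |x y. x \<in> aug \<and> y \<in> UNIV}"
    unfolding eq by (simp add: add_prod_def)
  then show "a * x \<in> ext aug"
    by (rule group_closure_closed)
       (use ext_superset[of aug] ext_mult subspace_ext subspace_0 subspace_diff in blast)+
qed

section \<open>The bimodule \<open>A \<otimes>_S A\<close> and the consequence of depth two\<close>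

definition lmul :: "'a \<Rightarrow> ('a \<times> 'a) frag \<Rightarrow> ('a \<times> 'a) frag" where
  "lmul a = frag_extend (\<lambda>(x, y). frag_of (a * x, y))"

definition rmul :: "'a \<Rightarrow> ('a \<times> 'a) frag \<Rightarrow> ('a \<times> 'a) frag" where
  "rmul b = frag_extend (\<lambda>(x, y). frag_of (x, y * b))"

abbreviation "NS \<equiv> balanced_rel S"

lemma subgroup_NS: "is_subgroup NS"
  by (simp add: balanced_rel_def is_subgroup_tensor_rel)

lemma NS_mem:
  "frag_of (x + x', y) - frag_of (x, y) - frag_of (x', y) \<in> NS"
  "frag_of (x, y + y') - frag_of (x, y) - frag_of (x, y') \<in> NS"
  "s \<in> S \<Longrightarrow> frag_of (x * s, y) - frag_of (x, s * y) \<in> NS"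
  unfolding balanced_rel_def
  by (rule tensor_rel_mem, rule tensor_rel_mem, rule tensor_rel_mem(3)[where ract = "(*)" and lact = "(*)"])

lemma tensor_map_lmul: "tensor_map NS (\<lambda>(x, y). frag_of (a * x, y)) (coset NS u) = coset NS (lmul a u)"
  unfolding lmul_def balanced_rel_def
  by (rule tensor_map_coset)
     (simp_all add: is_subgroup_tensor_rel frag_extend_diff distrib_left mult.assoc[symmetric] NS_mem[unfolded balanced_rel_def])

lemma tensor_map_rmul: "tensor_map NS (\<lambda>(x, y). frag_of (x, y * b)) (coset NS u) = coset NS (rmul b u)"
  unfolding rmul_def balanced_rel_def
  by (rule tensor_map_coset)
     (simp_all add: is_subgroup_tensor_rel frag_extend_diff distrib_right mult.assoc NS_mem[unfolded balanced_rel_def])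

lemma additive_lmul: "additive_map (lmul a)" and additive_rmul: "additive_map (rmul a)"
  by (simp_all add: lmul_def rmul_def additive_map_frag_extend)

lemma aug_left_stable_if_right_depth_two:
  assumes "right_depth_two S"
  shows "aug_left_stable"
  unfolding aug_left_stable_def
proof (intro allI ballI)
  fix a x :: 'a assume x: "x \<in> aug"
  then have xS: "x \<in> S" by (simp add: aug_def)
  let ?T = "quotient_space NS"
  obtain n M M' \<phi> where M: "subbimodule S n M" and M': "subbimodule S n M'"
    and Int: "M \<inter> M' = {0}" and Sum: "M + M' = free_mod n" and bij: "bij_betw \<phi> ?T M"
    and add: "\<forall>t\<in>?T. \<forall>t'\<in>?T. \<phi> (t + t') = \<phi> t + \<phi> t'"
    and left: "\<forall>a. \<forall>t\<in>?T. \<phi> (tensor_map NS (\<lambda>(x, y). frag_of (a * x, y)) t) = (\<lambda>i. a * \<phi> t i)"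
    and right: "\<forall>b\<in>S. \<forall>t\<in>?T. \<phi> (tensor_map NS (\<lambda>(x, y). frag_of (x, y * b)) t) = (\<lambda>i. \<phi> t i * b)"
    using assms unfolding right_depth_two_def Let_def by (elim exE conjE) (rule that; assumption)
  have T: "coset NS u \<in> ?T" for u by (simp add: quotient_space_def)
  define g where "g = (\<lambda>u. \<phi> (coset NS u))"
  have g_add: "additive_map g"
    using add T by (auto simp: additive_map_def g_def coset_add[OF subgroup_NS, symmetric])
  have g_left: "g (lmul c u) = (\<lambda>i. c * g u i)" for c u
    using left T by (simp add: g_def tensor_map_lmul[symmetric])
  have g_right: "b \<in> S \<Longrightarrow> g (rmul b u) = (\<lambda>i. g u i * b)" for b u
    using right T by (simp add: g_def tensor_map_rmul[symmetric])
  have g_inj: "u - v \<in> NS" if "g u = g v" for u v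
    using inj_onD[OF bij_betw_imp_inj_on[OF bij] _ T T, of u v] that
    by (simp add: g_def coset_eq_iff[OF subgroup_NS])
  have g_M: "g u \<in> M" for u using bij_betwE[OF bij] T by (auto simp: g_def)
  have g_surj: "\<exists>u. g u = m" if "m \<in> M" for m
  proof -
    have "m \<in> \<phi> ` ?T" using bij that by (simp add: bij_betw_def)
    then show ?thesis by (auto simp: g_def quotient_space_def)
  qed
  have sub: "is_subgroup W" and act: "v \<in> W \<Longrightarrow> (\<lambda>i. c * v i) \<in> W" if "subbimodule S n W" for W v c
  proof -
    show act: "v \<in> W \<Longrightarrow> (\<lambda>i. c * v i) \<in> W" for v c using that by (auto simp: subbimodule_def)
    have "u - v \<in> W" if "u \<in> W" "v \<in> W" for u v
    proof -
      have "u + (\<lambda>i. - 1 * v i) \<in> W"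
        using \<open>subbimodule S n W\<close> that(1) act[OF that(2), of "- 1"] unfolding subbimodule_def by blast
      moreover have "u + (\<lambda>i. - 1 * v i) = u - v" by (auto simp: fun_eq_iff)
      ultimately show ?thesis by simp
    qed
    then show "is_subgroup W" using that by (auto simp: is_subgroup_def subbimodule_def)
  qed
  \<comment> \<open>The standard basis of \<open>A^n\<close> is split along \<open>M + M'\<close>,
    and its \<open>M\<close>-parts \<open>m i\<close> are pulled back to tensors
    \<open>w i\<close>.\<close>
  define e where "e = (\<lambda>i (j::nat). if j = i then 1 else (0::'a))"
  have "\<exists>m m'. m \<in> M \<and> m' \<in> M' \<and> e i = m + m'" if "i < n" for i
  proof -
    have "e i \<in> M + M'" unfolding Sum using that by (auto simp: free_mod_def e_def)
    then show ?thesis by (auto simp: set_plus_def)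
  qed
  then obtain m m' where m: "\<And>i. i < n \<Longrightarrow> m i \<in> M \<and> m' i \<in> M' \<and> e i = m i + m' i" by metis
  define w where "w = (\<lambda>i. SOME u. g u = m i)"
  have w: "g (w i) = m i" if "i < n" for i
    unfolding w_def by (rule someI_ex[OF g_surj]) (use m[OF that] in blast)
  define u where "u = frag_of (1::'a, a)"
  \<comment> \<open>The image of \<open>1 \<otimes> a x\<close>. By right \<open>S\<close>-linearity
    its entries lie in \<open>A x\<close>, so their counits vanish.\<close>
  define v where "v = g (rmul x u)"
  have v_eq: "v = (\<lambda>i. g u i * x)" using g_right[OF xS] by (simp add: v_def)
  have "v \<in> M" by (simp add: v_def g_M)
  then have "v \<in> free_mod n" using M by (auto simp: subbimodule_def)
  have "v = (\<Sum>i<n. (\<lambda>j. v i * e i j))"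
    using \<open>v \<in> free_mod n\<close>
    by (auto simp: fun_eq_iff sum_fun_apply e_def free_mod_def if_distrib[of "(*) _"] cong: if_cong)
  also have "\<dots> = (\<Sum>i<n. (\<lambda>j. v i * m i j) + (\<lambda>j. v i * m' i j))"
    using m by (intro sum.cong) (auto simp: fun_eq_iff algebra_simps)
  finally have v_sum: "v = (\<Sum>i<n. (\<lambda>j. v i * m i j)) + (\<Sum>i<n. (\<lambda>j. v i * m' i j))"
    by (simp add: sum.distrib)
  have "(\<Sum>i<n. (\<lambda>j. v i * m i j)) \<in> M"
    using m by (intro is_subgroup_sum[OF sub[OF M]] act[OF M]) auto
  then have 1: "v - (\<Sum>i<n. (\<lambda>j. v i * m i j)) \<in> M"
    by (rule is_subgroupD(2)[OF sub[OF M] \<open>v \<in> M\<close>])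
  have "(\<Sum>i<n. (\<lambda>j. v i * m' i j)) \<in> M'"
    using m by (intro is_subgroup_sum[OF sub[OF M']] act[OF M']) auto
  also have "(\<Sum>i<n. (\<lambda>j. v i * m' i j)) = v - (\<Sum>i<n. (\<lambda>j. v i * m i j))"
    by (subst eq_diff_eq, subst add.commute, rule v_sum[symmetric])
  \<comment> \<open>The \<open>M'\<close>-part of \<open>v\<close> also lies in \<open>M\<close>,
    hence is zero, and \<open>v\<close> is a combination of the \<open>m i\<close> alone.\<close>
  finally have "v - (\<Sum>i<n. (\<lambda>j. v i * m i j)) \<in> {0}"
    unfolding Int[symmetric] using 1 by (rule IntI[rotated])
  then have "v = (\<Sum>i<n. (\<lambda>j. v i * m i j))" by simp
  also have "\<dots> = g (\<Sum>i<n. lmul (v i) (w i))"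
    using w by (simp add: additive_map_simps(5)[OF g_add] g_left)
  finally have "rmul x u - (\<Sum>i<n. lmul (v i) (w i)) \<in> NS"
    unfolding v_def by (rule g_inj)
  \<comment> \<open>The map \<open>\<epsilon> \<otimes> id\<close>, well defined on
    \<open>A \<otimes>_S A\<close> modulo \<open>S^+ A\<close>: it sends
    \<open>p s \<otimes> q - p \<otimes> s q\<close> to
    \<open>\<epsilon>(p) (\<epsilon>(s) 1 - s) q\<close>.\<close>
  define \<theta> where "\<theta> = frag_lift (\<lambda>(p, q). scale (\<epsilon> p) q)"
  have \<theta>: "additive_map \<theta>" by (simp add: \<theta>_def additive_map_frag_lift)
  have \<theta>_NS: "\<theta> r \<in> ext aug" if "r \<in> NS" for r
    using that unfolding balanced_rel_def tensor_rel_def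
  proof (rule group_closure_closed)
    have "scale (\<epsilon> p) (scale (\<epsilon> s) q - s * q) \<in> ext aug" if "s \<in> S" for p q s
    proof -
      have "- ((s - scale (\<epsilon> s) 1) * q) \<in> ext aug"
        using ext_mult ext_superset[of aug] minus_eps_in_aug[OF that]
        by (intro subspace_neg[OF subspace_ext] ext_mult) auto
      then show ?thesis
        by (intro subspace_scale[OF subspace_ext]) (simp add: algebra_simps scale_mult)
    qed
    then show "\<theta> r \<in> ext aug"
      if "r \<in> {frag_of (x + x', y) - frag_of (x, y) - frag_of (x', y) |x x' y. True} \<union>
       {frag_of (x, y + y') - frag_of (x, y) - frag_of (x, y') |x y y'. True} \<union>
       {frag_of (x * r, y) - frag_of (x, r * y) |x y r. r \<in> S}" for r
      using that subspace_0[OF subspace_ext]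
      by (auto simp: \<theta>_def frag_lift_simps scale_left_distrib scale_right_distrib scale_right_diff_distrib)
  qed (auto simp: additive_map_simps[OF \<theta>] subspace_0[OF subspace_ext] subspace_diff[OF subspace_ext])
  have \<theta>_lmul: "\<theta> (lmul c r) = scale (\<epsilon> c) (\<theta> r)" for c r
    by (rule additive_map_eq_frag[of "\<lambda>r. \<theta> (lmul c r)"])
       (auto simp: additive_map_def additive_map_simps[OF \<theta>] additive_map_simps[OF additive_lmul] scale_right_distrib,
        simp add: \<theta>_def lmul_def)
  have "\<epsilon> (v i) = 0" for i using x by (simp add: v_eq aug_def)
  then have "\<theta> (\<Sum>i<n. lmul (v i) (w i)) = 0"
    by (simp add: additive_map_simps(5)[OF \<theta>] \<theta>_lmul)
  moreover have "\<theta> (rmul x u) = a * x" by (simp add: \<theta>_def u_def rmul_def)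
  ultimately have "\<theta> (rmul x u - (\<Sum>i<n. lmul (v i) (w i))) = a * x"
    by (simp add: additive_map_simps[OF \<theta>])
  with \<theta>_NS[OF \<open>rmul x u - _ \<in> NS\<close>] show "a * x \<in> ext aug" by simp
qed

end


section \<open>The Galois map\<close>

context coideal_subalgebra
begin

text \<open>Equality in \<open>A \<otimes>_S A\<close>, kept on representatives so that calculations
  can be chained.\<close>

definition cg :: "('a \<times> 'a) frag \<Rightarrow> ('a \<times> 'a) frag \<Rightarrow> bool" where
  "cg u v \<longleftrightarrow> u - v \<in> NS"

lemma cg_refl [simp]: "cg u u"
  by (simp add: cg_def is_subgroupD[OF subgroup_NS])

lemma cg_eq: "u = v \<Longrightarrow> cg u v"
  by simp

lemma cg_sym: "cg u v \<Longrightarrow> cg v u"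
  using is_subgroupD(4)[OF subgroup_NS, of "u - v"] by (simp add: cg_def)

lemma cg_trans [trans]: "cg u v \<Longrightarrow> cg v w \<Longrightarrow> cg u w"
  using is_subgroupD(3)[OF subgroup_NS, of "u - v" "v - w"] by (simp add: cg_def)

lemma cg_add: "cg u v \<Longrightarrow> cg u' v' \<Longrightarrow> cg (u + u') (v + v')"
  using is_subgroupD(3)[OF subgroup_NS, of "u - v" "u' - v'"] by (simp add: cg_def algebra_simps)

lemma cg_diff: "cg u v \<Longrightarrow> cg u' v' \<Longrightarrow> cg (u - u') (v - v')"
  using is_subgroupD(2)[OF subgroup_NS, of "u - v" "u' - v'"] by (simp add: cg_def algebra_simps)

lemma cg_sum: "(\<And>i. i \<in> I \<Longrightarrow> cg (f i) (g i)) \<Longrightarrow> cg (\<Sum>i\<in>I. f i) (\<Sum>i\<in>I. g i)"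
  by (induction I rule: infinite_finite_induct) (auto intro: cg_add)

lemma cg_additive:
  fixes h :: "'x::ab_group_add \<Rightarrow> ('a \<times> 'a) frag"
  assumes "\<And>x y. cg (h (x + y)) (h x + h y)"
  shows "cg (h 0) 0" "cg (h (x - y)) (h x - h y)" "cg (h (\<Sum>i\<in>I. f i)) (\<Sum>i\<in>I. h (f i))"
proof -
  show 0: "cg (h 0) 0" using cg_sym[OF assms[of 0 0]] by (simp add: cg_def)
  show "cg (h (x - y)) (h x - h y)"
    using cg_sym[OF assms[of "x - y" y]] by (simp add: cg_def algebra_simps)
  show "cg (h (\<Sum>i\<in>I. f i)) (\<Sum>i\<in>I. h (f i))"
  proof (induction I rule: infinite_finite_induct)
    case (insert i I)
    from cg_trans[OF assms cg_add[OF cg_refl insert.IH]] insert.hyps show ?case by simp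
  qed (simp_all add: 0)
qed

abbreviation tp :: "'a \<Rightarrow> 'a \<Rightarrow> ('a \<times> 'a) frag" where
  "tp x y \<equiv> frag_of (x, y)"

lemma cg_tp_add:
  "cg (tp (x + x') y) (tp x y + tp x' y)" "cg (tp x (y + y')) (tp x y + tp x y')"
  using NS_mem by (simp_all add: cg_def diff_diff_eq)

lemma cg_tp_sum:
  "cg (tp (\<Sum>i\<in>I. f i) y) (\<Sum>i\<in>I. tp (f i) y)" "cg (tp x (\<Sum>i\<in>I. f i)) (\<Sum>i\<in>I. tp x (f i))"
  by (rule cg_additive(3)[of "\<lambda>x. tp x y"], rule cg_tp_add) (rule cg_additive(3)[of "\<lambda>y. tp x y"], rule cg_tp_add)

lemma cg_tp_S: "s \<in> S \<Longrightarrow> cg (tp (x * s) y) (tp x (s * y))"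
  using NS_mem(3) by (simp add: cg_def)

lemma cg_tp_scale: "cg (tp (scale c x) y) (tp x (scale c y))"
  using cg_tp_S[of "scale c 1" x y] by (simp add: subspace_scale subspace_S one_S scale_mult)

text \<open>The analogue of \<open>bal2_eval\<close> over \<open>S\<close>: scalars cross the tensor
  sign because \<open>k 1\<close> lies in \<open>S\<close>.\<close>

lemma cg_tp_eval:
  assumes "Vector_Spaces.linear scale scale f"
  shows "cg (\<Sum>c\<in>Basis. tp (f c) (scale (coord c m) y)) (tp (f m) y)"
proof -
  interpret f: Vector_Spaces.linear scale scale f by (rule assms)
  have "cg (\<Sum>c\<in>Basis. tp (f c) (scale (coord c m) y)) (\<Sum>c\<in>Basis. tp (f (scale (coord c m) c)) y)"
    by (rule cg_sum, rule cg_sym) (simp add: f.scale cg_tp_scale)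
  also have "cg \<dots> (tp (\<Sum>c\<in>Basis. f (scale (coord c m) c)) y)" by (rule cg_sym[OF cg_tp_sum(1)])
  also have "cg \<dots> (tp (f m) y)" by (simp add: f.sum[symmetric] sum_coord)
  finally show ?thesis .
qed

text \<open>\<open>galois_inv x z\<close> represents \<open>x \<sigma>(z\<^sub>1) \<otimes> z\<^sub>2 \<in> A \<otimes>\<^sub>S A\<close>, the preimage of \<open>x \<otimes> z\<close> under the
  Galois map \<open>x \<otimes> y \<mapsto> x y\<^sub>1 \<otimes> y\<^sub>2\<close>.\<close>

definition galois_inv :: "'a \<Rightarrow> 'a \<Rightarrow> ('a \<times> 'a) frag" where
  "galois_inv x z = (\<Sum>e\<in>Basis. tp (x * \<sigma> e) (D e z))"

lemma cg_galois_inv_add: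
  "cg (galois_inv (x + x') z) (galois_inv x z + galois_inv x' z)"
  "cg (galois_inv x (z + z')) (galois_inv x z + galois_inv x z')"
  unfolding galois_inv_def sum.distrib[symmetric] distrib_right D_add
  by (rule cg_sum, rule cg_tp_add)+

lemma cg_galois_inv_sum:
  "cg (galois_inv (\<Sum>i\<in>I. f i) z) (\<Sum>i\<in>I. galois_inv (f i) z)"
  "cg (galois_inv x (\<Sum>i\<in>I. f i)) (\<Sum>i\<in>I. galois_inv x (f i))"
  by (rule cg_additive(3)[of "\<lambda>x. galois_inv x z"], rule cg_galois_inv_add)
     (rule cg_additive(3)[of "galois_inv x"], rule cg_galois_inv_add)

lemma cg_galois_inv_scale: "cg (galois_inv (scale c x) z) (galois_inv x (scale c z))"
  unfolding galois_inv_def by (rule cg_sum) (simp add: scale_mult cg_tp_scale)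

text \<open>Since \<open>s_2\<close> lies in \<open>S\<close>, \<open>x \<sigma>(s_1 a_1) \<otimes>
  s_2 a_2 = x \<sigma>(a_1) \<sigma>(s_1) s_2 \<otimes> a_2\<close>, and
  \<open>\<sigma>(s_1) s_2 = \<epsilon>(s) 1 = 0\<close>. This is what lets
  \<open>galois_inv\<close> descend to \<open>A \<otimes> A / S^+ A\<close>.\<close>

lemma cg_galois_inv_aug:
  assumes s: "s \<in> aug"
  shows "cg (galois_inv x (s * a)) 0"
proof -
  have sS: "s \<in> S" using s by (simp add: aug_def)
  have lin: "Vector_Spaces.linear scale scale (\<lambda>c. x * \<sigma> c)"
    by (auto simp: Vector_Spaces.linear_iff vector_space_axioms algebra_simps scale_mult)
  have swap1: "(\<Sum>c\<in>Basis. \<Sum>b\<in>Basis. \<Sum>b'\<in>Basis. tp (x * \<sigma> c) (scale (coord c (b * b')) (D b s * D b' a))) =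
      (\<Sum>b'\<in>Basis. \<Sum>b\<in>Basis. \<Sum>c\<in>Basis. tp (x * \<sigma> c) (scale (coord c (b * b')) (D b s * D b' a)))"
    by (rule trans[OF sum.cong[OF refl sum.swap] trans[OF sum.swap sum.cong[OF refl sum.swap]]])
  have "cg (galois_inv x (s * a)) (\<Sum>c\<in>Basis. tp (x * \<sigma> c)
      (\<Sum>b\<in>Basis. \<Sum>b'\<in>Basis. scale (coord c (b * b')) (D b s * D b' a)))"
    by (simp add: galois_inv_def D_mult)
  also have "cg \<dots> (\<Sum>c\<in>Basis. \<Sum>b\<in>Basis. \<Sum>b'\<in>Basis. tp (x * \<sigma> c) (scale (coord c (b * b')) (D b s * D b' a)))"
    by (rule cg_sum, rule cg_trans[OF cg_tp_sum(2)], rule cg_sum, rule cg_tp_sum(2))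
  also have "cg \<dots> (\<Sum>b'\<in>Basis. \<Sum>b\<in>Basis. \<Sum>c\<in>Basis. tp (x * \<sigma> c) (scale (coord c (b * b')) (D b s * D b' a)))"
    by (subst swap1) (rule cg_refl)
  also have "cg \<dots> (\<Sum>b'\<in>Basis. \<Sum>b\<in>Basis. tp (x * \<sigma> (b * b')) (D b s * D b' a))"
    by (intro cg_sum cg_tp_eval lin)
  also have "cg \<dots> (\<Sum>b'\<in>Basis. \<Sum>b\<in>Basis. tp (x * \<sigma> (b * b') * D b s) (D b' a))"
    by (intro cg_sum cg_sym[OF cg_tp_S] D_S[OF sS])
  also have "cg \<dots> (\<Sum>b'\<in>Basis. tp (\<Sum>b\<in>Basis. x * \<sigma> (b * b') * D b s) (D b' a))"
    by (intro cg_sum cg_sym[OF cg_tp_sum(1)])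
  also have "cg \<dots> (\<Sum>b'\<in>Basis. tp 0 (D b' a))"
  proof (intro cg_eq sum.cong refl arg_cong[where f = "\<lambda>z. tp z _"])
    fix b'
    have "(\<Sum>b\<in>Basis. x * \<sigma> (b * b') * D b s) = x * \<sigma> b' * sw (\<lambda>p q. \<sigma> p * q) s"
      by (simp add: sw_def sum_distrib_left sigma_mult mult.assoc)
    also have "sw (\<lambda>p q. \<sigma> p * q) s = 0"
      using sw_antipode_left[of "\<lambda>z. z" s] s by (simp add: additive_map_def aug_def)
    finally show "(\<Sum>b\<in>Basis. x * \<sigma> (b * b') * D b s) = 0" by simp
  qed
  also have "cg \<dots> (\<Sum>b'\<in>Basis. 0)"
    by (rule cg_sum, rule cg_additive(1)[of "\<lambda>x. tp x _", OF cg_tp_add(1)])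
  finally show ?thesis by simp
qed

lemma cg_galois_inv_ext_aug:
  assumes "z \<in> ext aug"
  shows "cg (galois_inv x z) 0"
  using assms unfolding ext_def
proof (induction z arbitrary: x rule: span_induct_alt)
  case base
  show ?case by (rule cg_additive(1)[of "galois_inv x", OF cg_galois_inv_add(2)])
next
  case (step c z y)
  then obtain s a where "z = s * a" "s \<in> aug" by auto
  then have "cg (galois_inv x (scale c z)) 0"
    using cg_trans[OF cg_sym[OF cg_galois_inv_scale] cg_galois_inv_aug] by blast
  with step.IH have "cg (galois_inv x (scale c z) + galois_inv x y) (0 + 0)" by (intro cg_add) auto
  with cg_galois_inv_add(2) show ?case by (metis add_0 cg_trans)
qed

text \<open>\<open>galois_inv\<close> undoes the Galois map, because
  \<open>x y_1 \<sigma>(y_2) \<otimes> y_3 = x \<otimes> y\<close>.\<close>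

lemma cg_galois_inv_comult: "cg (\<Sum>b\<in>Basis. galois_inv (x * b) (D b y)) (tp x y)"
proof -
  have lin: "Vector_Spaces.linear scale scale (\<lambda>e. x * b * \<sigma> e)" for b
    by (auto simp: Vector_Spaces.linear_iff vector_space_axioms algebra_simps scale_mult)
  have swap2: "(\<Sum>b\<in>Basis. \<Sum>e\<in>Basis. \<Sum>g\<in>Basis. tp (x * b * \<sigma> e) (scale (coord e (D b g)) (D g y))) =
      (\<Sum>g\<in>Basis. \<Sum>b\<in>Basis. \<Sum>e\<in>Basis. tp (x * b * \<sigma> e) (scale (coord e (D b g)) (D g y)))"
    by (rule trans[OF sum.cong[OF refl sum.swap] sum.swap])
  have "cg (\<Sum>b\<in>Basis. galois_inv (x * b) (D b y))
      (\<Sum>b\<in>Basis. \<Sum>e\<in>Basis. tp (x * b * \<sigma> e) (\<Sum>g\<in>Basis. scale (coord e (D b g)) (D g y)))"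
    by (simp add: galois_inv_def D_D)
  also have "cg \<dots> (\<Sum>b\<in>Basis. \<Sum>e\<in>Basis. \<Sum>g\<in>Basis. tp (x * b * \<sigma> e) (scale (coord e (D b g)) (D g y)))"
    by (rule cg_sum, rule cg_sum, rule cg_tp_sum(2))
  also have "cg \<dots> (\<Sum>g\<in>Basis. \<Sum>b\<in>Basis. \<Sum>e\<in>Basis. tp (x * b * \<sigma> e) (scale (coord e (D b g)) (D g y)))"
    by (subst swap2) (rule cg_refl)
  also have "cg \<dots> (\<Sum>g\<in>Basis. \<Sum>b\<in>Basis. tp (x * b * \<sigma> (D b g)) (D g y))"
    by (intro cg_sum cg_tp_eval lin)
  also have "cg \<dots> (\<Sum>g\<in>Basis. tp (\<Sum>b\<in>Basis. x * b * \<sigma> (D b g)) (D g y))"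
    by (intro cg_sum cg_sym[OF cg_tp_sum(1)])
  also have "cg \<dots> (\<Sum>g\<in>Basis. tp (scale (\<epsilon> g) x) (D g y))"
  proof (intro cg_eq sum.cong refl arg_cong[where f = "\<lambda>z. tp z _"])
    fix g
    have "(\<Sum>b\<in>Basis. x * b * \<sigma> (D b g)) = x * sw (\<lambda>p q. p * \<sigma> q) g"
      by (simp add: sw_def sum_distrib_left mult.assoc)
    also have "sw (\<lambda>p q. p * \<sigma> q) g = scale (\<epsilon> g) 1"
      using sw_antipode_right[of "\<lambda>z. z" g] by (simp add: additive_map_def)
    finally show "(\<Sum>b\<in>Basis. x * b * \<sigma> (D b g)) = scale (\<epsilon> g) x" by (simp add: scale_mult)
  qed
  also have "cg \<dots> (\<Sum>g\<in>Basis. tp x (scale (\<epsilon> g) (D g y)))"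
    by (intro cg_sum cg_tp_scale)
  also have "cg \<dots> (tp x (\<Sum>g\<in>Basis. scale (\<epsilon> g) (D g y)))" by (rule cg_sym[OF cg_tp_sum(2)])
  also have "cg \<dots> (tp x y)" using sw_counit_left'[of y] by (simp add: sw_def)
  finally show ?thesis .
qed

text \<open>Coordinates on \<open>A / S^+ A\<close>: extend a basis of \<open>S^+ A\<close> to one
  of \<open>A\<close>, and let \<open>v\<close> list the added vectors. There is at least one, as
  \<open>1\<close> has nonzero counit and so lies outside \<open>S^+ A\<close>.\<close>

lemma complement_functionals:
  obtains n :: nat and v :: "nat \<Rightarrow> 'a" and \<gamma> :: "nat \<Rightarrow> 'a \<Rightarrow> 'k"
  where "1 \<le> n" "\<And>i. Vector_Spaces.linear scale (*) (\<gamma> i)" "\<And>i x. i < n \<Longrightarrow> x \<in> ext aug \<Longrightarrow> \<gamma> i x = 0"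
    "\<And>i j. i < n \<Longrightarrow> j < n \<Longrightarrow> \<gamma> i (v j) = (if i = j then 1 else 0)"
    "\<And>x. x - (\<Sum>i<n. scale (\<gamma> i x) (v i)) \<in> ext aug"
proof -
  obtain BK where BK: "BK \<subseteq> ext aug" "independent BK" "ext aug \<subseteq> span BK"
    using basis_exists[of "ext aug"] by metis
  have spK: "span BK = ext aug" using BK subspace_ext span_minimal by (metis subset_antisym)
  obtain B where B: "BK \<subseteq> B" "independent B" "UNIV \<subseteq> span B"
    using maximal_independent_subset_extend[of BK UNIV] BK by auto
  have spB: "span B = UNIV" using B(3) by auto
  have finB: "finite B" by (rule finiteI_independent[OF B(2)])
  define C where "C = B - BK"
  have finC: "finite C" using finB by (simp add: C_def)
  obtain v where v: "bij_betw v {..<card C} C"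
    using ex_bij_betw_nat_finite[OF finC] by (auto simp: atLeast0LessThan)
  have vC: "v i \<in> C" if "i < card C" for i using v that by (auto simp: bij_betw_def)
  have vinj: "v i = v j \<longleftrightarrow> i = j" if "i < card C" "j < card C" for i j
    using v that by (auto simp: bij_betw_def inj_on_def)
  let ?\<gamma> = "\<lambda>i x. representation B x (v i)"
  show ?thesis
  proof (rule that[of "card C" ?\<gamma> v])
    have "C \<noteq> {}"
    proof
      assume "C = {}"
      then have "B = BK" using B(1) by (auto simp: C_def)
      then have "1 \<in> ext aug" using spB spK by auto
      then show False using eps_ext_aug by force
    qed
    then show "1 \<le> card C" using finC by (simp add: Suc_le_eq card_gt_0_iff)
    show "Vector_Spaces.linear scale (*) (?\<gamma> i)" for i by (rule linear_representation[OF B(2) spB])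
    show "?\<gamma> i x = 0" if "i < card C" "x \<in> ext aug" for i x
    proof -
      have "representation B x = representation BK x"
        using that(2) B(1,2) spK by (intro representation_extend) auto
      then show ?thesis using vC[OF that(1)] representation_ne_zero[of BK x "v i"] by (auto simp: C_def)
    qed
    show "?\<gamma> i (v j) = (if i = j then 1 else 0)" if "i < card C" "j < card C" for i j
      using representation_basis[OF B(2), of "v j"] vC[OF that(2)] vinj[OF that] by (auto simp: C_def)
    show "x - (\<Sum>i<card C. scale (?\<gamma> i x) (v i)) \<in> ext aug" for x
    proof -
      have "x = (\<Sum>b\<in>B. scale (representation B x b) b)"
        using spB finB B(2) by (intro sum_representation_eq[symmetric]) auto
      also have "\<dots> = (\<Sum>b\<in>C. scale (representation B x b) b) + (\<Sum>b\<in>BK. scale (representation B x b) b)"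
        unfolding C_def by (rule sum.subset_diff[OF B(1) finB])
      also have "(\<Sum>b\<in>C. scale (representation B x b) b) = (\<Sum>i<card C. scale (?\<gamma> i x) (v i))"
        by (rule sum.reindex_bij_betw[OF v, symmetric])
      finally have "x - (\<Sum>i<card C. scale (?\<gamma> i x) (v i)) = (\<Sum>b\<in>BK. scale (representation B x b) b)"
        by (simp add: algebra_simps)
      then show ?thesis using BK(1) by (auto intro!: subspace_sum subspace_scale subspace_ext)
    qed
  qed
qed

text \<open>In coordinates the Galois map is an isomorphism onto the whole of \<open>A^n\<close>,
  with \<open>n\<close> the dimension of \<open>A / S^+ A\<close>, so the complementary summand is
  zero.\<close>

lemma right_depth_two_if_aug_left_stable:
  assumes st: "aug_left_stable"
  shows "right_depth_two S"
proof -
  note K = subspace_ext[of aug]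
  obtain n and v :: "nat \<Rightarrow> 'a" and \<gamma> :: "nat \<Rightarrow> 'a \<Rightarrow> 'k" where n: "1 \<le> n"
    and \<gamma>_linear: "\<And>i. Vector_Spaces.linear scale (*) (\<gamma> i)"
    and \<gamma>_K: "\<And>i x. i < n \<Longrightarrow> x \<in> ext aug \<Longrightarrow> \<gamma> i x = 0"
    and \<gamma>_v: "\<And>i j. i < n \<Longrightarrow> j < n \<Longrightarrow> \<gamma> i (v j) = (if i = j then 1 else 0)"
    and v_span: "\<And>x. x - (\<Sum>i<n. scale (\<gamma> i x) (v i)) \<in> ext aug"
    by (rule complement_functionals) (rule that; assumption)
  have \<gamma>: "\<gamma> i (x + y) = \<gamma> i x + \<gamma> i y" "\<gamma> i (scale c x) = c * \<gamma> i x" "\<gamma> i (x - y) = \<gamma> i x - \<gamma> i y" for i x y c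
  proof -
    interpret \<gamma>: Vector_Spaces.linear scale "(*)" "\<gamma> i" by (rule \<gamma>_linear)
    show "\<gamma> i (x + y) = \<gamma> i x + \<gamma> i y" "\<gamma> i (scale c x) = c * \<gamma> i x" "\<gamma> i (x - y) = \<gamma> i x - \<gamma> i y"
      by (simp_all add: \<gamma>.add \<gamma>.scale \<gamma>.diff)
  qed
  have \<gamma>_left: "\<gamma> i (s * b) = \<epsilon> s * \<gamma> i b" if "s \<in> S" "i < n" for s b i
  proof -
    have "(s - scale (\<epsilon> s) 1) * b \<in> ext aug"
      using minus_eps_in_aug[OF that(1)] ext_superset[of aug] by (intro ext_mult) auto
    from \<gamma>_K[OF that(2) this] show ?thesis by (simp add: left_diff_distrib scale_mult \<gamma>)
  qed
  \<comment> \<open>Here the hypothesis enters: \<open>S\<close> acts on \<open>A / S^+ A\<close>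
    from the right through \<open>\<epsilon>\<close>.\<close>
  have \<gamma>_right: "\<gamma> i (b * s) = \<epsilon> s * \<gamma> i b" if "s \<in> S" "i < n" for s b i
  proof -
    have "b * (s - scale (\<epsilon> s) 1) \<in> ext aug"
      using minus_eps_in_aug[OF that(1)] ext_superset[of aug] by (intro ext_aug_left[OF st]) auto
    from \<gamma>_K[OF that(2) this] show ?thesis by (simp add: right_diff_distrib scale_mult \<gamma>)
  qed
  \<comment> \<open>The \<open>i\<close>-th coordinate of the Galois image
    \<open>a b_1 \<otimes> b_2\<close>.\<close>
  define G where "G = (\<lambda>i a b. sw (\<lambda>p q. scale (\<gamma> i q) (a * p)) b)"
  have G_bal: "bal2 (\<lambda>p q. scale (\<gamma> i q) (a * p))" for i a
    by (auto simp: balanced_def \<gamma> algebra_simps scale_left_distrib scale_right_distrib scale_mult)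
  have G_add: "G i (a + a') b = G i a b + G i a' b" "G i a (b + b') = G i a b + G i a b'" for i a a' b b'
    by (simp_all add: G_def sw_add[OF G_bal]) (simp add: sw_def algebra_simps scale_right_distrib sum.distrib)
  have G_left: "G i (c * a) b = c * G i a b" for i c a b
    by (simp add: G_def sw_def sum_distrib_left scale_mult mult.assoc)
  \<comment> \<open>Modulo \<open>S^+ A\<close>, \<open>s_2 b_2\<close> is
    \<open>\<epsilon>(s_2) b_2\<close>, so \<open>a s_1 b_1 \<otimes> s_2 b_2\<close> becomes
    \<open>a s b_1 \<otimes> b_2\<close>.\<close>
  have G_S: "G i (a * s) b = G i a (s * b)" if "s \<in> S" "i < n" for i a s b
  proof -
    have "G i a (s * b) = sw (\<lambda>p q. sw (\<lambda>p' q'. scale (\<gamma> i (q * q')) (a * (p * p'))) b) s"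
      unfolding G_def by (rule sw_mult[OF G_bal])
    also have "\<dots> = sw (\<lambda>p q. sw (\<lambda>p' q'. scale (\<gamma> i q') (a * scale (\<epsilon> q) p * p')) b) s"
      using D_S[OF that(1)] that(2) by (simp add: sw_def \<gamma>_left scale_mult mult.assoc mult.commute)
    also have "\<dots> = G i (a * s) b"
      unfolding G_def sw_swap[of _ b s]
    proof (intro arg_cong[where f = "\<lambda>f. sw f b"] ext)
      fix p' q'
      show "sw (\<lambda>p q. scale (\<gamma> i q') (a * scale (\<epsilon> q) p * p')) s = scale (\<gamma> i q') (a * s * p')"
        by (rule sw_counit_right[where h = "\<lambda>z. scale (\<gamma> i q') (a * z * p')"])
           (auto simp: additive_map_def algebra_simps scale_right_distrib)
    qed
    finally show ?thesis by simp
  qed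
  have G_right: "G i a (b * s) = G i a b * s" if "s \<in> S" "i < n" for i a s b
  proof -
    have "G i a (b * s) = sw (\<lambda>p q. sw (\<lambda>p' q'. scale (\<gamma> i (q * q')) (a * (p * p'))) s) b"
      unfolding G_def by (rule sw_mult[OF G_bal])
    also have "\<dots> = sw (\<lambda>p q. sw (\<lambda>p' q'. scale (\<gamma> i q) (a * p * scale (\<epsilon> q') p')) s) b"
      using D_S[OF that(1)] that(2) by (simp add: sw_def \<gamma>_right scale_mult mult.assoc mult.commute)
    also have "\<dots> = sw (\<lambda>p q. scale (\<gamma> i q) (a * p * s)) b"
    proof (intro arg_cong[where f = "\<lambda>f. sw f b"] ext)
      fix p q
      show "sw (\<lambda>p' q'. scale (\<gamma> i q) (a * p * scale (\<epsilon> q') p')) s = scale (\<gamma> i q) (a * p * s)"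
        by (rule sw_counit_right[where h = "\<lambda>z. scale (\<gamma> i q) (a * p * z)"])
           (auto simp: additive_map_def algebra_simps scale_right_distrib)
    qed
    also have "\<dots> = G i a b * s" by (simp add: G_def sw_def sum_distrib_right scale_mult)
    finally show ?thesis .
  qed
  define h where "h = (\<lambda>u i. if i < n then frag_lift (\<lambda>(a, b). G i a b) u else 0)"
  have h_add: "additive_map h"
    by (auto simp: additive_map_def h_def fun_eq_iff frag_lift_simps)
  have h_of: "h (tp a b) i = (if i < n then G i a b else 0)" for a b i by (simp add: h_def)
  have h_NS: "h u = 0" if "u \<in> NS" for u
    using that unfolding balanced_rel_def
    by (rule additive_map_vanish_tensor_rel[OF h_add])
       (auto simp: balanced_def fun_eq_iff h_of G_add G_S)
  have h_cg: "h u = h u'" if "cg u u'" for u u'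
    using h_NS[of "u - u'"] that by (simp add: cg_def additive_map_simps[OF h_add])
  have h_lmul: "h (lmul c u) = (\<lambda>i. c * h u i)" for c u
    by (rule additive_map_eq_frag[of "\<lambda>u. h (lmul c u)"])
       (auto simp: additive_map_def additive_map_simps[OF h_add] frag_extend_add
         fun_eq_iff algebra_simps lmul_def h_of G_left)
  have h_rmul: "h (rmul s u) = (\<lambda>i. h u i * s)" if "s \<in> S" for s u
    by (rule additive_map_eq_frag[of "\<lambda>u. h (rmul s u)"])
       (auto simp: additive_map_def additive_map_simps[OF h_add] frag_extend_add
         fun_eq_iff algebra_simps rmul_def h_of G_right that)
  \<comment> \<open>The inverse: \<open>w\<close> stands for the sum of the tensors
    \<open>w j \<otimes> v j\<close>, which \<open>galois_inv\<close> pulls back.\<close>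
  define r where "r = (\<lambda>w. \<Sum>j<n. galois_inv (w j) (v j))"
  have r_add: "cg (r (w + w')) (r w + r w')" for w w'
    unfolding r_def sum.distrib[symmetric] by (rule cg_sum) (simp add: cg_galois_inv_add)
  have h_galois: "h (galois_inv x z) i = (if i < n then scale (\<gamma> i z) x else 0)" for x z i
  proof -
    have "h (galois_inv x z) i = (if i < n then sw (\<lambda>e z'. sw (\<lambda>p q. scale (\<gamma> i q) (x * (\<sigma> e * p))) z') z else 0)"
      by (simp add: galois_inv_def additive_map_simps(5)[OF h_add] sum_fun_apply h_of G_def mult.assoc) (simp add: sw_def)
    also have "sw (\<lambda>e z'. sw (\<lambda>p q. scale (\<gamma> i q) (x * (\<sigma> e * p))) z') z = scale (\<gamma> i z) (x * 1)"
      by (rule sw_S_id'(2)[where H = "\<lambda>u v. scale (\<gamma> i v) (x * u)"]) (rule G_bal)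
    finally show ?thesis by simp
  qed
  have h_r: "h (r w) = w" if "w \<in> free_mod n" for w :: "nat \<Rightarrow> 'a"
  proof
    fix i
    have "h (r w) i = (if i < n then \<Sum>j<n. scale (\<gamma> i (v j)) (w j) else 0)"
      by (simp add: r_def additive_map_simps(5)[OF h_add] sum_fun_apply h_galois)
    also have "\<dots> = w i"
      using that by (auto simp: free_mod_def \<gamma>_v if_distrib[of "\<lambda>z. scale z _"] cong: if_cong)
    finally show "h (r w) i = w i" .
  qed
  have r_h: "cg (r (h u)) u" for u
  proof -
    have "Poly_Mapping.keys u \<subseteq> UNIV" by simp
    then show ?thesis
    proof (induction u rule: frag_induction)
      case zero
      show ?case unfolding additive_map_simps(2)[OF h_add] by (rule cg_additive(1)[of r, OF r_add])
    next
      case (diff a b)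
      have "cg (r (h a - h b)) (r (h a) - r (h b))" by (rule cg_additive(2)[of r, OF r_add])
      also have "cg \<dots> (a - b)" using diff by (rule cg_diff)
      finally show ?case by (simp only: additive_map_simps(4)[OF h_add])
    next
      case (one xy)
      obtain x y where xy: "xy = (x, y)" by (cases xy)
      have "cg (r (h (tp x y))) (\<Sum>j<n. galois_inv (\<Sum>b\<in>Basis. scale (\<gamma> j (D b y)) (x * b)) (v j))"
        by (simp add: r_def h_of G_def sw_def)
      also have "cg \<dots> (\<Sum>j<n. \<Sum>b\<in>Basis. galois_inv (x * b) (scale (\<gamma> j (D b y)) (v j)))"
        by (rule cg_sum, rule cg_trans[OF cg_galois_inv_sum(1)], rule cg_sum, rule cg_galois_inv_scale)
      also have "cg \<dots> (\<Sum>b\<in>Basis. \<Sum>j<n. galois_inv (x * b) (scale (\<gamma> j (D b y)) (v j)))"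
        by (rule cg_eq, rule sum.swap)
      also have "cg \<dots> (\<Sum>b\<in>Basis. galois_inv (x * b) (\<Sum>j<n. scale (\<gamma> j (D b y)) (v j)))"
        by (rule cg_sum, rule cg_sym, rule cg_galois_inv_sum(2))
      \<comment> \<open>The combination of the \<open>v j\<close> differs from \<open>D b y\<close>
        by an element of \<open>S^+ A\<close>, where \<open>galois_inv\<close> vanishes.\<close>
      also have "cg \<dots> (\<Sum>b\<in>Basis. galois_inv (x * b) (D b y))"
      proof (rule cg_sum)
        fix b
        let ?z = "\<Sum>j<n. scale (\<gamma> j (D b y)) (v j)"
        have "cg (galois_inv (x * b) (D b y - ?z)) 0" by (rule cg_galois_inv_ext_aug[OF v_span])
        then have "cg (galois_inv (x * b) (D b y) - galois_inv (x * b) ?z) 0"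
          by (rule cg_trans[OF cg_sym[OF cg_additive(2)[of "galois_inv (x * b)", OF cg_galois_inv_add(2)]]])
        then show "cg (galois_inv (x * b) ?z) (galois_inv (x * b) (D b y))"
          by (auto simp: cg_def intro: cg_sym[unfolded cg_def])
      qed
      also have "cg \<dots> (tp x y)" by (rule cg_galois_inv_comult)
      finally show ?case by (simp add: xy)
    qed
  qed
  have h_free: "h u \<in> free_mod n" for u by (auto simp: free_mod_def h_def)
  let ?T = "quotient_space NS"
  define \<phi> where "\<phi> = (\<lambda>t. h (tensor_rep t))"
  have \<phi>: "\<phi> (coset NS u) = h u" for u
    unfolding \<phi>_def using tensor_rep_coset[OF subgroup_NS, of u] by (intro h_cg) (simp add: cg_def)
  have bij: "bij_betw \<phi> ?T (free_mod n)"
  proof (rule bij_betw_imageI)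
    show "inj_on \<phi> ?T"
    proof (rule inj_onI)
      fix t t' assume "t \<in> ?T" "t' \<in> ?T" "\<phi> t = \<phi> t'"
      then obtain u u' where u: "t = coset NS u" "t' = coset NS u'" "h u = h u'"
        by (auto simp: quotient_space_def \<phi>)
      then have "cg u u'" using cg_trans[OF cg_sym[OF r_h[of u]]] r_h[of u'] by simp
      then show "t = t'" by (simp add: u coset_eq_iff[OF subgroup_NS] cg_def)
    qed
    show "\<phi> ` ?T = free_mod n"
    proof (intro equalityI subsetI)
      fix w :: "nat \<Rightarrow> 'a" assume "w \<in> free_mod n"
      then have "w = \<phi> (coset NS (r w))" by (simp add: \<phi> h_r)
      then show "w \<in> \<phi> ` ?T" by (simp add: quotient_space_def)
    qed (auto simp: quotient_space_def \<phi> h_free)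
  qed
  have M: "subbimodule S n (free_mod n)" "subbimodule S n {0}"
    by (auto simp: subbimodule_def free_mod_def fun_eq_iff)
  have M2: "free_mod n \<inter> {0} = ({0} :: (nat \<Rightarrow> 'a) set)" "free_mod n + {0} = (free_mod n :: (nat \<Rightarrow> 'a) set)"
    by (auto simp: free_mod_def set_plus_def)
  have add: "\<forall>t\<in>?T. \<forall>t'\<in>?T. \<phi> (t + t') = \<phi> t + \<phi> t'"
    by (auto simp: quotient_space_def coset_add[OF subgroup_NS] \<phi> additive_map_simps[OF h_add])
  have left: "\<forall>a. \<forall>t\<in>?T. \<phi> (tensor_map NS (\<lambda>(x, y). frag_of (a * x, y)) t) = (\<lambda>i. a * \<phi> t i)"
    by (auto simp: quotient_space_def tensor_map_lmul \<phi> h_lmul)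
  have right: "\<forall>b\<in>S. \<forall>t\<in>?T. \<phi> (tensor_map NS (\<lambda>(x, y). frag_of (x, y * b)) t) = (\<lambda>i. \<phi> t i * b)"
    by (auto simp: quotient_space_def tensor_map_rmul \<phi> h_rmul)
  show ?thesis
    unfolding right_depth_two_def Let_def
    by (intro exI[of _ n] exI[of _ "free_mod n"] exI[of _ "{0}"] exI[of _ \<phi>] conjI n M M2 bij add left right)
qed

lemma equivalences:
  "left_normal \<Delta> \<sigma> S \<longleftrightarrow> aug_left_stable" "right_depth_two S \<longleftrightarrow> aug_left_stable"
  "rieffel_normal S \<longleftrightarrow> aug_left_stable"
  using aug_left_stable_if_left_normal left_normal_if_aug_left_stable right_depth_two_if_aug_left_stable
    aug_left_stable_if_right_depth_two rieffel_normal_if_left_normal aug_left_stable_if_rieffel_normal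
  by blast+

end

theorem mainTheorem5:
  fixes scale :: "'k::field \<Rightarrow> 'a::ring_1 \<Rightarrow> 'a"
    and \<Delta> :: "'a \<Rightarrow> ('a \<times> 'a) frag set"
    and \<epsilon> :: "'a \<Rightarrow> 'k"
    and \<sigma> :: "'a \<Rightarrow> 'a"
    and S :: "'a set"
  assumes hopf: "hopf_algebra scale \<Delta> \<epsilon> \<sigma>"
    and findim: "\<exists>Basis. finite_dimensional_vector_space scale Basis"
    and coideal: "left_coideal_subalgebra scale \<Delta> S"
  shows "(left_normal \<Delta> \<sigma> S \<longleftrightarrow> right_depth_two S) \<and>
         (right_depth_two S \<longleftrightarrow> rieffel_normal S)"
proof -
  obtain Basis where Basis: "finite_dimensional_vector_space scale Basis" using findim by blast
  interpret fd_hopf_algebra scale \<Delta> \<epsilon> \<sigma> Basis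
    using hopf Basis by (rule fd_hopf_algebra.intro)
  interpret coideal_subalgebra scale \<Delta> \<epsilon> \<sigma> Basis S
    using coideal left_coideal_D[OF coideal] by unfold_locales (simp_all add: left_coideal_subalgebra_def)
  show ?thesis by (simp add: equivalences)
qed

end
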